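(* Let $\mathcal M$ be a simple oriented matroid of rank $3$ with at least $7$ elements that is almost positively oriented. Then $\mathcal M$ is isomorphic to a positively oriented matroid.
   Context: Oriented matroids are given by signed circuits on a finite ground set $E$; simple means no loops (circuits $(\{e\},\emptyset)$) and no parallel or antiparallel pairs (circuits $(\{e\},\{f\})$ or $(\{e,f\},\emptyset)$). The chirotope $\chi:E^r\to\{+,-,0\}$ of a rank-$r$ oriented matroid is determined up to global sign by the circuits (for a vector configuration, $\chi(i_1,\dots,i_r)$ is the sign of $\det(\mathbf v_{i_1},\dots,\mathbf v_{i_r})$). An oriented matroid is positively oriented if there is a total order $\prec$ on $E$ (and a choice of chirotope) with $\chi(i_1,\dots,i_r)\in\{0,+\}$ whenever $i_1\prec\dots\prec i_r$. A rank-$3$ oriented matroid $\mathcal M$ is almost positively oriented if for every $e\in E$ the deletion $\mathcal M\setminus e$ (circuits of $\mathcal M$ whose support avoids $e$) is isomorphic to a positively oriented matroid. Isomorphism: reorientation (swapping signs of the elements of a fixed subset in every circuit) followed by bijective relabeling. *)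

theory Defs
  imports Main
begin

text \<open>Signed subsets of the ground set: pairs (positive part, negative part).\<close>
type_synonym 'a signed_set = "'a set \<times> 'a set"

definition supp :: "'a signed_set \<Rightarrow> 'a set" where
  "supp X = fst X \<union> snd X"

definition sneg :: "'a signed_set \<Rightarrow> 'a signed_set" where
  "sneg X = (snd X, fst X)"

definition oriented_matroid :: "'a set \<Rightarrow> 'a signed_set set \<Rightarrow> bool" where
  "oriented_matroid E C \<longleftrightarrow>
     finite E \<and>
     (\<forall>X\<in>C. fst X \<inter> snd X = {} \<and> supp X \<subseteq> E) \<and>
     ({}, {}) \<notin> C \<and>
     (\<forall>X\<in>C. sneg X \<in> C) \<and>
     (\<forall>X\<in>C. \<forall>Y\<in>C. supp X \<subseteq> supp Y \<longrightarrow> X = Y \<or> X = sneg Y) \<and>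
     (\<forall>X\<in>C. \<forall>Y\<in>C. \<forall>e. X \<noteq> sneg Y \<and> e \<in> fst X \<inter> snd Y \<longrightarrow>
        (\<exists>Z\<in>C. fst Z \<subseteq> (fst X \<union> fst Y) - {e} \<and> snd Z \<subseteq> (snd X \<union> snd Y) - {e}))"

definition om_indep :: "'a signed_set set \<Rightarrow> 'a set \<Rightarrow> bool" where
  "om_indep C I \<longleftrightarrow> (\<forall>X\<in>C. \<not> supp X \<subseteq> I)"

definition om_rank :: "'a set \<Rightarrow> 'a signed_set set \<Rightarrow> nat" where
  "om_rank E C = Max {card I | I. I \<subseteq> E \<and> om_indep C I}"

definition om_basis :: "'a set \<Rightarrow> 'a signed_set set \<Rightarrow> 'a set \<Rightarrow> bool" where
  "om_basis E C B \<longleftrightarrow> B \<subseteq> E \<and> om_indep C B \<and> card B = om_rank E C"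

definition simple_om :: "'a set \<Rightarrow> 'a signed_set set \<Rightarrow> bool" where
  "simple_om E C \<longleftrightarrow>
     (\<forall>e. ({e}, {}) \<notin> C) \<and>
     (\<forall>e f. e \<noteq> f \<longrightarrow> ({e}, {f}) \<notin> C \<and> ({e, f}, {}) \<notin> C)"

definition sgn_at :: "'a signed_set \<Rightarrow> 'a \<Rightarrow> int" where
  "sgn_at X e = (if e \<in> fst X then 1 else if e \<in> snd X then -1 else 0)"

text \<open>chi is a chirotope of the rank-r oriented matroid (E,C): an alternating sign map on
  r-tuples of E, non-zero exactly on ordered bases, compatible with the signed circuits
  (for a circuit X, distinct e,f in supp X and xs with supp X contained in {e,f} and set xs:
   chi(f,xs) = - X(e) X(f) chi(e,xs)).  It is determined by C up to a global sign.\<close>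
definition chirotope_of :: "'a set \<Rightarrow> 'a signed_set set \<Rightarrow> ('a list \<Rightarrow> int) \<Rightarrow> bool" where
  "chirotope_of E C chi \<longleftrightarrow>
     (let r = om_rank E C in
      (\<forall>xs. chi xs \<in> {-1, 0, 1}) \<and>
      (\<forall>xs. set xs \<subseteq> E \<and> length xs = r \<longrightarrow>
          (chi xs \<noteq> 0 \<longleftrightarrow> distinct xs \<and> om_basis E C (set xs))) \<and>
      (\<forall>xs i j. set xs \<subseteq> E \<and> length xs = r \<and> i < j \<and> j < r \<longrightarrow>
          chi (xs[i := xs ! j, j := xs ! i]) = - chi xs) \<and>
      (\<forall>X\<in>C. \<forall>e f xs. e \<in> supp X \<and> f \<in> supp X \<and> e \<noteq> f \<and> set xs \<subseteq> E \<and>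
          length xs + 1 = r \<and> supp X \<subseteq> {e, f} \<union> set xs \<longrightarrow>
          chi (f # xs) = - sgn_at X e * sgn_at X f * chi (e # xs)))"

definition positively_oriented :: "'a set \<Rightarrow> 'a signed_set set \<Rightarrow> bool" where
  "positively_oriented E C \<longleftrightarrow>
     (\<exists>(ord :: 'a \<Rightarrow> nat) chi. inj_on ord E \<and> chirotope_of E C chi \<and>
        (\<forall>xs. set xs \<subseteq> E \<and> length xs = om_rank E C \<and>
              sorted_wrt (\<lambda>x y. ord x < ord y) xs \<longrightarrow> chi xs \<ge> 0))"

definition reorient :: "'a set \<Rightarrow> 'a signed_set \<Rightarrow> 'a signed_set" where
  "reorient A X = ((fst X - A) \<union> (snd X \<inter> A), (snd X - A) \<union> (fst X \<inter> A))"

definition relabel :: "('a \<Rightarrow> 'b) \<Rightarrow> 'a signed_set \<Rightarrow> 'b signed_set" where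
  "relabel s X = (s ` fst X, s ` snd X)"

definition om_iso :: "'a set \<Rightarrow> 'a signed_set set \<Rightarrow> 'b set \<Rightarrow> 'b signed_set set \<Rightarrow> bool" where
  "om_iso E C E' C' \<longleftrightarrow>
     (\<exists>A s. A \<subseteq> E \<and> bij_betw s E E' \<and> C' = (\<lambda>X. relabel s (reorient A X)) ` C)"

definition deletion :: "'a set \<Rightarrow> 'a signed_set set \<Rightarrow> 'a \<Rightarrow> 'a set \<times> 'a signed_set set" where
  "deletion E C e = (E - {e}, {X \<in> C. e \<notin> supp X})"

definition iso_to_positively_oriented :: "'a set \<Rightarrow> 'a signed_set set \<Rightarrow> bool" where
  "iso_to_positively_oriented E C \<longleftrightarrow>
     (\<exists>(E' :: 'a set) C'. oriented_matroid E' C' \<and> positively_oriented E' C' \<and> om_iso E C E' C')"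

definition almost_positively_oriented :: "'a set \<Rightarrow> 'a signed_set set \<Rightarrow> bool" where
  "almost_positively_oriented E C \<longleftrightarrow>
     om_rank E C = 3 \<and>
     (\<forall>e\<in>E. iso_to_positively_oriented (fst (deletion E C e)) (snd (deletion E C e)))"

end

theory Submission
  imports Defs
begin

text \<open>
  Work with a chirotope \<open>\<chi>\<close> on triples. It suffices to find signs and an order that make \<open>\<chi>\<close>
  nonnegative on increasing triples, and each deletion has such signs and such an order.

  If a line has at least four points, delete one of them, \<open>e\<close>: either \<open>e\<close> can be inserted between two
  neighbours on the line, or the cut of the projective line in the order of the deletion sits exactly
  at \<open>e\<close>, and this cannot happen for four points \<open>e\<close> of the same line.
  If all lines have at most three points, then for a three-point line \<open>x, y, z\<close> the deletions of points
  off the line agree on which point, say \<open>y\<close>, is the middle one; \<open>y\<close> is then inserted between \<open>x\<close> and \<open>z\<close>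
  in an order of the deletion of \<open>y\<close>, after ruling out or repairing configurations of seven points in which
  \<open>x\<close> and \<open>z\<close> are not neighbours.
  If there are no three collinear points, sort the other points around a point \<open>p\<close>. Each deletion of a
  point other than \<open>p\<close> then determines signs, and by uniqueness these signs glue.
\<close>

section \<open>Signs, orders and chirotopes\<close>

text \<open>The rank is odd: cyclic rotation keeps an order positive, so an order may be cut
  wherever convenient, and the global sign of a chirotope is itself a reorientation. The obstacle is
  that the deletions come with unrelated signs and orders. On lines with at least three points they
  are compared through products of values of \<open>\<chi>\<close> in which every element occurs an
  even number of times, which no reorientation changes. Four points of a long line cannot all fail
  because exactly one of the three ways to pair up four points of a projective line is crossing,
  while the failures forbid crossings. The number 7 enters in three ways: a sign at \<open>i\<close>
  is read off from three points other than \<open>p\<close>, \<open>i\<close> and the two deleted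
  points; the points off a three-point line must outnumber the points on it; and six points beside
  \<open>y\<close> leave only a short list of exceptional configurations. The hypotheses provide
  chirotopes of deletions only; one of the whole matroid is obtained by extending one of these by a
  single element, and uniqueness up to sign carries the other deletions over to it.\<close>

definition sg3 :: "int \<Rightarrow> int \<Rightarrow> int \<Rightarrow> int" where
  "sg3 a b c = sgn (b - a) * sgn (c - a) * sgn (c - b)"

lemma ex_notin_list: "length xs < card A \<Longrightarrow> \<exists>x\<in>A. x \<notin> set xs"
  using card_mono[of "set xs" A] card_length[of xs] by fastforce

text \<open>The chirotope after reorienting the elements where \<open>r\<close> is -1. With a sign
  function instead of a subset, composition is a pointwise product.\<close>

definition resign :: "('a \<Rightarrow> int) \<Rightarrow> ('a \<Rightarrow> 'a \<Rightarrow> 'a \<Rightarrow> int) \<Rightarrow> 'a \<Rightarrow> 'a \<Rightarrow> 'a \<Rightarrow> int" where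
  "resign r \<chi> x y z = r x * r y * r z * \<chi> x y z"

definition sign_fun :: "('a \<Rightarrow> int) \<Rightarrow> bool" where
  "sign_fun r \<longleftrightarrow> (\<forall>x. r x = 1 \<or> r x = -1)"

text \<open>Multiplying by \<open>sg3\<close> instead of restricting to increasing triples makes positivity visibly
  invariant under cyclic rotation of the order.\<close>

definition pos_on :: "'a set \<Rightarrow> ('a \<Rightarrow> 'a \<Rightarrow> 'a \<Rightarrow> int) \<Rightarrow> ('a \<Rightarrow> int) \<Rightarrow> bool" where
  "pos_on S \<chi> h \<longleftrightarrow> inj_on h S \<and>
     (\<forall>x\<in>S. \<forall>y\<in>S. \<forall>z\<in>S. 0 \<le> \<chi> x y z * sg3 (h x) (h y) (h z))"

text \<open>Isomorphism to a positively oriented matroid, in terms of the chirotope; the relabelling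
  is absorbed in the choice of \<open>h\<close>.\<close>

definition pos_iso :: "'a set \<Rightarrow> ('a \<Rightarrow> 'a \<Rightarrow> 'a \<Rightarrow> int) \<Rightarrow> bool" where
  "pos_iso S \<chi> \<longleftrightarrow> (\<exists>r h. sign_fun r \<and> pos_on S (resign r \<chi>) h)"

lemma sgn_diff_pm: "a \<noteq> b \<Longrightarrow> sgn (b - a :: int) = 1 \<or> sgn (b - a) = -1"
  by (auto simp: sgn_if)

text \<open>\<open>sg3\<close> is the sign of a Vandermonde determinant, so it is alternating; a
  cyclic shift of three arguments is an even permutation.\<close>

lemma sg3_cyc: "sg3 b c a = sg3 a b c"
  by (auto simp: sg3_def sgn_if)

lemma sg3_swap: "sg3 b a c = - sg3 a b c" "sg3 a c b = - sg3 a b c"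
  by (auto simp: sg3_def sgn_if)

lemma sg3_sorted [simp]: "a < b \<Longrightarrow> b < c \<Longrightarrow> sg3 a b c = 1"
  by (auto simp: sg3_def sgn_if)

lemma sg3_refl [simp]: "sg3 a a c = 0" "sg3 a c a = 0" "sg3 c a a = 0"
  by (auto simp: sg3_def)

lemma sign_fun_sq: "sign_fun r \<Longrightarrow> r x * r x = 1"
  unfolding sign_fun_def by (drule spec[of _ x]) auto

lemma sign_fun_mult: "sign_fun r \<Longrightarrow> sign_fun s \<Longrightarrow> sign_fun (\<lambda>x. r x * s x)"
  unfolding sign_fun_def
proof (intro allI)
  fix x assume "\<forall>x. r x = 1 \<or> r x = -1" "\<forall>x. s x = 1 \<or> s x = -1"
  then show "r x * s x = 1 \<or> r x * s x = -1" by (auto dest!: spec[of _ x])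
qed

lemma resign_resign: "resign r (resign s \<chi>) = resign (\<lambda>x. r x * s x) \<chi>"
  by (intro ext) (simp add: resign_def algebra_simps)

lemma resign_sq: "sign_fun r \<Longrightarrow> resign r (resign r \<chi>) = \<chi>"
  unfolding resign_resign by (intro ext) (simp add: resign_def sign_fun_sq)

lemma pos_iso_resign:
  assumes r: "sign_fun r"
  shows "pos_iso S (resign r \<chi>) \<longleftrightarrow> pos_iso S \<chi>"
proof -
  have 1: "pos_iso S \<chi> \<Longrightarrow> pos_iso S (resign r \<chi>)" if "sign_fun r" for r and \<chi> :: "'a \<Rightarrow> 'a \<Rightarrow> 'a \<Rightarrow> int"
  proof -
    assume "pos_iso S \<chi>"
    then obtain s h where s: "sign_fun s" "pos_on S (resign s \<chi>) h" unfolding pos_iso_def by auto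
    have "resign (\<lambda>x. s x * r x) (resign r \<chi>) = resign s (resign r (resign r \<chi>))"
      unfolding resign_resign by (simp add: mult.assoc)
    then have "pos_on S (resign (\<lambda>x. s x * r x) (resign r \<chi>)) h" using s resign_sq[OF that] by simp
    then show ?thesis unfolding pos_iso_def using sign_fun_mult[OF s(1) that] by blast
  qed
  show ?thesis using 1[OF r, of \<chi>] 1[OF r, of "resign r \<chi>"] resign_sq[OF r] by metis
qed

lemma pos_iso_of_pos_on: "pos_on S \<chi> h \<Longrightarrow> pos_iso S \<chi>"
  unfolding pos_iso_def by (rule exI[of _ "\<lambda>_. 1"]) (auto simp: sign_fun_def resign_def[abs_def])

lemma pos_onD: "pos_on S \<chi> h \<Longrightarrow> x \<in> S \<Longrightarrow> y \<in> S \<Longrightarrow> z \<in> S \<Longrightarrow> 0 \<le> \<chi> x y z * sg3 (h x) (h y) (h z)"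
  unfolding pos_on_def by blast

lemma pos_on_sorted: "pos_on S \<chi> h \<Longrightarrow> x \<in> S \<Longrightarrow> y \<in> S \<Longrightarrow> z \<in> S \<Longrightarrow> h x < h y \<Longrightarrow> h y < h z \<Longrightarrow> 0 \<le> \<chi> x y z"
  using pos_onD[of S \<chi> h x y z] by simp

lemma pos_on_neq: "pos_on S \<chi> h \<Longrightarrow> x \<in> S \<Longrightarrow> y \<in> S \<Longrightarrow> x \<noteq> y \<Longrightarrow> h x \<noteq> h y"
  unfolding pos_on_def inj_on_def by blast

text \<open>An order may be cut at any element \<open>w\<close> because the rank is odd: a shift of
  the cut permutes the entries of each triple cyclically, hence evenly.\<close>

lemma pos_on_rotate:
  assumes p: "pos_on S \<chi> h" and S: "finite S" "w \<in> S"
  obtains k where "pos_on S \<chi> k" "\<forall>x\<in>S. x \<noteq> w \<longrightarrow> k w < k x"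
    "\<forall>x y. h w \<le> h x \<longrightarrow> h x < h y \<longrightarrow> k x < k y"
    "\<forall>x y. h x < h y \<longrightarrow> h y < h w \<longrightarrow> k x < k y"
    "\<forall>x\<in>S. \<forall>y\<in>S. h x < h w \<longrightarrow> h w \<le> h y \<longrightarrow> k y < k x"
proof -
  have "finite (h ` S)" using S by simp
  then obtain M where M: "\<forall>x\<in>S. h x \<le> M" using S by (metis Max_ge finite_imageI imageI)
  obtain m where m: "\<forall>x\<in>S. m \<le> h x" using \<open>finite (h ` S)\<close> S by (metis Min_le imageI)
  \<comment> \<open>\<open>N\<close> exceeds the range of \<open>h\<close> on \<open>S\<close>, so
    the elements below \<open>w\<close> move above all the others.\<close>
  define N where "N = M - m + 1"
  define k where "k x = (if h x < h w then h x + N else h x)" for x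
  have kk: "k y < k x" if "h x < h w" "y \<in> S" "x \<in> S" "h w \<le> h y" for x y
  proof -
    have "h y \<le> M" "m \<le> h x" using M m that by blast+
    then show ?thesis unfolding k_def N_def using that by simp
  qed
  have inj: "inj_on h S" using p unfolding pos_on_def by blast
  have "inj_on k S"
    unfolding inj_on_def
  proof (intro ballI impI)
    fix x y assume xy: "x \<in> S" "y \<in> S" "k x = k y"
    have "h x = h y"
    proof (cases "(h x < h w) = (h y < h w)")
      case True then show ?thesis using xy(3) unfolding k_def by (simp split: if_splits)
    next
      case False
      then show ?thesis using kk[of x y] kk[of y x] xy by (metis less_irrefl not_le)
    qed
    then show "x = y" using inj xy unfolding inj_on_def by blast
  qed
  moreover have "sg3 (k x) (k y) (k z) = sg3 (h x) (h y) (h z)" if "x \<in> S" "y \<in> S" "z \<in> S" for x y z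
  proof -
    have a: "sgn (k y - k x) = sgn (h y - h x) * (if (h x < h w) = (h y < h w) then 1 else -1)"
      if "x \<in> S" "y \<in> S" for x y
    proof (cases "(h x < h w) = (h y < h w)")
      case True then show ?thesis unfolding k_def by auto
    next
      case False
      then have "h x < h w \<and> h w \<le> h y \<or> h y < h w \<and> h w \<le> h x" by auto
      then show ?thesis
      proof
        assume c: "h x < h w \<and> h w \<le> h y"
        then have "k y < k x" using kk that by blast
        then show ?thesis using c by simp
      next
        assume c: "h y < h w \<and> h w \<le> h x"
        then have "k x < k y" using kk that by blast
        then show ?thesis using c by simp
      qed
    qed
    show ?thesis unfolding sg3_def a[OF that(1,2)] a[OF that(1,3)] a[OF that(2,3)]
      by (cases "h x < h w"; cases "h y < h w"; cases "h z < h w") simp_all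
  qed
  ultimately have "pos_on S \<chi> k" using p unfolding pos_on_def by simp
  moreover have "\<forall>x\<in>S. x \<noteq> w \<longrightarrow> k w < k x"
  proof (intro ballI impI)
    fix x assume x: "x \<in> S" "x \<noteq> w"
    then have "h x \<noteq> h w" using inj S(2) unfolding inj_on_def by blast
    then show "k w < k x" using kk[of x w] x S by (cases "h x < h w") (simp_all add: k_def)
  qed
  moreover have "\<forall>x y. h w \<le> h x \<longrightarrow> h x < h y \<longrightarrow> k x < k y" "\<forall>x y. h x < h y \<longrightarrow> h y < h w \<longrightarrow> k x < k y"
    unfolding k_def by simp_all
  ultimately show ?thesis using kk that[of k] by blast
qed

text \<open>\<open>gp\<close> is the three-term Grassmann-Pluecker relation [ac][bd] = [ab][cd] +
  [ad][bc] in the contraction by \<open>w\<close>, reduced to signs: the left side is determined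
  unless the two terms on the right have opposite signs. The first four laws after finiteness hold
  for all arguments, which avoids membership conditions; \<open>simple\<close> says that any two
  distinct points extend to a basis.\<close>

locale chiro =
  fixes E :: "'a set" and \<chi> :: "'a \<Rightarrow> 'a \<Rightarrow> 'a \<Rightarrow> int"
  assumes fin: "finite E"
    and val: "\<chi> x y z = 0 \<or> \<chi> x y z = 1 \<or> \<chi> x y z = -1"
    and alt1: "\<chi> y x z = - \<chi> x y z"
    and alt2: "\<chi> x z y = - \<chi> x y z"
    and gp: "0 \<le> (\<chi> w a b * \<chi> w c d) * (\<chi> w a d * \<chi> w b c) \<Longrightarrow>
        \<chi> w a c * \<chi> w b d = sgn (\<chi> w a b * \<chi> w c d + \<chi> w a d * \<chi> w b c)"
    and simple: "x \<in> E \<Longrightarrow> y \<in> E \<Longrightarrow> x \<noteq> y \<Longrightarrow> \<exists>z\<in>E. \<chi> x y z \<noteq> 0"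
begin

lemma cyc: "\<chi> y z x = \<chi> x y z"
  by (metis add.inverse_inverse alt1 alt2)

lemma rep [simp]: "\<chi> x x z = 0" "\<chi> x z x = 0" "\<chi> z x x = 0"
  using alt1[of x x z] alt1[of x z x] alt2[of z x x] alt2[of x z x] by (auto simp: cyc)

lemma chiro_resign: "sign_fun r \<Longrightarrow> chiro E (resign r \<chi>)"
proof (unfold_locales, goal_cases)
  case 1 show ?case by (rule fin)
next
  case (2 x y z)
  then have "r x = 1 \<or> r x = -1" "r y = 1 \<or> r y = -1" "r z = 1 \<or> r z = -1" unfolding sign_fun_def by blast+
  then show ?case using val[of x y z] unfolding resign_def by auto
next
  case (3 y x z) show ?case unfolding resign_def by (subst alt1) simp
next
  case (4 x z y) show ?case unfolding resign_def by (subst alt2) simp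
next
  case (5 w a b c d)
  define k where "k = r a * r b * r c * r d"
  have "r a = 1 \<or> r a = -1" "r b = 1 \<or> r b = -1" "r c = 1 \<or> r c = -1" "r d = 1 \<or> r d = -1"
    using 5(1) unfolding sign_fun_def by blast+
  then have k: "k = 1 \<or> k = -1" unfolding k_def by auto
  have w: "r w * r w = 1" by (rule sign_fun_sq[OF 5(1)])
  have e: "resign r \<chi> w p q * resign r \<chi> w u v = (r w * r w) * (r p * r q * r u * r v) * (\<chi> w p q * \<chi> w u v)"
    for p q u v unfolding resign_def by (simp add: algebra_simps)
  have e1: "resign r \<chi> w a b * resign r \<chi> w c d = k * (\<chi> w a b * \<chi> w c d)"
      "resign r \<chi> w a d * resign r \<chi> w b c = k * (\<chi> w a d * \<chi> w b c)"
      "resign r \<chi> w a c * resign r \<chi> w b d = k * (\<chi> w a c * \<chi> w b d)"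
    unfolding e w k_def by (simp_all add: algebra_simps)
  have "0 \<le> (\<chi> w a b * \<chi> w c d) * (\<chi> w a d * \<chi> w b c)" using 5(2) k unfolding e1 by auto
  then have "\<chi> w a c * \<chi> w b d = sgn (\<chi> w a b * \<chi> w c d + \<chi> w a d * \<chi> w b c)" by (rule gp)
  then show ?case using k unfolding e1 by (auto simp: sgn_if)
next
  case (6 x y)
  then obtain z where "z \<in> E" "\<chi> x y z \<noteq> 0" using simple by blast
  moreover have "r x \<noteq> 0" "r y \<noteq> 0" "r z \<noteq> 0" using 6 unfolding sign_fun_def by (metis zero_neq_neg_one zero_neq_one)+
  ultimately show ?case unfolding resign_def by auto
qed

text \<open>In the Grassmann-Pluecker relation at \<open>a\<close> with a point \<open>w\<close> off
  the line \<open>a b\<close>, only the term with \<open>\<chi> a c d\<close> survives, and its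
  cofactor is nonzero.\<close>

lemma line_trans:
  assumes "a \<in> E" "b \<in> E" "a \<noteq> b" "\<chi> a b c = 0" "\<chi> a b d = 0"
  shows "\<chi> a c d = 0"
proof -
  obtain w where w: "\<chi> a b w \<noteq> 0" using simple assms by blast
  have "\<chi> a b d * \<chi> a c w = sgn (\<chi> a b c * \<chi> a d w + \<chi> a b w * \<chi> a c d)"
    by (rule gp) (use assms in auto)
  then show ?thesis using assms w by (auto simp: sgn_0_0)
qed

lemma line_trans3:
  assumes "a \<in> E" "b \<in> E" "c \<in> E" "a \<noteq> b" "a \<noteq> c" "\<chi> a b c = 0" "\<chi> a b d = 0" "\<chi> a b e = 0"
  shows "\<chi> c d e = 0"
proof -
  have "\<chi> a c d = 0" "\<chi> a c e = 0" using line_trans assms by blast+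
  then have "\<chi> c a d = 0" "\<chi> c a e = 0" using alt1[of a c] by auto
  then show ?thesis using line_trans assms by metis
qed

text \<open>In the contraction by \<open>p\<close> the points \<open>q\<close> and \<open>t\<close>
  are parallel, so the sign relating them is the same from every viewpoint. This carries information
  about a line from one point to another.\<close>

lemma kappa:
  assumes "\<chi> p q t = 0"
  shows "\<chi> u p q * \<chi> w p t = \<chi> u p t * \<chi> w p q"
proof -
  have "\<chi> p q u * \<chi> p t w = sgn (\<chi> p q t * \<chi> p u w + \<chi> p q w * \<chi> p t u)"
    by (rule gp) (use assms in auto)
  then have "\<chi> p q u * \<chi> p t w = \<chi> p q w * \<chi> p t u"
    using assms val[of p q w] val[of p t u] by auto
  moreover have "\<chi> p q u = \<chi> u p q" "\<chi> p t w = \<chi> w p t" "\<chi> p q w = \<chi> w p q" "\<chi> p t u = \<chi> u p t"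
    by (rule cyc)+
  ultimately show ?thesis by (simp add: mult.commute)
qed

lemma pos_on_eq:
  assumes "pos_on S \<chi> h" "x \<in> S" "y \<in> S" "z \<in> S" "\<chi> x y z \<noteq> 0"
  shows "\<chi> x y z = sg3 (h x) (h y) (h z)"
proof -
  have "0 \<le> \<chi> x y z * sg3 (h x) (h y) (h z)" by (rule pos_onD[OF assms(1-4)])
  moreover have "x \<noteq> y" "y \<noteq> z" "x \<noteq> z" using assms(5) by auto
  then have "h x \<noteq> h y" "h x \<noteq> h z" "h y \<noteq> h z" using pos_on_neq[OF assms(1)] assms by metis+
  from this[THEN sgn_diff_pm] have "sg3 (h x) (h y) (h z) = 1 \<or> sg3 (h x) (h y) (h z) = -1"
    unfolding sg3_def by (elim disjE) simp_all
  ultimately show ?thesis using val[of x y z] assms(5) by auto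
qed

text \<open>On a line of a positively ordered set, the cyclic order has all other points in one gap.\<close>

lemma line_gap1:
  assumes p: "pos_on S \<chi> h" and S: "p \<in> S" "q \<in> S" "t \<in> S" "u \<in> S" "w \<in> S"
    and col: "\<chi> p q t = 0" and off: "\<chi> u p q \<noteq> 0" "\<chi> u p t \<noteq> 0" "\<chi> w p q \<noteq> 0" "\<chi> w p t \<noteq> 0" "q \<noteq> t"
  shows "sgn (h q - h w) * sgn (h q - h u) = sgn (h t - h w) * sgn (h t - h u)"
proof -
  note e = pos_on_eq[OF p]
  have "h u \<noteq> h p" "h u \<noteq> h q" "h u \<noteq> h t" "h w \<noteq> h p" "h w \<noteq> h q" "h w \<noteq> h t" "h p \<noteq> h q" "h p \<noteq> h t"
    using pos_on_neq[OF p] S off by (metis rep)+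
  note n = this[THEN sgn_diff_pm]
  have "sg3 (h u) (h p) (h q) * sg3 (h w) (h p) (h t) = sg3 (h u) (h p) (h t) * sg3 (h w) (h p) (h q)"
    using kappa[OF col, of u w] e[of u p q] e[of w p t] e[of u p t] e[of w p q] S off by simp
  then have "(sgn (h p - h u) * sgn (h p - h w) * sgn (h q - h p) * sgn (h t - h p)) *
      (sgn (h q - h u) * sgn (h t - h w)) =
      (sgn (h p - h u) * sgn (h p - h w) * sgn (h q - h p) * sgn (h t - h p)) *
      (sgn (h t - h u) * sgn (h q - h w))"
    unfolding sg3_def by (simp only: mult_ac)
  moreover have "sgn (h p - h u) * sgn (h p - h w) * sgn (h q - h p) * sgn (h t - h p) \<noteq> 0"
    using n(1,4,7,8) by auto
  ultimately have "sgn (h q - h u) * sgn (h t - h w) = sgn (h t - h u) * sgn (h q - h w)"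
    by simp
  then show ?thesis using n(2,3,5,6) by (elim disjE) simp_all
qed

end

section \<open>Inserting a point\<close>

lemma cross_aux:
  fixes Q :: int
  shows "0 \<le> (Q * (A * A)) * (Q * (B * B))"
proof -
  have "(Q * (A * A)) * (Q * (B * B)) = (Q * A * B) * (Q * A * B)" by (simp add: algebra_simps)
  then show ?thesis by (metis zero_le_square)
qed

section \<open>Betweenness on a line and insertion of a point\<close>

context chiro
begin

text \<open>Oriented-matroid form of \<open>e\<close> lying in the cone spanned by \<open>p\<close>
  and \<open>q\<close>: no line \<open>x y\<close> has both \<open>p\<close> and \<open>q\<close>
  weakly on one side and \<open>e\<close> strictly on the other. The factor \<open>c\<close> selects
  the side.\<close>

definition btw :: "'a \<Rightarrow> 'a \<Rightarrow> 'a \<Rightarrow> bool" where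
  "btw e p q \<longleftrightarrow> (\<forall>x\<in>E. \<forall>y\<in>E. \<forall>c. 0 \<le> \<chi> p x y * c \<longrightarrow> 0 \<le> \<chi> q x y * c \<longrightarrow> 0 \<le> \<chi> e x y * c)"

lemma btw_sym: "btw e p q \<Longrightarrow> btw e q p"
  unfolding btw_def by blast

text \<open>One viewpoint \<open>w\<close> off the line suffices: \<open>kappa\<close> carries the
  equalities to every \<open>x\<close> off the line, and there the Grassmann-Pluecker relation
  expresses \<open>\<chi> x e y\<close> as a combination of \<open>\<chi> x p y\<close> and
  \<open>\<chi> x q y\<close> with equal signs as coefficients.\<close>

lemma btwI:
  assumes E: "e \<in> E" "p \<in> E" "q \<in> E" and col: "\<chi> p q e = 0"
    and w: "\<chi> w p e = \<chi> w p q" "\<chi> w e q = \<chi> w p q" "\<chi> w p q \<noteq> 0"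
  shows "btw e p q"
proof -
  have *: "0 \<le> \<chi> e x y * c"
    if x: "\<chi> x p q \<noteq> 0" and c: "0 \<le> \<chi> p x y * c" "0 \<le> \<chi> q x y * c" for x y c
  proof -
    have "\<chi> x p q * \<chi> w p e = \<chi> x p e * \<chi> w p q" by (rule kappa[OF col])
    then have 1: "\<chi> x p e = \<chi> x p q" using w by simp
    have "\<chi> q p e = 0" using col alt1[of q p e] by simp
    then have "\<chi> x q p * \<chi> w q e = \<chi> x q e * \<chi> w q p" by (rule kappa)
    then have 2: "\<chi> x e q = \<chi> x p q" using w alt2[of x p q] alt2[of x e q] alt2[of w p q] alt2[of w e q] by simp
    have g: "0 \<le> \<chi> x p e * \<chi> x q y * (\<chi> x p y * \<chi> x e q) \<Longrightarrow>
      \<chi> x p q * \<chi> x e y = sgn (\<chi> x p e * \<chi> x q y + \<chi> x p y * \<chi> x e q)" by (rule gp)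
    have a: "\<chi> p x y = - \<chi> x p y" "\<chi> q x y = - \<chi> x q y" "\<chi> e x y = - \<chi> x e y" by (rule alt1)+
    show ?thesis
    proof (cases c "0::int" rule: linorder_cases)
      case equal then show ?thesis by simp
    next
      case less
      then have "\<chi> x p y \<ge> 0" "\<chi> x q y \<ge> 0" using c unfolding a by (auto simp: mult_le_0_iff)
      then have "\<chi> x e y \<ge> 0" using g x val[of x p q] val[of x p y] val[of x q y] unfolding 1 2 by auto
      then show ?thesis using less unfolding a by (simp add: mult_nonneg_nonpos)
    next
      case greater
      then have "\<chi> x p y \<le> 0" "\<chi> x q y \<le> 0" using c unfolding a by (auto simp: mult_le_0_iff)
      then have "\<chi> x e y \<le> 0" using g x val[of x p q] val[of x p y] val[of x q y] unfolding 1 2 by auto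
      then show ?thesis using greater unfolding a by (simp add: mult_nonpos_nonneg)
    qed
  qed
  show ?thesis unfolding btw_def
  proof (intro ballI allI impI)
    fix x y c assume xy: "x \<in> E" "y \<in> E" and c: "0 \<le> \<chi> p x y * c" "0 \<le> \<chi> q x y * c"
    consider "\<chi> x p q \<noteq> 0" | "\<chi> y p q \<noteq> 0" | "\<chi> x p q = 0" "\<chi> y p q = 0" by blast
    then show "0 \<le> \<chi> e x y * c"
    proof cases
      case 1 then show ?thesis using * c by blast
    next
      case 2
      have a: "\<chi> p y x = - \<chi> p x y" "\<chi> q y x = - \<chi> q x y" "\<chi> e y x = - \<chi> e x y" by (rule alt2)+
      show ?thesis using *[OF 2, of x "- c"] c unfolding a by simp
    next
      case 3
      have pq: "p \<noteq> q" "p \<noteq> e" using w by auto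
      have "\<chi> p q x = 0" "\<chi> p q y = 0" using 3 cyc by metis+
      then have "\<chi> e x y = 0" using line_trans3[of p q e x y] E pq col by blast
      then show ?thesis by simp
    qed
  qed
qed

lemma pos_on_splitI:
  assumes inj: "inj_on k S"
    and core: "\<And>x y. x \<in> S - {e} \<Longrightarrow> y \<in> S - {e} \<Longrightarrow> 0 \<le> \<chi> e x y * sg3 (k e) (k x) (k y)"
    and rest: "\<And>x y z. x \<in> S - {e} \<Longrightarrow> y \<in> S - {e} \<Longrightarrow> z \<in> S - {e} \<Longrightarrow> 0 \<le> \<chi> x y z * sg3 (k x) (k y) (k z)"
  shows "pos_on S \<chi> k"
  unfolding pos_on_def
proof (intro conjI ballI inj)
  fix x y z assume xyz: "x \<in> S" "y \<in> S" "z \<in> S"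
  show "0 \<le> \<chi> x y z * sg3 (k x) (k y) (k z)"
  proof (cases "x = y \<or> y = z \<or> x = z")
    case False
    then consider "x \<noteq> e" "y \<noteq> e" "z \<noteq> e" | "x = e" "y \<noteq> e" "z \<noteq> e"
      | "y = e" "x \<noteq> e" "z \<noteq> e" | "z = e" "x \<noteq> e" "y \<noteq> e"
      by metis
    then show ?thesis
    proof cases
      case 1 then show ?thesis using rest xyz by simp
    next
      case 2 then show ?thesis using core xyz by simp
    next
      case 3
      have "\<chi> x e z = \<chi> e z x" "sg3 (k x) (k e) (k z) = sg3 (k e) (k z) (k x)" by (metis cyc sg3_cyc)+
      then show ?thesis using 3 core[of z x] xyz by simp
    next
      case 4
      have "\<chi> x y e = \<chi> e x y" "sg3 (k x) (k y) (k e) = sg3 (k e) (k x) (k y)" by (metis cyc sg3_cyc)+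
      then show ?thesis using 4 core[of x y] xyz by simp
    qed
  qed auto
qed

text \<open>In its new place \<open>e\<close> compares with every point other than \<open>p\<close>
  as \<open>p\<close> does, and with every point other than \<open>q\<close> as \<open>q\<close>
  does. Triples through \<open>e\<close> thus have the same \<open>sg3\<close> as the triples with
  \<open>p\<close> or \<open>q\<close> in place of \<open>e\<close>, and \<open>btw\<close> passes
  positivity on. Doubling \<open>h\<close> makes room for the odd value of \<open>e\<close>.\<close>

lemma pos_insert:
  assumes p: "pos_on (E - {e}) \<chi> h" and E: "p \<in> E - {e}" "q \<in> E - {e}" "e \<in> E"
    and pq: "h p < h q" and cons: "\<And>t. t \<in> E - {e} \<Longrightarrow> \<not> (h p < h t \<and> h t < h q)"
    and b: "btw e p q"
  shows "pos_iso E \<chi>"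
proof -
  define k where "k x = (if x = e then 2 * h p + 1 else 2 * h x)" for x
  have inj: "inj_on h (E - {e})" using p unfolding pos_on_def by blast
  have core: "0 \<le> \<chi> e x y * sg3 (k e) (k x) (k y)" if xy: "x \<in> E - {e}" "y \<in> E - {e}" for x y
  proof -
    have neqs: "h x \<noteq> h p" if "x \<noteq> p" "x \<in> E - {e}" for x using inj that E unfolding inj_on_def by blast
    have neqs2: "h x \<noteq> h q" if "x \<noteq> q" "x \<in> E - {e}" for x using inj that E unfolding inj_on_def by blast
    have s: "sgn (k x - k e) = sgn (h x - h p)" if "x \<noteq> p" "x \<in> E - {e}" for x
      using neqs[OF that] that unfolding k_def by (auto simp: sgn_if)
    have s2: "sgn (k x - k e) = sgn (h x - h q)" if "x \<noteq> q" "x \<in> E - {e}" for x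
      using neqs2[OF that] cons[OF that(2)] pq that unfolding k_def by (auto simp: sgn_if)
    have s3: "sgn (k y - k x) = sgn (h y - h x)" using xy unfolding k_def by (auto simp: sgn_if)
    define c where "c = sg3 (k e) (k x) (k y)"
    have "0 \<le> \<chi> p x y * c"
    proof (cases "x = p \<or> y = p")
      case False
      then have "c = sg3 (h p) (h x) (h y)" unfolding c_def sg3_def s3 using s xy by metis
      then show ?thesis using pos_onD[OF p, of p x y] E xy by simp
    qed auto
    moreover have "0 \<le> \<chi> q x y * c"
    proof (cases "x = q \<or> y = q")
      case False
      then have "c = sg3 (h q) (h x) (h y)" unfolding c_def sg3_def s3 using s2 xy by metis
      then show ?thesis using pos_onD[OF p, of q x y] E xy by simp
    qed auto
    ultimately show ?thesis using b xy unfolding btw_def c_def by blast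
  qed
  have "inj_on k E"
  proof (rule inj_onI)
    fix x y assume a: "x \<in> E" "y \<in> E" "k x = k y"
    have "2 * h p + 1 \<noteq> 2 * h y" "2 * h x \<noteq> 2 * h p + 1" by presburger+
    then show "x = y" using a inj unfolding k_def inj_on_def by (auto split: if_splits)
  qed
  then have "pos_on E \<chi> k"
  proof (rule pos_on_splitI[OF _ core])
    fix x y z assume "x \<in> E - {e}" "y \<in> E - {e}" "z \<in> E - {e}"
    moreover from this have "sg3 (k x) (k y) (k z) = sg3 (h x) (h y) (h z)"
      unfolding sg3_def k_def by (auto simp: sgn_if)
    ultimately show "0 \<le> \<chi> x y z * sg3 (k x) (k y) (k z)" using pos_onD[OF p] by metis
  qed
  then show ?thesis by (rule pos_iso_of_pos_on)
qed

text \<open>The first and the last point are neighbours in the cyclic order; cutting at the last one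
  makes them consecutive.\<close>

lemma pos_insert_wrap:
  assumes p: "pos_on (E - {e}) \<chi> h" and E: "p \<in> E - {e}" "q \<in> E - {e}" "e \<in> E" "p \<noteq> q"
    and min: "\<And>t. t \<in> E - {e} \<Longrightarrow> h p \<le> h t" and max: "\<And>t. t \<in> E - {e} \<Longrightarrow> h t \<le> h q"
    and b: "btw e p q"
  shows "pos_iso E \<chi>"
proof -
  have "finite (E - {e})" using fin by simp
  then obtain k where k: "pos_on (E - {e}) \<chi> k" "\<forall>x\<in>E - {e}. x \<noteq> q \<longrightarrow> k q < k x"
    "\<forall>x y. h x < h y \<longrightarrow> h y < h q \<longrightarrow> k x < k y"
    using pos_on_rotate[OF p _ E(2)] by metis
  note neq = pos_on_neq[OF p]
  show ?thesis
  proof (rule pos_insert[OF k(1) E(2) E(1) E(3) _ _ btw_sym[OF b]])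
    show "k q < k p" using k(2) E by blast
    show "\<not> (k q < k t \<and> k t < k p)" if t: "t \<in> E - {e}" for t
    proof
      assume a: "k q < k t \<and> k t < k p"
      then have "t \<noteq> q" "t \<noteq> p" by auto
      then have "h p < h t" "h t < h q" using neq[of p t] neq[of t q] min[OF t] max[OF t] t E by auto
      then show False using k(3) a by (meson less_asym)
    qed
  qed
qed

text \<open>Each product of four values contains every element an even number of times, so
  reorientation does not change it. If nothing vanishes, in a positive order it is a square times
  the factor \<open>Q\<close>, which depends on the order of \<open>a, b, c, d\<close> only and not
  on the viewpoint.\<close>

lemma pos_iso_cross:
  assumes "pos_iso S \<chi>" "a \<in> S" "b \<in> S" "c \<in> S" "d \<in> S" "e \<in> S" "f \<in> S"
  shows "0 \<le> (\<chi> e a b * \<chi> e b c * \<chi> e c d * \<chi> e d a) * (\<chi> f a b * \<chi> f b c * \<chi> f c d * \<chi> f d a)"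
    (is "0 \<le> ?P \<chi>")
proof -
  obtain r h where r: "sign_fun r" and p: "pos_on S (resign r \<chi>) h" using assms(1) unfolding pos_iso_def by blast
  interpret R: chiro E "resign r \<chi>" by (rule chiro_resign[OF r])
  let ?\<rho> = "resign r \<chi>"
  have "0 \<le> ?P ?\<rho>"
  proof (cases "?P ?\<rho> = 0")
    case False
    then have nz: "?\<rho> e a b \<noteq> 0" "?\<rho> e b c \<noteq> 0" "?\<rho> e c d \<noteq> 0" "?\<rho> e d a \<noteq> 0"
       "?\<rho> f a b \<noteq> 0" "?\<rho> f b c \<noteq> 0" "?\<rho> f c d \<noteq> 0" "?\<rho> f d a \<noteq> 0" by auto
    define Q where "Q = sgn (h b - h a) * sgn (h c - h b) * sgn (h d - h c) * sgn (h a - h d)"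
    define A where "A e = sgn (h a - h e) * sgn (h b - h e) * sgn (h c - h e) * sgn (h d - h e)" for e
    note e = R.pos_on_eq[OF p]
    have "?\<rho> e a b * ?\<rho> e b c * ?\<rho> e c d * ?\<rho> e d a = Q * (A e * A e)"
      using e[OF _ _ _ nz(1)] e[OF _ _ _ nz(2)] e[OF _ _ _ nz(3)] e[OF _ _ _ nz(4)] assms
      unfolding Q_def A_def sg3_def by (simp only: mult_ac)
    moreover have "?\<rho> f a b * ?\<rho> f b c * ?\<rho> f c d * ?\<rho> f d a = Q * (A f * A f)"
      using e[OF _ _ _ nz(5)] e[OF _ _ _ nz(6)] e[OF _ _ _ nz(7)] e[OF _ _ _ nz(8)] assms
      unfolding Q_def A_def sg3_def by (simp only: mult_ac)
    ultimately show ?thesis using cross_aux by simp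
  qed linarith
  moreover have "?P ?\<rho> = ?P \<chi> * ((r e * r e) * (r e * r e) * (r f * r f) * (r f * r f) * (r a * r a) * (r a * r a) *
     (r b * r b) * (r b * r b) * (r c * r c) * (r c * r c) * (r d * r d) * (r d * r d))"
    unfolding resign_def by (simp only: mult_ac)
  ultimately show ?thesis by (simp add: sign_fun_sq[OF r])
qed

text \<open>After orienting all points of \<open>N\<close> towards one side of a reference point
  \<open>q\<close>, the relation \<open>\<rho> w i j = 1\<close> is a strict linear order with
  \<open>q\<close> first; transitivity is the Grassmann-Pluecker relation involving
  \<open>q\<close>. The number of predecessors serves as \<open>h\<close>.\<close>

lemma sort_around:
  assumes N: "N \<subseteq> E" and nz: "\<And>i j. i \<in> N \<Longrightarrow> j \<in> N \<Longrightarrow> i \<noteq> j \<Longrightarrow> \<chi> w i j \<noteq> 0" and wN: "w \<notin> N"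
  obtains r h where "sign_fun r" "inj_on h N" "\<forall>x. 0 \<le> h x"
    "\<forall>i\<in>N. \<forall>j\<in>N. resign r \<chi> w i j = sgn (h j - h i)"
proof (cases "N = {}")
  case True
  then show ?thesis using that[of "\<lambda>_. 1" "\<lambda>_. 0"] by (auto simp: sign_fun_def)
next
  case False
  then obtain q where q: "q \<in> N" by blast
  define r where "r i = (if i \<in> N \<and> i \<noteq> q then \<chi> w q i else 1)" for i
  have r: "sign_fun r" unfolding sign_fun_def r_def using nz val q by metis
  define \<rho> where "\<rho> = resign r \<chi>"
  interpret R: chiro E \<rho> unfolding \<rho>_def by (rule chiro_resign[OF r])
  have rw: "r w = 1" unfolding r_def using wN by simp
  have \<rho>q: "\<rho> w q i = 1" if "i \<in> N" "i \<noteq> q" for i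
    using that rw nz[OF q that(1)] val[of w q i] unfolding \<rho>_def resign_def r_def using wN by auto
  have nz: "\<rho> w i j = 1 \<or> \<rho> w j i = 1" if "i \<in> N" "j \<in> N" "i \<noteq> j" for i j
  proof -
    have "r w \<noteq> 0" "r i \<noteq> 0" "r j \<noteq> 0" using r unfolding sign_fun_def by (metis zero_neq_neg_one zero_neq_one)+
    then have "\<rho> w i j \<noteq> 0" unfolding \<rho>_def resign_def using nz[OF that] by simp
    then show ?thesis using R.val[of w i j] R.alt2[of w i j] by auto
  qed
  have trans: "\<rho> w i k = 1" if ijk: "i \<in> N" "j \<in> N" "k \<in> N" "\<rho> w i j = 1" "\<rho> w j k = 1" for i j k
  proof -
    have d: "i \<noteq> j" "j \<noteq> k" using ijk by auto
    have kq: "k \<noteq> q" using \<rho>q[of j] ijk R.alt2[of w q j] d by auto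
    have jq: "j \<noteq> q" using \<rho>q[of i] ijk R.alt2[of w q i] d by auto
    show ?thesis
    proof (cases "i = q")
      case True then show ?thesis using \<rho>q[of k] ijk kq by simp
    next
      case False
      have "\<rho> w q j * \<rho> w i k = sgn (\<rho> w q i * \<rho> w j k + \<rho> w q k * \<rho> w i j)"
        by (rule R.gp) (use \<rho>q ijk kq jq False in simp)
      then show ?thesis using \<rho>q ijk kq jq False by simp
    qed
  qed
  define h where "h i = int (card {j\<in>N. \<rho> w j i = 1})" for i
  have fN: "finite N" using N fin finite_subset by blast
  have lt: "h i < h j" if ij: "i \<in> N" "j \<in> N" "\<rho> w i j = 1" for i j
  proof -
    have "{l\<in>N. \<rho> w l i = 1} \<subseteq> {l\<in>N. \<rho> w l j = 1}" using trans ij by blast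
    moreover have "i \<in> {l\<in>N. \<rho> w l j = 1}" "i \<notin> {l\<in>N. \<rho> w l i = 1}" using ij by auto
    ultimately have "{l\<in>N. \<rho> w l i = 1} \<subset> {l\<in>N. \<rho> w l j = 1}" by blast
    then show ?thesis unfolding h_def using fN by (simp add: psubset_card_mono)
  qed
  have "inj_on h N" by (rule inj_onI) (metis lt nz less_irrefl)
  moreover have "\<rho> w i j = sgn (h j - h i)" if "i \<in> N" "j \<in> N" for i j
  proof (cases "i = j")
    case False
    then show ?thesis using nz[OF that] lt[of i j] lt[of j i] that R.alt2[of w i j] by auto
  qed simp
  moreover have "\<forall>x. 0 \<le> h x" unfolding h_def by simp
  ultimately show ?thesis using that r unfolding \<rho>_def by blast
qed

text \<open>Only triples through \<open>w\<close> can be nonzero, so it suffices to sort the line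
  around \<open>w\<close>. As \<open>h\<close> is nonnegative, the value -1 puts \<open>w\<close> in
  front.\<close>

lemma near_pencil:
  assumes w: "w \<in> E" and col: "\<And>i j k. i \<in> E - {w} \<Longrightarrow> j \<in> E - {w} \<Longrightarrow> k \<in> E - {w} \<Longrightarrow> \<chi> i j k = 0"
    and nz: "\<And>i j. i \<in> E - {w} \<Longrightarrow> j \<in> E - {w} \<Longrightarrow> i \<noteq> j \<Longrightarrow> \<chi> w i j \<noteq> 0"
  shows "pos_iso E \<chi>"
proof -
  obtain r h where r: "sign_fun r" and h: "inj_on h (E - {w})" "\<forall>x. 0 \<le> h x"
    "\<forall>i\<in>E - {w}. \<forall>j\<in>E - {w}. resign r \<chi> w i j = sgn (h j - h i)"
    by (rule sort_around[of "E - {w}" w]) (use nz in auto)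
  interpret R: chiro E "resign r \<chi>" by (rule chiro_resign[OF r])
  define k where "k x = (if x = w then -1 else h x)" for x
  have core: "0 \<le> resign r \<chi> w x y * sg3 (k w) (k x) (k y)" if "x \<in> E - {w}" "y \<in> E - {w}" for x y
    using that h(3) h(2)[rule_format, of x] h(2)[rule_format, of y] unfolding sg3_def k_def by auto
  have inj: "inj_on k E" using h(1,2) unfolding inj_on_def k_def by (metis DiffI neg_0_le_iff_le not_one_le_zero singletonD)
  have "pos_on E (resign r \<chi>) k"
  proof (rule R.pos_on_splitI[OF inj core])
    fix x y z assume "x \<in> E - {w}" "y \<in> E - {w}" "z \<in> E - {w}"
    then show "0 \<le> resign r \<chi> x y z * sg3 (k x) (k y) (k z)" using col unfolding resign_def by simp
  qed
  then show ?thesis unfolding pos_iso_def using r by blast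
qed

end

section \<open>Lines with at least four points\<close>

context chiro
begin

text \<open>A collinear set closed under adding points collinear with two of its members. Sets with
  at most one point qualify too; where the predicate is used for a true line, the size comes from
  elsewhere.\<close>

definition is_line :: "'a set \<Rightarrow> bool" where
  "is_line L \<longleftrightarrow> L \<subseteq> E \<and> (\<forall>p\<in>L. \<forall>q\<in>L. \<forall>t\<in>L. \<chi> p q t = 0) \<and>
     (\<forall>u\<in>E - L. \<forall>p\<in>L. \<forall>q\<in>L. p \<noteq> q \<longrightarrow> \<chi> u p q \<noteq> 0)"

lemma is_line_span:
  assumes ab: "a \<in> E" "b \<in> E" "a \<noteq> b"
  shows "is_line {p\<in>E. \<chi> a b p = 0}"
proof -
  let ?L = "{p\<in>E. \<chi> a b p = 0}"
  have "\<chi> p q t = 0" if "p \<in> ?L" "q \<in> ?L" "t \<in> ?L" for p q t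
    using that ab line_trans[of a b q t] line_trans3[of a b p q t] by (cases "p = a") auto
  moreover have "\<chi> u p q \<noteq> 0" if u: "u \<in> E - ?L" and pq: "p \<in> ?L" "q \<in> ?L" "p \<noteq> q" for u p q
  proof
    assume 0: "\<chi> u p q = 0"
    have "\<chi> p q a = 0" "\<chi> p q b = 0" "\<chi> p q u = 0"
      using line_trans3[of a b p q] line_trans[of a b q] pq ab cyc 0 calculation[of p q a] calculation[of p q b] by auto
    then have "\<chi> a b u = 0"
      using line_trans[of p q b u] line_trans3[of p q a b u] pq ab by (cases "p = a") auto
    then show False using u by simp
  qed
  ultimately show ?thesis unfolding is_line_def by blast
qed

lemma resign_nz: "sign_fun r \<Longrightarrow> resign r \<chi> x y z = 0 \<longleftrightarrow> \<chi> x y z = 0"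
  unfolding resign_def sign_fun_def by (metis mult_eq_0_iff zero_neq_neg_one zero_neq_one)

lemma is_line_resign: "sign_fun r \<Longrightarrow> chiro.is_line E (resign r \<chi>) L \<longleftrightarrow> is_line L"
  unfolding is_line_def chiro.is_line_def[OF chiro_resign] by (simp add: resign_nz)

lemma line_gap:
  assumes p: "pos_on S \<chi> h" and S: "S \<subseteq> E" and L: "is_line L" "p \<in> L \<inter> S" "q \<in> L \<inter> S" "t \<in> L \<inter> S" "p \<noteq> q" "p \<noteq> t"
    and u: "u \<in> S - L" "w \<in> S - L"
  shows "sgn (h q - h w) * sgn (h q - h u) = sgn (h t - h w) * sgn (h t - h u)"
proof (cases "q = t")
  case False
  show ?thesis by (rule line_gap1[OF p, of p]) (use assms False in \<open>auto simp: is_line_def\<close>)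
qed simp

text \<open>Cutting the order at a point \<open>w\<close> off the line turns the cyclic statement
  into a linear one: no point off the line lies between two points of it. The third point
  \<open>p\<close> of the line is the base from which \<open>q\<close> and \<open>t\<close> are
  compared.\<close>

lemma line_gap_min:
  assumes p: "pos_on S \<chi> h" and S: "S \<subseteq> E" and L: "is_line L" "p \<in> L \<inter> S" "q \<in> L \<inter> S" "t \<in> L \<inter> S" "p \<noteq> q" "p \<noteq> t"
    and w: "w \<in> S - L" "\<And>x. x \<in> S \<Longrightarrow> x \<noteq> w \<Longrightarrow> h w < h x" and u: "u \<in> S - L"
  shows "sgn (h q - h u) = sgn (h t - h u)"
proof -
  have "q \<noteq> w" "t \<noteq> w" using L w by auto
  then have "sgn (h q - h w) = 1" "sgn (h t - h w) = 1" using w(2)[of q] w(2)[of t] L by auto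
  then show ?thesis using line_gap[OF assms(1-8) u w(1)] by simp
qed

text \<open>After cutting at \<open>w\<close>, the points of \<open>L\<close> other than
  \<open>e\<close> all lie on the same side of each point off \<open>L\<close>. If \<open>w\<close>
  sees two of them with different signs relative to \<open>e\<close>, a closest such pair is
  consecutive in the whole order and \<open>e\<close> fits in between. Otherwise the cut of the line
  sits at \<open>e\<close>; then \<open>w\<close> sees \<open>p\<close> and \<open>q\<close> alike
  from \<open>e\<close>, and the line \<open>u v\<close> does not separate them. The inequality
  records this failure.\<close>

lemma insert_on_line_pos:
  assumes L: "is_line L" "e \<in> L" "4 \<le> card L" and w: "w \<in> E - L"
    and p: "pos_on (E - {e}) \<chi> h" and no: "\<not> pos_iso E \<chi>"
    and pq: "p \<in> L - {e}" "q \<in> L - {e}" and uv: "u \<in> E - L" "v \<in> E - L"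
  shows "0 \<le> \<chi> w e p * \<chi> w e q * (\<chi> p u v * \<chi> q u v)"
proof -
  let ?S = "E - {e}"
  have LE: "L \<subseteq> E" and col: "\<And>p q t. p \<in> L \<Longrightarrow> q \<in> L \<Longrightarrow> t \<in> L \<Longrightarrow> \<chi> p q t = 0"
    and off: "\<And>u p q. u \<in> E - L \<Longrightarrow> p \<in> L \<Longrightarrow> q \<in> L \<Longrightarrow> p \<noteq> q \<Longrightarrow> \<chi> u p q \<noteq> 0"
    using L(1) unfolding is_line_def by blast+
  have wS: "w \<in> ?S" using w L by blast
  have "finite ?S" using fin by simp
  then obtain k where k: "pos_on ?S \<chi> k" "\<And>x. x \<in> ?S \<Longrightarrow> x \<noteq> w \<Longrightarrow> k w < k x"
    using pos_on_rotate[OF p _ wS] by metis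
  have gap: "sgn (k a - k u) = sgn (k b - k u)" if ab: "a \<in> L - {e}" "b \<in> L - {e}" and u: "u \<in> E - L" for a b u
  proof -
    \<comment> \<open>Here four points are used: besides \<open>e\<close>, \<open>a\<close>,
      \<open>b\<close> the line must have a base point for \<open>line_gap_min\<close>.\<close>
    obtain c where c: "c \<in> L" "c \<noteq> e" "c \<noteq> a" "c \<noteq> b" using ex_notin_list[of "[e, a, b]" L] L(3) by auto
    have uu: "u \<noteq> e" "w \<noteq> e" using u w L by auto
    show ?thesis
      by (rule line_gap_min[OF k(1) _ L(1), of c a b w u]) (use ab u uu c w LE k(2) in auto)
  qed
  show ?thesis
  proof (cases "\<forall>a\<in>L - {e}. \<forall>b\<in>L - {e}. \<chi> w e a = \<chi> w e b")
    case True
    then have "\<chi> w e p = \<chi> w e q" using pq by blast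
    moreover have "\<chi> w e p \<noteq> 0" using off[OF w L(2), of p] pq by blast
    ultimately have 1: "\<chi> w e p * \<chi> w e q = 1" using val[of w e p] by auto
    define c where "c = sg3 (k p) (k u) (k v)"
    have "u \<noteq> e" "v \<noteq> e" using uv L by auto
    have g: "sgn (k u - k p) = sgn (k u - k q)" "sgn (k v - k p) = sgn (k v - k q)"
      using gap[OF pq uv(1)] gap[OF pq uv(2)] by (metis minus_diff_eq sgn_minus)+
    then have "c = sg3 (k q) (k u) (k v)" unfolding sg3_def c_def by simp
    then have a: "0 \<le> \<chi> p u v * c" "0 \<le> \<chi> q u v * c"
      using pos_onD[OF k(1), of p u v] pos_onD[OF k(1), of q u v] pq uv LE \<open>u \<noteq> e\<close> \<open>v \<noteq> e\<close> unfolding c_def by auto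
    show ?thesis
    proof (cases "u = v")
      case False
      then have "k u \<noteq> k v" "k u \<noteq> k p" "k v \<noteq> k p" using pos_on_neq[OF k(1)] pq uv LE \<open>u \<noteq> e\<close> \<open>v \<noteq> e\<close> by auto
      then have "c \<noteq> 0" unfolding c_def sg3_def by (simp add: sgn_0_0)
      then have "0 \<le> \<chi> p u v * \<chi> q u v" using a by (auto simp: zero_le_mult_iff)
      then show ?thesis using 1 by simp
    qed simp
  next
    case False
    \<comment> \<open>A pair with different signs relative to \<open>e\<close> and least distance in
      \<open>k\<close>. A point of \<open>L\<close> between the two would form a closer such pair
      with one of them, and by \<open>gap\<close> no other point lies between.\<close>
    define P where "P n \<longleftrightarrow> (\<exists>a b. a \<in> L - {e} \<and> b \<in> L - {e} \<and> \<chi> w e a \<noteq> \<chi> w e b \<and> k a < k b \<and> nat (k b - k a) = n)" for n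
    have "\<exists>n. P n"
    proof -
      obtain a b where ab: "a \<in> L - {e}" "b \<in> L - {e}" "\<chi> w e a \<noteq> \<chi> w e b" using False by blast
      then have "k a \<noteq> k b" using pos_on_neq[OF k(1), of a b] LE by blast
      then have "k a < k b \<or> k b < k a" by linarith
      then show ?thesis unfolding P_def using ab by metis
    qed
    then have "P (LEAST n. P n)" by (rule LeastI_ex)
    then obtain a b where D: "a \<in> L - {e}" "b \<in> L - {e}" "\<chi> w e a \<noteq> \<chi> w e b" "k a < k b" and least: "nat (k b - k a) = (LEAST n. P n)"
      unfolding P_def by blast
    have min: "nat (k b - k a) \<le> nat (k y - k x)" if "x \<in> L - {e}" "y \<in> L - {e}" "\<chi> w e x \<noteq> \<chi> w e y" "k x < k y" for x y
      unfolding least by (rule Least_le) (use that in \<open>auto simp: P_def\<close>)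
    have cons: "\<not> (k a < k t \<and> k t < k b)" if t: "t \<in> ?S" for t
    proof
      assume kt: "k a < k t \<and> k t < k b"
      show False
      proof (cases "t \<in> L")
        case True
        then have "t \<in> L - {e}" using t by blast
        moreover have "\<chi> w e t \<noteq> \<chi> w e a \<or> \<chi> w e t \<noteq> \<chi> w e b" using D(3) by auto
        ultimately show False using min[of a t] min[of t b] D kt
          by (cases "\<chi> w e a = \<chi> w e t") auto
      next
        case False
        then show False using gap[OF D(1,2), of t] t kt by simp
      qed
    qed
    define c where "c = \<chi> w e b"
    have c: "c = 1 \<or> c = -1" unfolding c_def using off[OF w L(2), of b] D val[of w e b] by auto
    have ac: "\<chi> w e a = - c" using D c off[OF w L(2), of a] val[of w e a] val[of w e b] unfolding c_def by auto
    \<comment> \<open>Reorienting \<open>e\<close> alone leaves the order of the other points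
      positive and makes \<open>w\<close> see \<open>a, e, b\<close> in this order.\<close>
    define r where "r x = (if x = e then c else 1)" for x
    have r: "sign_fun r" unfolding sign_fun_def r_def using c by simp
    interpret R: chiro E "resign r \<chi>" by (rule chiro_resign[OF r])
    have eq: "resign r \<chi> x y z = \<chi> x y z" if "x \<noteq> e" "y \<noteq> e" "z \<noteq> e" for x y z
      using that unfolding resign_def r_def by simp
    have we: "w \<noteq> e" using w L by auto
    have "pos_on ?S (resign r \<chi>) k" using k(1) unfolding pos_on_def by (simp add: eq)
    moreover have "R.btw e a b"
    proof (rule R.btwI[where w = w])
      show "e \<in> E" "a \<in> E" "b \<in> E" using D L LE by auto
      show "resign r \<chi> a b e = 0" using col[of a b e] D L unfolding resign_def by simp
      have aw: "a \<noteq> w" "b \<noteq> w" using D w by auto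
      have "\<chi> w a b \<noteq> 0" using off[OF w, of a b] D by auto
      then have 1: "\<chi> w a b = 1" using pos_on_eq[OF k(1), of w a b] wS D LE k(2)[of a] aw by auto
      have 2: "\<chi> w a e = c" using ac alt2[of w a e] by simp
      show "resign r \<chi> w a e = resign r \<chi> w a b" "resign r \<chi> w e b = resign r \<chi> w a b" "resign r \<chi> w a b \<noteq> 0"
        unfolding resign_def r_def 1 2 c_def[symmetric] using D we c by auto
    qed
    ultimately have "pos_iso E (resign r \<chi>)"
      using R.pos_insert[of e k a b] D cons L LE by blast
    then show ?thesis using no pos_iso_resign[OF r] by blast
  qed
qed

text \<open>Every element occurs an even number of times in the inequality, so the signs of the
  deletion drop out.\<close>

lemma insert_on_line:
  assumes L: "is_line L" "e \<in> L" "4 \<le> card L" and w: "w \<in> E - L"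
    and p: "pos_iso (E - {e}) \<chi>" and no: "\<not> pos_iso E \<chi>"
    and pq: "p \<in> L - {e}" "q \<in> L - {e}" and uv: "u \<in> E - L" "v \<in> E - L"
  shows "0 \<le> \<chi> w e p * \<chi> w e q * (\<chi> p u v * \<chi> q u v)"
proof -
  obtain r h where r: "sign_fun r" and h: "pos_on (E - {e}) (resign r \<chi>) h" using p unfolding pos_iso_def by blast
  interpret R: chiro E "resign r \<chi>" by (rule chiro_resign[OF r])
  let ?\<rho> = "resign r \<chi>"
  have "0 \<le> ?\<rho> w e p * ?\<rho> w e q * (?\<rho> p u v * ?\<rho> q u v)"
    by (rule R.insert_on_line_pos[OF _ L(2,3) w h _ pq uv]) (use is_line_resign[OF r] L(1) no pos_iso_resign[OF r] in auto)
  moreover have "?\<rho> w e p * ?\<rho> w e q * (?\<rho> p u v * ?\<rho> q u v) = \<chi> w e p * \<chi> w e q * (\<chi> p u v * \<chi> q u v) *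
     ((r w * r w) * (r e * r e) * (r p * r p) * (r q * r q) * (r u * r u) * (r v * r v))"
    unfolding resign_def by (simp only: mult_ac)
  ultimately show ?thesis by (simp add: sign_fun_sq[OF r])
qed

text \<open>The two inequalities sharing \<open>la * lb\<close> show that the pairs
  \<open>a, b\<close> and \<open>c, d\<close> do not cross on the projective line as seen from
  \<open>w\<close>, and likewise for the other two pairings. But exactly one of the three pairings
  of four points is crossing: the product of the three sign equations is 1 = -1.\<close>

lemma four_on_line_aux:
  fixes la lb lc :: int
  assumes "\<chi> w a b \<noteq> 0" "\<chi> w a c \<noteq> 0" "\<chi> w b c \<noteq> 0" "\<chi> w a d \<noteq> 0" "\<chi> w b d \<noteq> 0" "\<chi> w c d \<noteq> 0"
    and l: "la \<noteq> 0" "lb \<noteq> 0" "lc \<noteq> 0"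
    and "0 \<le> \<chi> w c a * \<chi> w c b * (la * lb)" "0 \<le> \<chi> w d a * \<chi> w d b * (la * lb)"
     "0 \<le> \<chi> w a b * \<chi> w a c * (lb * lc)" "0 \<le> \<chi> w d b * \<chi> w d c * (lb * lc)"
     "0 \<le> \<chi> w b a * \<chi> w b c * (la * lc)" "0 \<le> \<chi> w d a * \<chi> w d c * (la * lc)"
  shows False
proof -
  have *: "x = y" if "0 \<le> x * z" "0 \<le> y * z" "z \<noteq> 0" "x = 1 \<or> x = -1" "y = 1 \<or> y = -1" for x y z :: int
    using that by auto
  have alts: "\<chi> w c a = - \<chi> w a c" "\<chi> w c b = - \<chi> w b c" "\<chi> w d a = - \<chi> w a d" "\<chi> w d b = - \<chi> w b d"
    "\<chi> w d c = - \<chi> w c d" "\<chi> w b a = - \<chi> w a b" by (rule alt2)+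
  note v = val[of w a b] val[of w a c] val[of w b c] val[of w a d] val[of w b d] val[of w c d]
  have "\<chi> w c a * \<chi> w c b = \<chi> w d a * \<chi> w d b"
    by (rule *[OF assms(10,11)]) (use assms(1-9) v alts in auto)
  moreover have "\<chi> w a b * \<chi> w a c = \<chi> w d b * \<chi> w d c"
    by (rule *[OF assms(12,13)]) (use assms(1-9) v alts in auto)
  moreover have "\<chi> w b a * \<chi> w b c = \<chi> w d a * \<chi> w d c"
    by (rule *[OF assms(14,15)]) (use assms(1-9) v alts in auto)
  ultimately show False using assms(1-6) v unfolding alts by auto
qed

lemma four_on_line:
  assumes del: "\<And>e. e \<in> E \<Longrightarrow> pos_iso (E - {e}) \<chi>"
    and L: "is_line L" "4 \<le> card L" and uv: "u \<in> E - L" "v \<in> E - L" "u \<noteq> v"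
  shows "pos_iso E \<chi>"
proof (rule ccontr)
  assume no: "\<not> pos_iso E \<chi>"
  have LE: "L \<subseteq> E" and off: "\<And>u p q. u \<in> E - L \<Longrightarrow> p \<in> L \<Longrightarrow> q \<in> L \<Longrightarrow> p \<noteq> q \<Longrightarrow> \<chi> u p q \<noteq> 0"
    using L(1) unfolding is_line_def by blast+
  have fL: "finite L" using fin LE finite_subset by blast
  have fail: "0 \<le> \<chi> u e p * \<chi> u e q * (\<chi> p u v * \<chi> q u v)"
    if "e \<in> L" "p \<in> L" "q \<in> L" "p \<noteq> e" "q \<noteq> e" for e p q
    using insert_on_line[OF L(1) that(1) L(2) uv(1) _ no _ _ uv(1,2)] that del LE by blast
  have one: "p = q" if "p \<in> L" "q \<in> L" "\<chi> p u v = 0" "\<chi> q u v = 0" for p q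
  proof (rule ccontr)
    assume "p \<noteq> q"
    have "\<chi> u v p = 0" "\<chi> u v q = 0" using that cyc by auto
    then have "\<chi> u p q = 0" using line_trans[of u v p q] uv by blast
    then show False using off[OF uv(1) that(1,2) \<open>p \<noteq> q\<close>] by blast
  qed
  \<comment> \<open>At most one point of \<open>L\<close> lies on the line \<open>u v\<close>. The
    three points \<open>a, b, c\<close> avoid it, while \<open>d\<close> may be that point: no value
    at \<open>d\<close> enters as a factor.\<close>
  obtain z where z: "\<And>p. p \<in> L \<Longrightarrow> p \<noteq> z \<Longrightarrow> \<chi> p u v \<noteq> 0" using one by metis
  have "3 \<le> card (L - {z})" using L fL by (cases "z \<in> L") auto
  then obtain M where M: "M \<subseteq> L - {z}" "card M = 3" by (meson obtain_subset_with_card_n)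
  obtain a b c where abc: "M = {a, b, c}" "a \<noteq> b" "a \<noteq> c" "b \<noteq> c" using M(2) unfolding card_3_iff by blast
  obtain d where d: "d \<in> L" "d \<notin> M" using ex_notin_list[of "[a, b, c]" L] L(2) abc(1) by auto
  have m: "a \<in> L" "b \<in> L" "c \<in> L" "d \<noteq> a" "d \<noteq> b" "d \<noteq> c" "\<chi> a u v \<noteq> 0" "\<chi> b u v \<noteq> 0" "\<chi> c u v \<noteq> 0"
    using M d abc z by auto
  show False
    by (rule four_on_line_aux[of u a b c d "\<chi> a u v" "\<chi> b u v" "\<chi> c u v"])
      (use m d abc off[OF uv(1)] fail in auto)
qed

text \<open>Two points off the line are needed to compare failures; with fewer the matroid is a
  near-pencil.\<close>

theorem pos_iso_long_line:
  assumes del: "\<And>e. e \<in> E \<Longrightarrow> pos_iso (E - {e}) \<chi>"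
    and L: "is_line L" "4 \<le> card L" 
  shows "pos_iso E \<chi>"
proof (cases "\<exists>u v. u \<in> E - L \<and> v \<in> E - L \<and> u \<noteq> v")
  case True
  then show ?thesis using four_on_line[OF del L] by blast
next
  case False
  have LE: "L \<subseteq> E" and col: "\<And>p q t. p \<in> L \<Longrightarrow> q \<in> L \<Longrightarrow> t \<in> L \<Longrightarrow> \<chi> p q t = 0"
    and off: "\<And>u p q. u \<in> E - L \<Longrightarrow> p \<in> L \<Longrightarrow> q \<in> L \<Longrightarrow> p \<noteq> q \<Longrightarrow> \<chi> u p q \<noteq> 0"
    using L(1) unfolding is_line_def by blast+
  obtain M where M: "M \<subseteq> L" "card M = 2" using L(2) by (meson obtain_subset_with_card_n le_trans numeral_le_iff semiring_norm(68,69,71))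
  then obtain a b where ab: "a \<in> L" "b \<in> L" "a \<noteq> b" unfolding card_2_iff by blast
  then obtain w where "w \<in> E" "\<chi> a b w \<noteq> 0" using simple LE by blast
  then have w: "w \<in> E - L" using col ab by blast
  then have "E - {w} = L" using False LE by blast
  then show ?thesis using near_pencil[of w] w col off by auto
qed

end

section \<open>Three-point lines\<close>

lemma ordered_triple:
  fixes k :: "'a \<Rightarrow> int"
  assumes "3 \<le> card A" "inj_on k A"
  obtains a b c where "a \<in> A" "b \<in> A" "c \<in> A" "k a < k b" "k b < k c"
proof -
  obtain M where M: "M \<subseteq> A" "card M = 3" using assms(1) by (meson obtain_subset_with_card_n)
  then obtain a b c where abc: "M = {a,b,c}" "a \<noteq> b" "a \<noteq> c" "b \<noteq> c" unfolding card_3_iff by blast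
  then have in_A: "a \<in> A" "b \<in> A" "c \<in> A" using M by auto
  then have "k a \<noteq> k b" "k a \<noteq> k c" "k b \<noteq> k c" using abc assms(2) unfolding inj_on_def by blast+
  then consider "k a < k b" "k b < k c" | "k a < k c" "k c < k b" | "k b < k a" "k a < k c" |
    "k b < k c" "k c < k a" | "k c < k a" "k a < k b" | "k c < k b" "k b < k a" by linarith
  then show ?thesis using in_A that by cases metis+
qed

lemma ordered_pair:
  fixes k :: "'a \<Rightarrow> int"
  assumes "2 \<le> card A" "inj_on k A"
  obtains a b where "a \<in> A" "b \<in> A" "k a < k b"
proof -
  obtain M where M: "M \<subseteq> A" "card M = 2" using assms(1) by (meson obtain_subset_with_card_n)
  then obtain a b where abc: "M = {a,b}" "a \<noteq> b" unfolding card_2_iff by blast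
  then have in_A: "a \<in> A" "b \<in> A" using M by auto
  then have "k a \<noteq> k b" using abc assms(2) unfolding inj_on_def by blast
  then show ?thesis using in_A that by (metis linorder_neq_iff)
qed

section \<open>Inserting the middle point of a three-point line\<close>

context chiro
begin

lemma is_line3:
  assumes nl4: "\<And>L. is_line L \<Longrightarrow> card L < 4"
    and x: "x \<in> E" "y \<in> E" "z \<in> E" "x \<noteq> y" "x \<noteq> z" "y \<noteq> z" "\<chi> x y z = 0"
  shows "is_line {x, y, z}"
proof -
  let ?L = "{p\<in>E. \<chi> x y p = 0}"
  have L: "is_line ?L" by (rule is_line_span) fact+
  have "{x, y, z} \<subseteq> ?L" using x by auto
  moreover have "finite ?L" using fin by simp
  moreover have "card ?L \<le> card {x, y, z}" using nl4[OF L] x by simp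
  ultimately have "{x, y, z} = ?L" by (metis card_seteq)
  then show ?thesis using L by metis
qed

text \<open>The sign condition at \<open>w\<close> says that \<open>y\<close> or its negative lies
  in the cone of \<open>x\<close> and \<open>z\<close> as they are oriented. After reorienting
  \<open>y\<close>, it can be inserted as soon as \<open>x\<close> and \<open>z\<close> are
  neighbours in the cyclic order, which is the disjunction \<open>c\<close>.\<close>

lemma insert_mid:
  assumes x: "x \<in> E" "y \<in> E" "z \<in> E" "x \<noteq> y" "x \<noteq> z" "y \<noteq> z" "\<chi> x y z = 0"
    and w: "w \<in> E" "\<chi> w y x * \<chi> w y z = -1" and p: "pos_on (E - {y}) \<chi> h"
    and c: "(h x < h z \<and> (\<forall>t\<in>E - {y}. \<not> (h x < h t \<and> h t < h z))) \<or>
       (\<forall>t\<in>E - {y}. h x \<le> h t \<and> h t \<le> h z)"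
  shows "pos_iso E \<chi>"
proof -
  have n: "\<chi> w y x \<noteq> 0" "\<chi> w y z \<noteq> 0" using w by auto
  have wy: "w \<noteq> y" "w \<noteq> x" "w \<noteq> z" using n by auto
  have "\<chi> w x z \<noteq> 0"
  proof
    assume "\<chi> w x z = 0"
    then have "\<chi> x z w = 0" using cyc by metis
    moreover have "\<chi> x z y = 0" using x alt2[of x z y] by simp
    ultimately have "\<chi> x y w = 0" using line_trans[of x z y w] x by blast
    then have "\<chi> w x y = 0" using cyc by metis
    then show False using n alt2[of w y x] by simp
  qed
  \<comment> \<open>The sign of \<open>y\<close> for which \<open>w\<close> sees
    \<open>x, y, z\<close> in this order.\<close>
  define d where "d = \<chi> w x z * \<chi> w x y"
  have xy: "\<chi> w x y = - \<chi> w y x" by (rule alt2)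
  have d: "d = 1 \<or> d = -1" using \<open>\<chi> w x z \<noteq> 0\<close> n val[of w x z] val[of w y x] unfolding d_def xy by auto
  define r where "r t = (if t = y then d else 1)" for t
  have r: "sign_fun r" unfolding sign_fun_def r_def using d by simp
  interpret R: chiro E "resign r \<chi>" by (rule chiro_resign[OF r])
  have eq: "resign r \<chi> a b c = \<chi> a b c" if "a \<noteq> y" "b \<noteq> y" "c \<noteq> y" for a b c
    using that unfolding resign_def r_def by simp
  have q: "pos_on (E - {y}) (resign r \<chi>) h" using p unfolding pos_on_def by (simp add: eq)
  have b: "R.btw y x z"
  proof (rule R.btwI[where w = w])
    show "y \<in> E" "x \<in> E" "z \<in> E" by fact+
    show "resign r \<chi> x z y = 0" using x(7) alt2[of x z y] unfolding resign_def by simp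
    have "resign r \<chi> w x y = d * \<chi> w x y" "resign r \<chi> w y z = d * \<chi> w y z"
      unfolding resign_def r_def using wy x by auto
    then show "resign r \<chi> w x y = resign r \<chi> w x z" "resign r \<chi> w y z = resign r \<chi> w x z"
      using val[of w y x] val[of w y z] n w(2) x wy unfolding eq[OF wy(1) x(4) x(6)[symmetric]] d_def xy by auto
    show "resign r \<chi> w x z \<noteq> 0" using eq wy x \<open>\<chi> w x z \<noteq> 0\<close> by simp
  qed
  have "pos_iso E (resign r \<chi>)"
    using c
  proof
    assume "h x < h z \<and> (\<forall>t\<in>E - {y}. \<not> (h x < h t \<and> h t < h z))"
    then show ?thesis using R.pos_insert[OF q, of x z] b x by auto
  next
    assume "\<forall>t\<in>E - {y}. h x \<le> h t \<and> h t \<le> h z"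
    then show ?thesis using R.pos_insert_wrap[OF q, of x z] b x by auto
  qed
  then show ?thesis using pos_iso_resign[OF r] by blast
qed

text \<open>Reversing \<open>A\<close> changes \<open>sg3\<close> exactly on triples with at least
  two points in \<open>A\<close>; negating \<open>B\<close> changes \<open>\<chi>\<close> on triples
  with an odd number of points in \<open>B\<close>. For mixed triples both happen together or not at
  all, and unmixed triples vanish.\<close>

lemma pos_on_reverse_block:
  assumes p: "pos_on (A \<union> B) \<chi> h" and dis: "A \<inter> B = {}" and f: "finite (A \<union> B)"
    and AB: "\<And>a b. a \<in> A \<Longrightarrow> b \<in> B \<Longrightarrow> h a < h b"
    and A: "\<And>a b c. a \<in> A \<Longrightarrow> b \<in> A \<Longrightarrow> c \<in> A \<Longrightarrow> \<chi> a b c = 0"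
    and B: "\<And>a b c. a \<in> B \<Longrightarrow> b \<in> B \<Longrightarrow> c \<in> B \<Longrightarrow> \<chi> a b c = 0"
  obtains k where "pos_on (A \<union> B) (resign (\<lambda>t. if t \<in> B then -1 else 1) \<chi>) k"
    "\<And>a b. a \<in> A \<Longrightarrow> b \<in> B \<Longrightarrow> k a < k b"
    "\<And>a b. a \<in> A \<Longrightarrow> b \<in> A \<Longrightarrow> k a < k b \<longleftrightarrow> h b < h a"
    "\<And>a b. a \<in> B \<Longrightarrow> b \<in> B \<Longrightarrow> k a < k b \<longleftrightarrow> h a < h b"
proof -
  obtain K where K: "\<And>t. t \<in> A \<union> B \<Longrightarrow> \<bar>h t\<bar> \<le> K"
  proof -
    have "finite ((\<lambda>t. \<bar>h t\<bar>) ` (A \<union> B))" using f by simp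
    then show ?thesis using that[of "Max ((\<lambda>t. \<bar>h t\<bar>) ` (A \<union> B))"] by simp
  qed
  \<comment> \<open>As \<open>h\<close> is bounded by \<open>K\<close> in absolute value, the
    reversed values are at most \<open>- 2 * K - 1\<close> and stay below those of
    \<open>B\<close>.\<close>
  define k where "k t = (if t \<in> A then - 3 * K - 1 - h t else h t)" for t
  have inA: "k t = - 3 * K - 1 - h t" if "t \<in> A" for t using that k_def by simp
  have inB: "k t = h t" if "t \<in> B" for t using that k_def dis by auto
  have kAB: "k a < k b" if "a \<in> A" "b \<in> B" for a b
    using K[of a] K[of b] that inA inB by auto
  have inj: "inj_on h (A \<union> B)" using p unfolding pos_on_def by blast
  have "inj_on k (A \<union> B)"
  proof (rule inj_onI)
    fix x y assume xy: "x \<in> A \<union> B" "y \<in> A \<union> B" "k x = k y"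
    then have "h x = h y" using kAB[of x y] kAB[of y x] inA inB by auto
    then show "x = y" using inj xy unfolding inj_on_def by blast
  qed
  moreover have "0 \<le> resign (\<lambda>t. if t \<in> B then -1 else 1) \<chi> x y z * sg3 (k x) (k y) (k z)"
    if xyz: "x \<in> A \<union> B" "y \<in> A \<union> B" "z \<in> A \<union> B" for x y z
  proof -
    define s where "s a b = (if a \<in> A \<and> b \<in> A then -1 else 1::int)" for a b
    have s: "sgn (k b - k a) = s a b * sgn (h b - h a)" if ab: "a \<in> A \<union> B" "b \<in> A \<union> B" for a b
    proof -
      consider "a \<in> A" "b \<in> A" | "a \<in> B" "b \<in> B" | "a \<in> A" "b \<in> B" | "a \<in> B" "b \<in> A" using ab by blast
      then show ?thesis
      proof cases
        case 1
        have "sgn (h a - h b) = - sgn (h b - h a)" by (metis minus_diff_eq sgn_minus)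
        then show ?thesis using 1 inA unfolding s_def by simp
      next
        case 2 then show ?thesis using inB dis unfolding s_def by auto
      next
        case 3 then show ?thesis using kAB[OF 3] AB[OF 3] dis unfolding s_def by auto
      next
        case 4 then show ?thesis using kAB[OF 4(2,1)] AB[OF 4(2,1)] dis unfolding s_def by auto
      qed
    qed
    have e: "sg3 (k x) (k y) (k z) = s x y * s x z * s y z * sg3 (h x) (h y) (h z)"
      unfolding sg3_def using s xyz by (simp add: mult_ac)
    note P = pos_onD[OF p xyz]
    show ?thesis
    proof (cases "\<chi> x y z = 0")
      case False
      have m: "t \<in> B \<longleftrightarrow> t \<notin> A" if "t \<in> A \<union> B" for t using that dis by blast
      have "\<not> (x \<in> A \<and> y \<in> A \<and> z \<in> A)" "\<not> (x \<notin> A \<and> y \<notin> A \<and> z \<notin> A)" using False A B xyz by blast+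
      then show ?thesis using P unfolding e resign_def s_def using m[OF xyz(1)] m[OF xyz(2)] m[OF xyz(3)]
        by (cases "x \<in> A"; cases "y \<in> A"; cases "z \<in> A") simp_all
    qed (simp add: resign_def)
  qed
  ultimately have "pos_on (A \<union> B) (resign (\<lambda>t. if t \<in> B then -1 else 1) \<chi>) k" unfolding pos_on_def by blast
  then show ?thesis by (rule that) (use kAB inA inB in auto)
qed

text \<open>Three lines through \<open>x\<close>: the two ways to see the cyclic order of \<open>u1, u2, v2, y\<close>,
  from \<open>z\<close> and from \<open>v1\<close>, disagree.\<close>

lemma three_lines_through_point:
  assumes p: "pos_on S \<chi> h" and S: "x \<in> S" "u1 \<in> S" "u2 \<in> S" "z \<in> S" "v1 \<in> S" "v2 \<in> S" "S \<subseteq> E"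
    and ord: "h x < h u1" "h u1 < h u2" "h u2 < h z" "h z < h v1" "h v1 < h v2"
    and y: "y \<in> E" "y \<notin> S" "\<chi> x y z = 0"
    and L: "is_line {x, u1, u2}" "is_line {x, v1, v2}" "is_line {x, y, z}" and nz2: "\<chi> z u2 v2 \<noteq> 0"
    and s: "\<chi> v1 y x * \<chi> v1 y z = 1"
    and pi: "pos_iso (E - {x}) \<chi>"
  shows False
proof -
  have d: "x \<noteq> u1" "x \<noteq> u2" "x \<noteq> z" "x \<noteq> v1" "x \<noteq> v2" "u1 \<noteq> u2" "u1 \<noteq> z" "u1 \<noteq> v1" "u1 \<noteq> v2"
    "u2 \<noteq> z" "u2 \<noteq> v1" "u2 \<noteq> v2" "z \<noteq> v1" "z \<noteq> v2" "v1 \<noteq> v2" using ord by auto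
  have dy: "y \<noteq> x" "y \<noteq> u1" "y \<noteq> u2" "y \<noteq> z" "y \<noteq> v1" "y \<noteq> v2" using S y by auto
  have off: "\<chi> e p q \<noteq> 0" if "is_line M" "e \<in> E" "e \<notin> M" "p \<in> M" "q \<in> M" "p \<noteq> q" for e p q M
    using that unfolding is_line_def by blast
  have inE: "x \<in> E" "u1 \<in> E" "u2 \<in> E" "z \<in> E" "v1 \<in> E" "v2 \<in> E" using S by auto
  have "\<chi> z u1 u2 \<noteq> 0" "\<chi> v1 u1 u2 \<noteq> 0" "\<chi> v1 x u1 \<noteq> 0"
    by (rule off[OF L(1)]; use d inE in simp)+
  moreover have "\<chi> u2 v1 v2 \<noteq> 0" "\<chi> z v1 v2 \<noteq> 0" by (rule off[OF L(2)]; use d inE in simp)+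
  moreover have "\<chi> v1 x z \<noteq> 0" "\<chi> v2 x z \<noteq> 0" "\<chi> u1 x z \<noteq> 0" "\<chi> v2 z y \<noteq> 0"
    by (rule off[OF L(3)]; use d inE dy dy[symmetric] in simp)+
  ultimately have nz: "\<chi> z u1 u2 \<noteq> 0" "\<chi> z u2 v2 \<noteq> 0" "\<chi> v1 u1 u2 \<noteq> 0" "\<chi> v1 u2 v2 \<noteq> 0" "\<chi> x z v1 \<noteq> 0"
      "\<chi> z v1 v2 \<noteq> 0" "\<chi> x u1 v1 \<noteq> 0" "\<chi> x z v2 \<noteq> 0" "\<chi> x u1 z \<noteq> 0" "\<chi> v2 z y \<noteq> 0"
    using nz2 alt1[of v1 u2 v2] cyc[of x z v1] cyc[of x u1 v1] cyc[of x z v2] alt1[of x u1 z] by simp_all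
  have col: "\<chi> x v1 v2 = 0" using L(2) unfolding is_line_def by blast
  note srt = pos_on_sorted[OF p]
  have c: "\<chi> z u1 u2 = 1" "\<chi> u2 z v2 = 1" "\<chi> u1 u2 v1 = 1" "\<chi> u2 v1 v2 = 1" "\<chi> x z v1 = 1" "\<chi> z v1 v2 = 1"
    "\<chi> x u1 v1 = 1" "\<chi> x z v2 = 1" "\<chi> x u1 z = 1" "0 \<le> \<chi> u1 z v1"
    using srt[of u1 u2 z] srt[of u2 z v2] srt[of u1 u2 v1] srt[of u2 v1 v2] srt[of x z v1] srt[of z v1 v2]
      srt[of x u1 v1] srt[of x z v2] srt[of x u1 z] srt[of u1 z v1] ord S nz
      val[of z u1 u2] val[of u2 z v2] val[of u1 u2 v1] val[of u2 v1 v2] val[of x z v1] val[of z v1 v2]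
      val[of x u1 v1] val[of x z v2] val[of x u1 z]
      cyc[of u1 u2 z] alt1[of z u2 v2] cyc[of u1 u2 v1] alt1[of v1 u2 v2] by auto
  define b where "b = \<chi> v2 z y"
  have b: "b * b = 1" using nz(10) val[of v2 z y] unfolding b_def by auto
  have "\<chi> z x y = 0" using y(3) cyc alt1[of z x y] by (metis cyc)
  \<comment> \<open>The position of \<open>y\<close> on the line through \<open>x\<close> and
    \<open>z\<close> is carried from the viewpoint \<open>v2\<close> to \<open>u1\<close>.\<close>
  then have "\<chi> v2 z x * \<chi> u1 z y = \<chi> v2 z y * \<chi> u1 z x" by (rule kappa)
  moreover have "\<chi> v2 z x = -1" using c(8) alt1[of z x v2] cyc[of z x v2] by simp
  moreover have "\<chi> u1 z x = 1" using c(9) cyc[of u1 z x] by simp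
  ultimately have 1: "\<chi> u1 z y = - b" unfolding b_def by simp
  have Pz: "\<chi> z u1 u2 * \<chi> z u2 v2 * \<chi> z v2 y * \<chi> z y u1 = -1"
  proof -
    have "\<chi> z u2 v2 = -1" using c alt1[of z u2 v2] by simp
    moreover have "\<chi> z v2 y = - b" unfolding b_def by (rule alt1)
    moreover have "\<chi> z y u1 = - b" using 1 cyc[of z y u1] by simp
    ultimately show ?thesis using c(1) b by simp
  qed
  define a where "a = \<chi> v1 x y"
  have ya: "\<chi> v1 y x = - a" unfolding a_def by (rule alt2)
  have a: "a * a = 1" "\<chi> v1 y z = - a" using s val[of v1 y x] val[of v1 y z] unfolding ya by auto
  have vxz: "\<chi> v1 x z = 1" using c(5) cyc[of x z v1] by simp
  have vxv: "\<chi> v1 x v2 = 0" using col alt1[of v1 x v2] by simp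
  have vzv: "\<chi> v1 z v2 = -1" using c(6) alt1[of v1 z v2] by simp
  have "\<chi> v1 x z * \<chi> v1 y v2 = sgn (\<chi> v1 x y * \<chi> v1 z v2 + \<chi> v1 x v2 * \<chi> v1 y z)"
    by (rule gp) (simp add: vxv)
  then have "\<chi> v1 y v2 = sgn (- a)" using vxz vxv vzv unfolding a_def by simp
  moreover have sa: "sgn (- a) = - a" using a val[of v1 x y] unfolding a_def by auto
  ultimately have 2: "\<chi> v1 v2 y = a" using alt2[of v1 v2 y] by simp
  have g: "\<chi> v1 z u1 \<le> 0" "\<chi> v1 x u1 = 1"
    using c(10) c(7) cyc[of z u1 v1] alt1[of z u1 v1] cyc[of x u1 v1] by auto
  have aa: "a = 1 \<or> a = -1" using a val[of v1 x y] unfolding a_def by auto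
  \<comment> \<open>The points \<open>z, u1, v1\<close> may be collinear;
    \<open>\<chi> v1 z u1 \<le> 0\<close> is enough, because then no term opposes the second one,
    whose sign is that of \<open>- a\<close>.\<close>
  have "\<chi> v1 x z * \<chi> v1 y u1 = sgn (\<chi> v1 x y * \<chi> v1 z u1 + \<chi> v1 x u1 * \<chi> v1 y z)"
    by (rule gp) (use g a aa in \<open>auto simp: a_def[symmetric]\<close>)
  then have 3: "\<chi> v1 y u1 = - a" using vxz g a aa unfolding a_def[symmetric] by (auto simp: sgn_if)
  have Pv: "\<chi> v1 u1 u2 * \<chi> v1 u2 v2 * \<chi> v1 v2 y * \<chi> v1 y u1 = 1"
  proof -
    have "\<chi> v1 u1 u2 = 1" "\<chi> v1 u2 v2 = -1" using c cyc[of u1 u2 v1] alt1[of v1 u2 v2] by auto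
    then show ?thesis using 2 3 a by simp
  qed
  have "u1 \<in> E - {x}" "u2 \<in> E - {x}" "v2 \<in> E - {x}" "y \<in> E - {x}" "z \<in> E - {x}" "v1 \<in> E - {x}"
    using S ord y by auto
  from pos_iso_cross[OF pi this(1,2,3,4,5,6)] show False unfolding Pz Pv by simp
qed

text \<open>Here \<open>y\<close> lies on the other segment between \<open>x\<close> and
  \<open>z\<close>. Negating the block \<open>B\<close> of \<open>z\<close> switches segments, and
  the simultaneous reversal of \<open>A\<close> brings \<open>x\<close> next to \<open>z\<close>:
  two first points become last of \<open>A\<close> and first of \<open>B\<close>, two last points
  become first and last of the whole order.\<close>

lemma insert_mid_reversed:
  assumes x: "x \<in> A" "y \<in> E" "z \<in> B" "\<chi> x y z = 0" "x \<noteq> z" and AB: "A \<union> B = E - {y}" "A \<inter> B = {}"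
    and w: "w \<in> A" "w \<noteq> x" "\<chi> w y x * \<chi> w y z = 1" and p: "pos_on (E - {y}) \<chi> h"
    and L: "is_line A" "is_line B" and lt: "\<And>a b. a \<in> A \<Longrightarrow> b \<in> B \<Longrightarrow> h a < h b"
    and c: "(\<forall>a\<in>A. h x \<le> h a) \<and> (\<forall>b\<in>B. h z \<le> h b) \<or> (\<forall>a\<in>A. h a \<le> h x) \<and> (\<forall>b\<in>B. h b \<le> h z)"
  shows "pos_iso E \<chi>"
proof -
  let ?r = "\<lambda>t. if t \<in> B then -1 else 1 :: int"
  have r: "sign_fun ?r" unfolding sign_fun_def by simp
  interpret R: chiro E "resign ?r \<chi>" by (rule chiro_resign[OF r])
  have f: "finite (A \<union> B)" unfolding AB(1) using fin by simp
  have z1: "\<chi> a b c = 0" if "a \<in> A" "b \<in> A" "c \<in> A" for a b c using that L(1) unfolding is_line_def by blast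
  have z2: "\<chi> a b c = 0" if "a \<in> B" "b \<in> B" "c \<in> B" for a b c using that L(2) unfolding is_line_def by blast
  obtain k where k: "pos_on (A \<union> B) (resign ?r \<chi>) k"
    "\<And>a b. a \<in> A \<Longrightarrow> b \<in> B \<Longrightarrow> k a < k b"
    "\<And>a b. a \<in> A \<Longrightarrow> b \<in> A \<Longrightarrow> k a < k b \<longleftrightarrow> h b < h a"
    "\<And>a b. a \<in> B \<Longrightarrow> b \<in> B \<Longrightarrow> k a < k b \<longleftrightarrow> h a < h b"
    by (rule pos_on_reverse_block[OF _ AB(2) f lt z1 z2]) (use p AB(1) in auto)
  have m: "x \<in> E" "z \<in> E" "x \<noteq> y" "y \<noteq> z" "w \<in> E" "y \<notin> B" "w \<notin> B" "x \<notin> B" using x w AB by auto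
  have kx: "k x < k z" using k(2) x by blast
  show ?thesis
  proof -
    have "(k x < k z \<and> (\<forall>t\<in>E - {y}. \<not> (k x < k t \<and> k t < k z))) \<or> (\<forall>t\<in>E - {y}. k x \<le> k t \<and> k t \<le> k z)"
      using c
    proof
      assume c: "(\<forall>a\<in>A. h x \<le> h a) \<and> (\<forall>b\<in>B. h z \<le> h b)"
      have "\<not> (k x < k t \<and> k t < k z)" if "t \<in> E - {y}" for t
      proof (cases "t \<in> A")
        case True then show ?thesis using c k(3)[of x t] x by force
      next
        case False
        then have "t \<in> B" using that AB by blast
        then show ?thesis using c k(4)[of t z] x by force
      qed
      then show ?thesis using kx by blast
    next
      assume c: "(\<forall>a\<in>A. h a \<le> h x) \<and> (\<forall>b\<in>B. h b \<le> h z)"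
      have "k x \<le> k t \<and> k t \<le> k z" if "t \<in> E - {y}" for t
      proof (cases "t \<in> A")
        case True
        then have "\<not> k t < k x" using c k(3)[of t x] x by force
        then show ?thesis using k(2)[OF True x(3)] by simp
      next
        case False
        then have t: "t \<in> B" using that AB by blast
        then have "\<not> k z < k t" using c k(4)[of z t] x by force
        then show ?thesis using k(2)[OF x(1) t] by simp
      qed
      then show ?thesis by blast
    qed
    moreover have "resign ?r \<chi> x y z = 0" using x unfolding resign_def by simp
    moreover have "resign ?r \<chi> w y x * resign ?r \<chi> w y z = -1" using w(3) m x unfolding resign_def by simp
    moreover have "pos_on (E - {y}) (resign ?r \<chi>) k" using k(1) AB(1) by simp
    ultimately have "pos_iso E (resign ?r \<chi>)" using R.insert_mid[of x y z w k] m x by blast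
    then show ?thesis using pos_iso_resign[OF r] by blast
  qed
qed

end


section \<open>Three-point lines: neighbours in the order without the middle point\<close>

context chiro
begin

text \<open>If \<open>y\<close> lies between \<open>x\<close> and \<open>z\<close> on a three-point line that is not crossed between \<open>x\<close> and \<open>z\<close>,
  then \<open>x\<close> and \<open>z\<close> are neighbours in a positive order of the other points,
  apart from configurations of seven points.\<close>

lemma three_point_line_min:
  assumes nl4: "\<And>L. is_line L \<Longrightarrow> card L < 4" and n: "7 \<le> card E"
    and x: "x \<in> E" "y \<in> E" "z \<in> E" "x \<noteq> y" "x \<noteq> z" "y \<noteq> z" "\<chi> x y z = 0"
    and p: "pos_on (E - {y}) \<chi> k" and xmin: "\<And>t. t \<in> E - {y} \<Longrightarrow> t \<noteq> x \<Longrightarrow> k x < k t"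
    and c: "c = 1 \<or> c = -1" "\<And>w. w \<in> E - {x,y,z} \<Longrightarrow> \<chi> w y x * \<chi> w y z = c"
    and mid: "\<And>u v. u \<in> E - {x,y,z} \<Longrightarrow> v \<in> E - {x,y,z} \<Longrightarrow> u \<noteq> v \<Longrightarrow> 0 \<le> - c * (\<chi> x u v * \<chi> z u v)"
    and del: "pos_iso (E - {x}) \<chi>" "pos_iso (E - {z}) \<chi>"
  shows "pos_iso E \<chi>"
proof -
  let ?S = "E - {y}"
  define off where "off = E - {x,y,z}"
  define A where "A = {t\<in>off. k t < k z}"
  define B where "B = {t\<in>off. k z < k t}"
  have L: "is_line {x,y,z}" by (rule is_line3[OF nl4]) (use x in auto)
  have fo: "finite off" unfolding off_def using fin by simp
  have "card off = card E - 3" unfolding off_def using x by (subst card_Diff_subset) auto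
  then have co: "4 \<le> card off" using n by simp
  have injS: "inj_on k ?S" using p unfolding pos_on_def by blast
  have kz: "k t \<noteq> k z" if "t \<in> off" for t using that injS x unfolding inj_on_def off_def by blast
  have AB: "A \<union> B = off" "A \<inter> B = {}" using kz unfolding A_def B_def by force+
  have fAB: "finite A" "finite B" using fo unfolding A_def B_def by auto
  have cAB: "4 \<le> card A + card B" using co AB fAB card_Un_disjoint by metis
  have inS: "off \<subseteq> ?S" unfolding off_def by blast
  have xk: "k x < k t" if "t \<in> off" for t using xmin[of t] that unfolding off_def by blast
  have xz: "k x < k z" using xmin[of z] x by blast
  have injo: "inj_on k off" using injS inS inj_on_subset by blast
  then have inj: "inj_on k A" "inj_on k B" unfolding A_def B_def by (auto intro: inj_on_subset)
  have gapline: "sgn (k q - k w) * sgn (k q - k d) = sgn (k t - k w) * sgn (k t - k d)"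
    if l: "\<chi> a b e = 0" "a \<in> ?S" "b \<in> ?S" "e \<in> ?S" "a \<noteq> b" "a \<noteq> e" "b \<noteq> e" "w \<in> ?S - {a,b,e}" "d \<in> ?S - {a,b,e}"
      "q \<in> {a,b,e}" "t \<in> {a,b,e}" for a b e w d q t
  proof -
    have L: "is_line {a,b,e}" by (rule is_line3[OF nl4]) (use l in auto)
    obtain m where m: "m \<in> {a,b,e}" "m \<noteq> q" "m \<noteq> t" using l(5-7) by (cases "a \<noteq> q \<and> a \<noteq> t"; cases "b \<noteq> q \<and> b \<noteq> t") auto
    have "{a,b,e} \<inter> ?S = {a,b,e}" using l by blast
    then show ?thesis using line_gap[OF p _ L, of m q t d w] l m by blast
  qed
  have offD: "t \<in> ?S" "t \<noteq> x" "t \<noteq> z" "t \<noteq> y" if "t \<in> off" for t using that unfolding off_def by auto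
  have mid': "0 \<le> - c * (\<chi> x u v * \<chi> z u v)" if "u \<in> off" "v \<in> off" "u \<noteq> v" for u v
    using mid that unfolding off_def by blast
  have c': "\<chi> w y x * \<chi> w y z = c" if "w \<in> off" for w
    using c(2) that unfolding off_def by blast
  \<comment> \<open>The point \<open>x\<close> comes first, so it is not between \<open>z\<close>
    and \<open>d\<close>; by the gap property neither are \<open>u\<close> and \<open>v\<close>,
    which lie on a line with it.\<close>
  have xl: "sgn (k u - k z) = sgn (k u - k d)" "sgn (k v - k z) = sgn (k v - k d)"
    if l: "\<chi> x u v = 0" "u \<in> off" "v \<in> off" "d \<in> off" "u \<noteq> v" "d \<noteq> u" "d \<noteq> v" for u v d
  proof -
    have g: "sgn (k u - k z) * sgn (k u - k d) = sgn (k x - k z) * sgn (k x - k d)"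
        "sgn (k v - k z) * sgn (k v - k d) = sgn (k x - k z) * sgn (k x - k d)"
      by (rule gapline[OF l(1)]; use l offD[OF l(2)] offD[OF l(3)] offD[OF l(4)] x in auto)+
    have "sgn (k x - k z) * sgn (k x - k d) = 1" using xz xk[OF l(4)] by simp
    then show "sgn (k u - k z) = sgn (k u - k d)" "sgn (k v - k z) = sgn (k v - k d)"
      using g by (auto simp: sgn_if split: if_splits)
  qed
  \<comment> \<open>The first point \<open>x\<close> is off this line, so its three points
    \<open>u, v, z\<close> all lie on the same side of any further point \<open>d\<close>.\<close>
  have zl: "sgn (k u - k d) = sgn (k z - k d)" "sgn (k v - k d) = sgn (k z - k d)"
    if l: "\<chi> z u v = 0" "u \<in> off" "v \<in> off" "d \<in> off" "u \<noteq> v" "d \<noteq> u" "d \<noteq> v" for u v d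
  proof -
    have g: "sgn (k u - k x) * sgn (k u - k d) = sgn (k z - k x) * sgn (k z - k d)"
        "sgn (k v - k x) * sgn (k v - k d) = sgn (k z - k x) * sgn (k z - k d)"
      by (rule gapline[OF l(1)]; use l offD[OF l(2)] offD[OF l(3)] offD[OF l(4)] x in auto)+
    then show "sgn (k u - k d) = sgn (k z - k d)" "sgn (k v - k d) = sgn (k z - k d)"
      using xk[OF l(2)] xk[OF l(3)] xz by simp_all
  qed
  have AD: "u \<in> off" "k u < k z" if "u \<in> A" for u using that unfolding A_def by auto
  have BD: "u \<in> off" "k z < k u" if "u \<in> B" for u using that unfolding B_def by auto
  note srt = pos_on_sorted[OF p]
  obtain w where w: "w \<in> off" using co by (metis card.empty ex_in_conv not_numeral_le_zero)
  show ?thesis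
  proof (cases "c = -1")
    case True
    \<comment> \<open>From the order \<open>x, u, z, v\<close> positivity gives opposite weak signs,
      while \<open>mid\<close> with \<open>c = -1\<close> asks for a nonnegative product; so one
      value vanishes.\<close>
    have zero: "\<chi> x u v = 0 \<or> \<chi> z u v = 0" if uv: "u \<in> A" "v \<in> B" for u v
    proof -
      have "0 \<le> \<chi> x u v" using srt[of x u v] AD[OF uv(1)] BD[OF uv(2)] offD xk x by auto
      moreover have "0 \<le> \<chi> u z v" using srt[of u z v] AD[OF uv(1)] BD[OF uv(2)] offD x by auto
      then have "\<chi> z u v \<le> 0" using alt1[of z u v] by simp
      moreover have "0 \<le> \<chi> x u v * \<chi> z u v" using mid'[of u v] True AD[OF uv(1)] BD[OF uv(2)] by force
      ultimately show ?thesis by (auto simp: zero_le_mult_iff)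
    qed
    \<comment> \<open>A point \<open>d\<close> outside the interval from \<open>u\<close> to
      \<open>v\<close> excludes a line through \<open>x\<close>, and a point \<open>e\<close> inside
      it excludes a line through \<open>z\<close>.\<close>
    have bad: False if uv: "u \<in> A" "v \<in> B" and d: "d \<in> off" "d \<noteq> u" "d \<noteq> v" "k d < k u \<or> k v < k d"
      and e: "e \<in> off" "e \<noteq> u" "e \<noteq> v" "k u < k e" "k e < k v" for u v d e
    proof -
      have uvo: "u \<in> off" "v \<in> off" "u \<noteq> v" using AD[OF uv(1)] BD[OF uv(2)] by auto
      show False using zero[OF uv]
      proof
        assume "\<chi> x u v = 0"
        from xl[OF this uvo(1,2) d(1) uvo(3) d(2,3)] d(4) AD(2)[OF uv(1)] BD(2)[OF uv(2)] show False by auto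
      next
        assume "\<chi> z u v = 0"
        from zl[OF this uvo(1,2) e(1) uvo(3) e(2,3)] e(4,5) show False by simp
      qed
    qed
    have "A = {} \<or> B = {}"
    proof (rule ccontr)
      assume ne: "\<not> ?thesis"
      then obtain u v where uv: "u \<in> A" "v \<in> B" by blast
      \<comment> \<open>With four points off the line and both blocks nonempty, in each case there
        are \<open>u\<close> in \<open>A\<close> and \<open>v\<close> in \<open>B\<close> with one
        further point inside their interval and one outside.\<close>
      consider "3 \<le> card A" | "3 \<le> card B" | "2 \<le> card A" "2 \<le> card B" using cAB by linarith
      then show False
      proof cases
        case 1
        then obtain u1 u2 u3 where u: "u1 \<in> A" "u2 \<in> A" "u3 \<in> A" "k u1 < k u2" "k u2 < k u3"
          using ordered_triple[OF _ inj(1)] by metis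
        show False by (rule bad[OF u(2) uv(2), of u1 u3])
          (use AD[OF u(1)] AD[OF u(2)] AD[OF u(3)] BD[OF uv(2)] u in auto)
      next
        case 2
        then obtain u1 u2 u3 where u: "u1 \<in> B" "u2 \<in> B" "u3 \<in> B" "k u1 < k u2" "k u2 < k u3"
          using ordered_triple[OF _ inj(2)] by metis
        show False by (rule bad[OF uv(1) u(2), of u3 u1])
          (use BD[OF u(1)] BD[OF u(2)] BD[OF u(3)] AD[OF uv(1)] u in auto)
      next
        case 3
        obtain u1 u2 where u: "u1 \<in> A" "u2 \<in> A" "k u1 < k u2" using ordered_pair[OF 3(1) inj(1)] by metis
        obtain v1 v2 where v: "v1 \<in> B" "v2 \<in> B" "k v1 < k v2" using ordered_pair[OF 3(2) inj(2)] by metis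
        show False by (rule bad[OF u(1) v(1), of v2 u2])
          (use AD[OF u(1)] AD[OF u(2)] BD[OF v(1)] BD[OF v(2)] u v in auto)
      qed
    qed
    then have "(k x < k z \<and> (\<forall>t\<in>E - {y}. \<not> (k x < k t \<and> k t < k z))) \<or> (\<forall>t\<in>E - {y}. k x \<le> k t \<and> k t \<le> k z)"
    proof
      assume a: "A = {}"
      have "\<not> (k x < k t \<and> k t < k z)" if "t \<in> E - {y}" for t
        using a that unfolding A_def off_def by auto
      then show ?thesis using xz by blast
    next
      assume b: "B = {}"
      have "k t \<le> k z" if "t \<in> E - {y}" for t
        using b that xz unfolding B_def off_def by force
      moreover have "k x \<le> k t" if "t \<in> E - {y}" for t using xmin[OF that] by (cases "t = x") auto
      ultimately show ?thesis by blast
    qed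
    moreover have "w \<in> E" using w unfolding off_def by blast
    ultimately show ?thesis using insert_mid[OF x _ _ p, of w] c'[OF w] True by blast
  next
    case False
    then have c1: "c = 1" using c by blast
    \<comment> \<open>For \<open>u, v\<close> on the same side of \<open>z\<close> both values are
      nonnegative, and now \<open>mid\<close> asks for a nonpositive product.\<close>
    have zero: "\<chi> x u v = 0 \<or> \<chi> z u v = 0" if uv: "u \<in> off" "v \<in> off" "k u < k v" "v \<in> A \<or> u \<in> B" for u v
    proof -
      have "0 \<le> \<chi> x u v" using srt[of x u v] offD[OF uv(1)] offD[OF uv(2)] xk[OF uv(1)] uv x by auto
      moreover have "0 \<le> \<chi> z u v"
        using uv(4)
      proof
        assume "v \<in> A"
        then show ?thesis using srt[of u v z] cyc[of u v z] AD[of v] uv offD[OF uv(1)] offD[OF uv(2)] x by auto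
      next
        assume "u \<in> B"
        then show ?thesis using srt[of z u v] BD[of u] uv offD[OF uv(1)] offD[OF uv(2)] x by auto
      qed
      moreover have "\<chi> x u v * \<chi> z u v \<le> 0" using mid'[of u v] c1 uv by force
      ultimately show ?thesis by (auto simp: mult_le_0_iff)
    qed
    \<comment> \<open>A point \<open>d\<close> between \<open>u\<close> and \<open>v\<close>
      excludes a line through \<open>z\<close> by \<open>zl\<close>; for a line through
      \<open>x\<close>, \<open>xl\<close> would put \<open>z\<close> between \<open>u\<close> and
      \<open>v\<close> as well, but both are in the same block.\<close>
    have bad: False if uv: "u \<in> off" "v \<in> off" "d \<in> off" "k u < k d" "k d < k v" "v \<in> A \<or> u \<in> B" for u v d
    proof -
      have n: "u \<noteq> v" "d \<noteq> u" "d \<noteq> v" using uv by auto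
      have "\<chi> x u v = 0 \<or> \<chi> z u v = 0" using zero[of u v] uv by auto
      then show False
      proof
        assume "\<chi> x u v = 0"
        from xl[OF this uv(1-3) n] uv(4-6) AD[of v] BD[of u] show False by auto
      next
        assume "\<chi> z u v = 0"
        from zl[OF this uv(1-3) n] uv(4-5) show False by simp
      qed
    qed
    have "card A \<le> 2"
    proof (rule ccontr)
      assume "\<not> card A \<le> 2"
      then have "3 \<le> card A" by simp
      then obtain u1 u2 u3 where u: "u1 \<in> A" "u2 \<in> A" "u3 \<in> A" "k u1 < k u2" "k u2 < k u3"
          using ordered_triple[OF _ inj(1)] by metis
      then show False using bad[of u1 u3 u2] AD by blast
    qed
    moreover have "card B \<le> 2"
    proof (rule ccontr)
      assume "\<not> card B \<le> 2"
      then have "3 \<le> card B" by simp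
      then obtain u1 u2 u3 where u: "u1 \<in> B" "u2 \<in> B" "u3 \<in> B" "k u1 < k u2" "k u2 < k u3"
          using ordered_triple[OF _ inj(2)] by metis
      then show False using bad[of u1 u3 u2] BD by blast
    qed
    \<comment> \<open>Both bounds are attained, so \<open>E\<close> has exactly seven points, in the
      order \<open>x, u1, u2, z, v1, v2\<close> without \<open>y\<close>.\<close>
    ultimately have c2: "card A = 2" "card B = 2" using cAB by auto
    obtain u1 u2 where u: "u1 \<in> A" "u2 \<in> A" "k u1 < k u2" using ordered_pair[OF _ inj(1)] c2 by (metis order_refl)
    obtain v1 v2 where v: "v1 \<in> B" "v2 \<in> B" "k v1 < k v2" using ordered_pair[OF _ inj(2)] c2 by (metis order_refl)
    have "u1 \<noteq> u2" using u by auto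
    then have "{u1, u2} = A" by (intro card_seteq) (use u c2 fAB in auto)
    then have A2: "A = {u1, u2}" by blast
    have "v1 \<noteq> v2" using v by auto
    then have "{v1, v2} = B" by (intro card_seteq) (use v c2 fAB in auto)
    then have B2: "B = {v1, v2}" by blast
    have S6: "?S = {x, u1, u2, z, v1, v2}" using AB(1) x unfolding A2 B2 off_def by blast
    note uo = AD[OF u(1)] AD[OF u(2)] and vo = BD[OF v(1)] BD[OF v(2)]
    have ord: "k x < k u1" "k u1 < k u2" "k u2 < k z" "k z < k v1" "k v1 < k v2" using u v uo vo xk by auto
    have lu: "\<chi> x u1 u2 = 0 \<or> \<chi> z u1 u2 = 0" and lv: "\<chi> x v1 v2 = 0 \<or> \<chi> z v1 v2 = 0"
      using zero[of u1 u2] zero[of v1 v2] u v uo vo by auto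
    have inE: "x \<in> E" "u1 \<in> E" "u2 \<in> E" "z \<in> E" "v1 \<in> E" "v2 \<in> E" using x uo vo unfolding off_def by auto
    have inS': "x \<in> ?S" "u1 \<in> ?S" "u2 \<in> ?S" "z \<in> ?S" "v1 \<in> ?S" "v2 \<in> ?S" unfolding S6 by auto
    have d: "x \<noteq> u1" "x \<noteq> u2" "x \<noteq> z" "x \<noteq> v1" "x \<noteq> v2" "u1 \<noteq> u2" "u1 \<noteq> z" "u1 \<noteq> v1" "u1 \<noteq> v2"
      "u2 \<noteq> z" "u2 \<noteq> v1" "u2 \<noteq> v2" "z \<noteq> v1" "z \<noteq> v2" "v1 \<noteq> v2" using ord by auto
    have zyx: "\<chi> z y x = 0" "\<chi> x y z = 0" using x(7) cyc alt1[of z y x] by (metis add.inverse_neutral alt2)+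
    have L': "is_line {z, y, x}" using L by (metis insert_commute)
    have S6': "?S = {x, u1, u2} \<union> {z, v1, v2}" "?S = {v1, v2, x} \<union> {u1, u2, z}" unfolding S6 by auto
    have finS: "finite ?S" using fin by simp
    \<comment> \<open>Each of the pairs \<open>u1, u2\<close> and \<open>v1, v2\<close> is collinear
      with \<open>x\<close> or with \<open>z\<close>. If the two lines pass through different
      points, they form two blocks and the order is repaired by reversal; if both pass through the
      same point, its deletion gives a contradiction.\<close>
    consider (xz) "\<chi> x u1 u2 = 0" "\<chi> z v1 v2 = 0" | (zx) "\<chi> z u1 u2 = 0" "\<chi> x v1 v2 = 0"
      | (xx) "\<chi> x u1 u2 = 0" "\<chi> x v1 v2 = 0" | (zz) "\<chi> z u1 u2 = 0" "\<chi> z v1 v2 = 0" using lu lv by blast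
    then show ?thesis
    proof cases
      case xz
      have l: "is_line {x, u1, u2}" "is_line {z, v1, v2}" by (rule is_line3[OF nl4]; use d inE xz in simp)+
      show ?thesis
      proof (rule insert_mid_reversed[OF _ x(2) _ zyx(2) d(3) S6'(1)[symmetric] _ _ _ _ p l])
        show "\<chi> u1 y x * \<chi> u1 y z = 1" using c' uo c1 by simp
      qed (use d ord in auto)
    next
      case zx
      have l: "is_line {v1, v2, x}" "is_line {u1, u2, z}"
        by (rule is_line3[OF nl4]; use d inE zx cyc[of v1 v2 x] cyc[of u1 u2 z] in simp)+
      \<comment> \<open>Cut at \<open>v1\<close> the order is \<open>v1, v2, x, u1, u2, z\<close>,
        with \<open>x\<close> and \<open>z\<close> both last in their blocks.\<close>
      obtain k' where k': "pos_on ?S \<chi> k'" 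
        "\<forall>a b. k v1 \<le> k a \<longrightarrow> k a < k b \<longrightarrow> k' a < k' b"
        "\<forall>a b. k a < k b \<longrightarrow> k b < k v1 \<longrightarrow> k' a < k' b"
        "\<forall>a\<in>?S. \<forall>b\<in>?S. k a < k v1 \<longrightarrow> k v1 \<le> k b \<longrightarrow> k' b < k' a"
        by (rule pos_on_rotate[OF p finS inS'(5)])
      have o: "k' v1 < k' v2" "k' v2 < k' x" "k' x < k' u1" "k' u1 < k' u2" "k' u2 < k' z"
        using k'(2)[rule_format, of v1 v2] k'(3)[rule_format, of x u1] k'(3)[rule_format, of u1 u2]
          k'(3)[rule_format, of u2 z] k'(4)[rule_format, of x v2] ord inS' by auto
      show ?thesis
      proof (rule insert_mid_reversed[OF _ x(2) _ zyx(2) d(3) S6'(2)[symmetric] _ _ _ _ k'(1) l])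
        show "\<chi> v1 y x * \<chi> v1 y z = 1" using c' vo c1 by simp
      qed (use d o in auto)
    next
      case xx
      have l: "is_line {x, u1, u2}" "is_line {x, v1, v2}" by (rule is_line3[OF nl4]; use d inE xx in simp)+
      have "\<chi> z u2 v2 \<noteq> 0"
      proof
        assume "\<chi> z u2 v2 = 0"
        from zl[OF this, of v1] show False using uo vo d ord by auto
      qed
      moreover have "\<chi> v1 y x * \<chi> v1 y z = 1" using c' vo c1 by simp
      ultimately have False
        using three_lines_through_point[OF p inS' _ ord x(2) _ zyx(2) l L _ _ del(1)] by blast
      then show ?thesis ..
    next
      case zz
      have l: "is_line {z, v1, v2}" "is_line {z, u1, u2}" by (rule is_line3[OF nl4]; use d inE zz in simp)+
      \<comment> \<open>Cut at \<open>z\<close> the order is \<open>z, v1, v2, x, u1, u2\<close>: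
        the preceding situation with \<open>x\<close> and \<open>z\<close> exchanged.\<close>
      obtain k' where k': "pos_on ?S \<chi> k'" 
        "\<forall>a b. k z \<le> k a \<longrightarrow> k a < k b \<longrightarrow> k' a < k' b"
        "\<forall>a b. k a < k b \<longrightarrow> k b < k z \<longrightarrow> k' a < k' b"
        "\<forall>a\<in>?S. \<forall>b\<in>?S. k a < k z \<longrightarrow> k z \<le> k b \<longrightarrow> k' b < k' a"
        by (rule pos_on_rotate[OF p finS inS'(4)])
      have o: "k' z < k' v1" "k' v1 < k' v2" "k' v2 < k' x" "k' x < k' u1" "k' u1 < k' u2"
        using k'(2)[rule_format, of v1 v2] k'(2)[rule_format, of z v1] k'(3)[rule_format, of x u1] k'(3)[rule_format, of u1 u2]
          k'(4)[rule_format, of x v2] ord inS' by auto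
      have "\<chi> x v2 u2 \<noteq> 0"
      proof
        assume "\<chi> x v2 u2 = 0"
        then have "\<chi> x u2 v2 = 0" using alt2[of x u2 v2] by simp
        from xl[OF this, of u1] show False using uo vo d ord by auto
      qed
      moreover have "\<chi> u1 y z * \<chi> u1 y x = 1" using c' uo c1 by (simp add: mult.commute)
      ultimately have False
        using three_lines_through_point[OF k'(1) inS'(4,5,6,1,2,3) _ o x(2) _ zyx(1) l L' _ _ del(2)] by blast
      then show ?thesis ..
    qed
  qed
qed

end


section \<open>Three-point lines: one middle point for all deletions\<close>

context chiro
begin

lemma is_line_off: "is_line L \<Longrightarrow> u \<in> E - L \<Longrightarrow> p \<in> L \<Longrightarrow> q \<in> L \<Longrightarrow> p \<noteq> q \<Longrightarrow> \<chi> u p q \<noteq> 0"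
  unfolding is_line_def by blast

lemma is_line_col: "is_line L \<Longrightarrow> p \<in> L \<Longrightarrow> q \<in> L \<Longrightarrow> t \<in> L \<Longrightarrow> \<chi> p q t = 0"
  unfolding is_line_def by blast

text \<open>Neither \<open>mid\<close> nor the conclusion depends on the orientation, so the order
  of the deletion of \<open>y\<close> may be taken as positive without signs and cut at
  \<open>x\<close>. By \<open>kappa\<close> all points off the line see \<open>y\<close> in the same
  position relative to \<open>x\<close> and \<open>z\<close>; this common sign is
  \<open>c\<close>.\<close>

lemma three_point_line_mid:
  assumes nl4: "\<And>L. is_line L \<Longrightarrow> card L < 4" and n: "7 \<le> card E"
    and x: "x \<in> E" "y \<in> E" "z \<in> E" "x \<noteq> y" "x \<noteq> z" "y \<noteq> z" "\<chi> x y z = 0"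
    and mid: "\<And>u v. u \<in> E - {x,y,z} \<Longrightarrow> v \<in> E - {x,y,z} \<Longrightarrow> u \<noteq> v \<Longrightarrow>
        \<chi> u y x * \<chi> u y z * (\<chi> x u v * \<chi> z u v) \<le> 0"
    and del: "\<And>e. e \<in> E \<Longrightarrow> pos_iso (E - {e}) \<chi>"
  shows "pos_iso E \<chi>"
proof -
  obtain r h where r: "sign_fun r" and h: "pos_on (E - {y}) (resign r \<chi>) h"
    using del[OF x(2)] unfolding pos_iso_def by blast
  interpret R: chiro E "resign r \<chi>" by (rule chiro_resign[OF r])
  let ?\<rho> = "resign r \<chi>"
  have finS: "finite (E - {y})" using fin by simp
  have xS: "x \<in> E - {y}" using x by blast
  obtain k where k: "pos_on (E - {y}) ?\<rho> k" "\<forall>t\<in>E - {y}. t \<noteq> x \<longrightarrow> k x < k t"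
    by (rule pos_on_rotate[OF h finS xS])
  have nl4': "\<And>L. R.is_line L \<Longrightarrow> card L < 4" using nl4 is_line_resign[OF r] by blast
  have col: "?\<rho> x y z = 0" using x(7) unfolding resign_def by simp
  have L: "R.is_line {x,y,z}" by (rule R.is_line3[OF nl4']) (use x col in auto)
  have off: "?\<rho> w y x \<noteq> 0" "?\<rho> w y z \<noteq> 0" if "w \<in> E - {x,y,z}" for w
    by (rule R.is_line_off[OF L that]; use x in simp)+
  obtain w where w: "w \<in> E - {x,y,z}" using ex_notin_list[of "[x, y, z]" E] n by auto
  define c where "c = ?\<rho> w y x * ?\<rho> w y z"
  have c: "c = 1 \<or> c = -1" using off[OF w] R.val[of w y x] R.val[of w y z] unfolding c_def by auto
  have c2: "?\<rho> t y x * ?\<rho> t y z = c" if t: "t \<in> E - {x,y,z}" for t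
  proof -
    have "?\<rho> y x z = 0" using col R.alt1[of y x z] by simp
    then have "?\<rho> t y x * ?\<rho> w y z = ?\<rho> t y z * ?\<rho> w y x" by (rule R.kappa)
    then show ?thesis unfolding c_def
      using off[OF w] off[OF t] R.val[of w y x] R.val[of w y z] R.val[of t y x] R.val[of t y z] by auto
  qed
  have mid': "0 \<le> - c * (?\<rho> x u v * ?\<rho> z u v)" if uv: "u \<in> E - {x,y,z}" "v \<in> E - {x,y,z}" "u \<noteq> v" for u v
  proof -
    have "?\<rho> u y x * ?\<rho> u y z * (?\<rho> x u v * ?\<rho> z u v) = \<chi> u y x * \<chi> u y z * (\<chi> x u v * \<chi> z u v) *
      ((r u * r u) * (r u * r u) * (r y * r y) * (r x * r x) * (r z * r z) * (r v * r v))"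
      unfolding resign_def by (simp only: mult_ac)
    also have "\<dots> \<le> 0" using mid[OF uv] by (simp add: sign_fun_sq[OF r])
    finally show ?thesis unfolding c2[OF uv(1)] by simp
  qed
  have "pos_iso E ?\<rho>"
    by (rule R.three_point_line_min[OF nl4' n x(1-6) col k(1) _ c c2 mid'])
      (use k(2) del x pos_iso_resign[OF r] in auto)
  then show ?thesis using pos_iso_resign[OF r] by blast
qed

text \<open>On a three-point line \<open>L = {p, m, q}\<close>, \<open>middle L m u v\<close> says that the line through \<open>u, v\<close> does not
  cross the segment from \<open>p\<close> to \<open>q\<close> that contains \<open>m\<close>.\<close>

definition middle :: "'a set \<Rightarrow> 'a \<Rightarrow> 'a \<Rightarrow> 'a \<Rightarrow> bool" where
  "middle L m u v \<longleftrightarrow> (\<forall>p\<in>L - {m}. \<forall>q\<in>L - {m}. p \<noteq> q \<longrightarrow> \<chi> u m p * \<chi> u m q * (\<chi> p u v * \<chi> q u v) \<le> 0)"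

lemma middle_resign:
  assumes r: "sign_fun r"
  shows "chiro.middle (resign r \<chi>) L m u v \<longleftrightarrow> middle L m u v"
proof -
  interpret R: chiro E "resign r \<chi>" by (rule chiro_resign[OF r])
  have "resign r \<chi> u m p * resign r \<chi> u m q * (resign r \<chi> p u v * resign r \<chi> q u v) =
     \<chi> u m p * \<chi> u m q * (\<chi> p u v * \<chi> q u v) *
      ((r u * r u) * (r u * r u) * (r m * r m) * (r p * r p) * (r q * r q) * (r v * r v))" for p q
    unfolding resign_def by (simp only: mult_ac)
  then show ?thesis unfolding middle_def R.middle_def by (simp add: sign_fun_sq[OF r])
qed

text \<open>In the order cut at \<open>w\<close> the middle point is the second of the three:
  \<open>w\<close> sees it between the other two, and no point off the line comes between these in
  the order, so a line \<open>u v\<close> cannot separate them.\<close>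

lemma middle_pos:
  assumes p: "pos_on S \<chi> h" and S: "S \<subseteq> E" and L: "is_line L" "L \<subseteq> S" "card L = 3" and w: "w \<in> S - L"
  obtains m where "m \<in> L" "\<And>u v. u \<in> S - L \<Longrightarrow> v \<in> S - L \<Longrightarrow> u \<noteq> v \<Longrightarrow> middle L m u v"
proof -
  have finS: "finite S" using fin S finite_subset by blast
  have wS: "w \<in> S" using w by blast
  obtain k where k: "pos_on S \<chi> k" "\<forall>t\<in>S. t \<noteq> w \<longrightarrow> k w < k t"
    by (rule pos_on_rotate[OF p finS wS])
  have "inj_on k L" using k(1) L(2) unfolding pos_on_def by (meson inj_on_subset)
  then obtain a m b where amb: "a \<in> L" "m \<in> L" "b \<in> L" "k a < k m" "k m < k b"
    using ordered_triple[of L k] L(3) by auto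
  have d: "a \<noteq> m" "a \<noteq> b" "m \<noteq> b" using amb by auto
  then have "card {a, m, b} = card L" using L(3) by simp
  moreover have "finite L" using L(3) card.infinite by fastforce
  ultimately have "{a, m, b} = L" using amb by (intro card_subset_eq) auto
  then have Leq: "L = {a, m, b}" ..
  have col: "\<chi> m a b = 0" using L(1) amb unfolding is_line_def by blast
  have mm: "middle L m u v" if uv: "u \<in> S - L" "v \<in> S - L" "u \<noteq> v" for u v
  proof -
    have nz: "\<chi> t m a \<noteq> 0" "\<chi> t m b \<noteq> 0" if "t \<in> S - L" for t
    proof -
      have t: "t \<in> E - L" using that S by blast
      show "\<chi> t m a \<noteq> 0" "\<chi> t m b \<noteq> 0"
        using is_line_off[OF L(1) t amb(2,1) d(1)[symmetric]] is_line_off[OF L(1) t amb(2,3) d(3)] .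
    qed
    have inS: "a \<in> S" "m \<in> S" "b \<in> S" using amb(1-3) L(2) by blast+
    have "a \<noteq> w" using amb(1) w by blast
    then have wk: "k w < k a" using k(2) inS(1) by simp
    have "\<chi> w m a = sg3 (k w) (k m) (k a)" by (rule pos_on_eq[OF k(1) wS inS(2,1) nz(1)[OF w]])
    moreover have "sg3 (k w) (k m) (k a) = -1" using sg3_swap(2)[of "k w" "k m" "k a"] wk amb by simp
    moreover have "\<chi> w m b = sg3 (k w) (k m) (k b)" by (rule pos_on_eq[OF k(1) wS inS(2,3) nz(2)[OF w]])
    moreover have "sg3 (k w) (k m) (k b) = 1" using wk amb by simp
    ultimately have "\<chi> w m a = - 1" "\<chi> w m b = 1" by simp_all
    then have "\<chi> u m a * \<chi> u m b = -1"
      using kappa[OF col, of u w] nz[OF uv(1)] val[of u m a] val[of u m b] by auto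
    moreover have "0 \<le> \<chi> a u v * \<chi> b u v"
    proof -
      have g: "sgn (k a - k t) = sgn (k b - k t)" if t: "t \<in> S - L" for t
        by (rule line_gap_min[OF k(1) S L(1), of m a b w t]) (use amb L d w t k(2) in auto)
      have g': "sgn (k t - k a) = sgn (k t - k b)" if "t \<in> S - L" for t
        using g[OF that] by (metis minus_diff_eq sgn_minus)
      define c where "c = sg3 (k a) (k u) (k v)"
      have "c = sg3 (k b) (k u) (k v)" unfolding c_def sg3_def using g' uv by simp
      then have "0 \<le> \<chi> a u v * c" "0 \<le> \<chi> b u v * c"
        using pos_onD[OF k(1), of a u v] pos_onD[OF k(1), of b u v] uv amb L(2) unfolding c_def by auto
      moreover have "k u \<noteq> k v" "k u \<noteq> k a" "k v \<noteq> k a"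
        by (rule pos_on_neq[OF k(1)]; use uv amb L(2) in blast)+
      then have "c \<noteq> 0" unfolding c_def sg3_def by (simp add: sgn_0_0)
      ultimately show ?thesis by (auto simp: zero_le_mult_iff)
    qed
    ultimately have 1: "\<chi> u m a * \<chi> u m b * (\<chi> a u v * \<chi> b u v) \<le> 0" by simp
    then have 2: "\<chi> u m b * \<chi> u m a * (\<chi> b u v * \<chi> a u v) \<le> 0" by (simp only: mult_ac)
    show ?thesis unfolding middle_def Leq using 1 2 by auto
  qed
  show ?thesis by (rule that[OF amb(2) mm])
qed

lemma middle_deletion:
  assumes p: "pos_iso S \<chi>" and S: "S \<subseteq> E" and L: "is_line L" "L \<subseteq> S" "card L = 3" and w: "w \<in> S - L"
  shows "\<exists>m\<in>L. \<forall>u\<in>S - L. \<forall>v\<in>S - L. u \<noteq> v \<longrightarrow> middle L m u v"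
proof -
  obtain r h where r: "sign_fun r" and h: "pos_on S (resign r \<chi>) h" using p unfolding pos_iso_def by blast
  interpret R: chiro E "resign r \<chi>" by (rule chiro_resign[OF r])
  have "R.is_line L" using L(1) is_line_resign[OF r] by blast
  then show ?thesis using R.middle_pos[OF h S _ L(2,3) w] middle_resign[OF r] by metis
qed

text \<open>The line \<open>u v\<close> avoids the open segment from \<open>p\<close> to
  \<open>q\<close> through \<open>m\<close> and the open segment from \<open>m\<close> to
  \<open>q\<close> through \<open>p\<close>. Together these cover the projective line except
  \<open>q\<close>, so \<open>u v\<close> passes through \<open>q\<close>. The meeting point need
  not be an element; the Grassmann-Pluecker relation at \<open>u\<close> replaces it.\<close>

lemma middle_unique:
  assumes L: "is_line {m, p, q}" "m \<noteq> p" "m \<noteq> q" "p \<noteq> q" and uv: "u \<in> E - {m, p, q}"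
    and M: "middle {m, p, q} m u v" "middle {m, p, q} p u v"
  shows "\<chi> q u v = 0"
proof (rule ccontr)
  assume nq: "\<chi> q u v \<noteq> 0"
  have nz: "\<chi> u m p \<noteq> 0" "\<chi> u m q \<noteq> 0" "\<chi> u p q \<noteq> 0" 
    by (rule is_line_off[OF L(1) uv]; use L in simp)+
  have 1: "\<chi> u m p * \<chi> u m q * (\<chi> p u v * \<chi> q u v) \<le> 0" using M(1) L(2-4) unfolding middle_def by blast
  have 2: "\<chi> u p m * \<chi> u p q * (\<chi> m u v * \<chi> q u v) \<le> 0" using M(2) L(2-4) unfolding middle_def by blast
  have a: "\<chi> p u v = - \<chi> u p v" "\<chi> q u v = - \<chi> u q v" "\<chi> m u v = - \<chi> u m v" "\<chi> u p m = - \<chi> u m p"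
    using alt1 alt2 by blast+
  have M2: "0 \<le> \<chi> u m p * \<chi> u p q * (\<chi> u m v * \<chi> u q v)" and M1: "\<chi> u m p * \<chi> u m q * (\<chi> u p v * \<chi> u q v) \<le> 0"
    using 1 2 unfolding a by auto
  have "\<chi> u m q * \<chi> u p v = sgn (\<chi> u m p * \<chi> u q v + \<chi> u m v * \<chi> u p q)"
    by (rule gp) (use M2 in \<open>simp only: mult_ac\<close>)
  moreover have "sgn (\<chi> u m p * \<chi> u q v + \<chi> u m v * \<chi> u p q) = \<chi> u m p * \<chi> u q v"
  proof -
    have s: "sgn (s + t) = s" if "0 \<le> s * t" "s = 1 \<or> s = -1" for s t :: int using that by auto
    show ?thesis
    proof (rule s)
      show "0 \<le> \<chi> u m p * \<chi> u q v * (\<chi> u m v * \<chi> u p q)" using M2 by (simp only: mult_ac)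
      show "\<chi> u m p * \<chi> u q v = 1 \<or> \<chi> u m p * \<chi> u q v = - 1"
        using nz nq a val[of u m p] val[of u q v] by auto
    qed
  qed
  ultimately have e: "\<chi> u m q * \<chi> u p v = \<chi> u m p * \<chi> u q v" by simp
  have "\<chi> u m p * \<chi> u m q * (\<chi> u p v * \<chi> u q v) = (\<chi> u m q * \<chi> u p v) * (\<chi> u m p * \<chi> u q v)" by (simp only: mult_ac)
  also have "\<dots> = 1" unfolding e using nz nq a val[of u m p] val[of u q v] by auto
  finally show False using M1 by simp
qed

theorem pos_iso_three_point_line:
  assumes nl4: "\<And>L. is_line L \<Longrightarrow> card L < 4" and n: "7 \<le> card E"
    and del: "\<And>e. e \<in> E \<Longrightarrow> pos_iso (E - {e}) \<chi>"
    and x: "x \<in> E" "y \<in> E" "z \<in> E" "x \<noteq> y" "x \<noteq> z" "y \<noteq> z" "\<chi> x y z = 0"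
  shows "pos_iso E \<chi>"
proof -
  define L where "L = {x, y, z}"
  have L: "is_line L" unfolding L_def by (rule is_line3[OF nl4]) (use x in auto)
  have cL: "card L = 3" unfolding L_def using x by simp
  have LE: "L \<subseteq> E" unfolding L_def using x by auto
  define F where "F = E - L"
  have fL: "finite L" using cL card.infinite by fastforce
  have "card F = card E - 3" unfolding F_def using LE cL fL by (subst card_Diff_subset) auto
  then have cF: "4 \<le> card F" using n by simp
  have third: "\<exists>q. L = {m, m', q} \<and> q \<noteq> m \<and> q \<noteq> m'" if "m \<in> L" "m' \<in> L" "m \<noteq> m'" for m m'
    using that x unfolding L_def by blast
  have two: "\<exists>q\<in>L. \<chi> q u v = 0 \<and> q \<noteq> m \<and> q \<noteq> m'"
    if "m \<in> L" "m' \<in> L" "m \<noteq> m'" "u \<in> F" "middle L m u v" "middle L m' u v" for m m' u v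
    using third[OF that(1-3)] middle_unique[of m m' _ u v] L that unfolding F_def by blast
  have "\<exists>m\<in>L. \<forall>u\<in>F - {e}. \<forall>v\<in>F - {e}. u \<noteq> v \<longrightarrow> middle L m u v" if e: "e \<in> F" for e
  proof -
    obtain w where w: "w \<in> F" "w \<noteq> e" using ex_notin_list[of "[e]" F] cF by auto
    have "(E - {e}) - L = F - {e}" unfolding F_def by blast
    then show ?thesis
      using middle_deletion[of "E - {e}" L w] del[of e] e w L cL LE unfolding F_def by auto
  qed
  then obtain T where T: "\<And>e. e \<in> F \<Longrightarrow> T e \<in> L"
    "\<And>e u v. e \<in> F \<Longrightarrow> u \<in> F - {e} \<Longrightarrow> v \<in> F - {e} \<Longrightarrow> u \<noteq> v \<Longrightarrow> middle L (T e) u v" by metis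
  \<comment> \<open>At least four points off the line choose among three candidates, so two of the
    choices \<open>T\<close> agree.\<close>
  have "card (T ` F) \<le> card L" by (rule card_mono[OF fL]) (use T(1) in blast)
  then have "\<not> inj_on T F" using cF cL card_image by fastforce
  then obtain g h where gh: "g \<in> F" "h \<in> F" "g \<noteq> h" "T g = T h" unfolding inj_on_def by blast
  \<comment> \<open>If \<open>e\<close> chose another middle point than \<open>g\<close> and
    \<open>h\<close>, then for a fourth point \<open>f\<close> both choices apply to the pairs
    \<open>f, h\<close> and \<open>f, g\<close>. The third point \<open>q\<close> of
    \<open>L\<close> would lie on both lines, so \<open>q, f, g, h\<close> would be four collinear
    points.\<close>
  have const: "T e = T g" if e: "e \<in> F" for e
  proof (rule ccontr)
    assume ne: "T e \<noteq> T g"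
    obtain f where f: "f \<in> F" "f \<noteq> e" "f \<noteq> g" "f \<noteq> h" using ex_notin_list[of "[e, g, h]" F] cF by auto
    have d: "e \<noteq> g" "e \<noteq> h" using ne gh by auto
    obtain q where q: "q \<in> L" "\<chi> q f h = 0" "q \<noteq> T e" "q \<noteq> T g"
      using two[of "T e" "T g" f h] T(1)[OF e] T(1)[OF gh(1)] ne f T(2)[OF e, of f h] T(2)[OF gh(1), of f h] gh d by blast
    obtain q' where q': "q' \<in> L" "\<chi> q' f g = 0" "q' \<noteq> T e" "q' \<noteq> T g"
      using two[of "T e" "T h" f g] T(1)[OF e] T(1)[OF gh(2)] ne f T(2)[OF e, of f g] T(2)[OF gh(2), of f g] gh d
      unfolding gh(4) by blast
    have "q' = q" using third[OF T(1)[OF e] T(1)[OF gh(1)] ne] q q' by blast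
    then have z: "\<chi> q f h = 0" "\<chi> q f g = 0" using q q' by auto
    have m: "q \<in> E" "f \<in> E" "h \<in> E" "g \<in> E" "q \<noteq> f" "q \<noteq> h" "q \<noteq> g"
      using q(1) LE f gh unfolding F_def by auto
    have "is_line {q, f, h}" by (rule is_line3[OF nl4]) (use m f z in auto)
    then have "\<chi> g q f \<noteq> 0" by (rule is_line_off) (use m f gh in auto)
    then show False using z(2) cyc by metis
  qed
  have M: "middle L (T g) u v" if uv: "u \<in> F" "v \<in> F" "u \<noteq> v" for u v
  proof -
    obtain e where e: "e \<in> F" "e \<noteq> u" "e \<noteq> v" using ex_notin_list[of "[u, v]" F] cF by auto
    then show ?thesis using T(2)[OF e(1), of u v] uv const[OF e(1)] by auto
  qed
  obtain p q where pq: "L = {p, T g, q}" "p \<noteq> T g" "q \<noteq> T g" "p \<noteq> q"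
    using T(1)[OF gh(1)] x unfolding L_def by blast
  show ?thesis
  proof (rule three_point_line_mid[OF nl4 n, of p "T g" q])
    show "\<chi> p (T g) q = 0" by (rule is_line_col[OF L]) (simp_all add: pq(1))
    show "\<chi> u (T g) p * \<chi> u (T g) q * (\<chi> p u v * \<chi> q u v) \<le> 0"
      if "u \<in> E - {p, T g, q}" "v \<in> E - {p, T g, q}" "u \<noteq> v" for u v
      using M[of u v] that pq unfolding F_def middle_def by blast
  qed (use pq LE del in auto)
qed

end

section \<open>The uniform case\<close>

text \<open>Multiplying the comparison of two numbers by their signs relative to \<open>op\<close>
  gives the comparison in the linear order cut at \<open>op\<close>. In that order the three
  equations form a cycle.\<close>

lemma no_double_change:
  fixes oi oj ok op s :: int
  assumes n: "oi \<noteq> op" "oj \<noteq> op" "ok \<noteq> op" and s: "s = 1 \<or> s = -1"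
    and ij: "sgn (oj - oi) = - s * sgn (oi - op) * sgn (oj - op)"
    and ik: "sgn (ok - oi) = s * sgn (oi - op) * sgn (ok - op)"
    and jk: "sgn (ok - oj) = - s * sgn (oj - op) * sgn (ok - op)"
  shows False
proof -
  consider "oi < op" | "op < oi" using n by linarith
  then have a: "sgn (oi - op) = -1 \<and> oi < op \<or> sgn (oi - op) = 1 \<and> op < oi" by cases auto
  consider "oj < op" | "op < oj" using n by linarith
  then have b: "sgn (oj - op) = -1 \<and> oj < op \<or> sgn (oj - op) = 1 \<and> op < oj" by cases auto
  consider "ok < op" | "op < ok" using n by linarith
  then have c: "sgn (ok - op) = -1 \<and> ok < op \<or> sgn (ok - op) = 1 \<and> op < ok" by cases auto
  show False using a b c s ij ik jk by (elim disjE conjE) (simp_all add: sgn_1_pos sgn_1_neg)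
qed

section \<open>Gluing the signs of the deletions\<close>

context chiro
begin

text \<open>Triples through \<open>p\<close> express the order \<open>m\<close> of the deletion by
  \<open>h\<close>, the signs and the sides of \<open>p\<close>. In triples without \<open>p\<close>
  the sides cancel, so \<open>h\<close> is an order for them as well, with signs \<open>R\<close>.
  The last clause, that \<open>R\<close> changes at most once along \<open>h\<close>, expresses that
  \<open>p\<close> has a place in the order.\<close>

lemma uniform_deletion:
  assumes p: "p \<in> E" and a: "a \<in> E - {p}"
    and nz: "\<And>x y z. x \<in> E \<Longrightarrow> y \<in> E \<Longrightarrow> z \<in> E \<Longrightarrow> x \<noteq> y \<Longrightarrow> x \<noteq> z \<Longrightarrow> y \<noteq> z \<Longrightarrow> \<chi> x y z \<noteq> 0"
    and h: "\<And>i j. i \<in> E - {p} \<Longrightarrow> j \<in> E - {p} \<Longrightarrow> \<chi> p i j = sgn (h j - h i)"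
    and del: "pos_iso (E - {a}) \<chi>"
  shows "\<exists>R. sign_fun R \<and>
     (\<forall>i\<in>E - {p,a}. \<forall>j\<in>E - {p,a}. \<forall>k\<in>E - {p,a}. i \<noteq> j \<longrightarrow> i \<noteq> k \<longrightarrow> j \<noteq> k \<longrightarrow>
        \<chi> i j k * sg3 (h i) (h j) (h k) = R i * R j * R k) \<and>
     (\<forall>i\<in>E - {p,a}. \<forall>j\<in>E - {p,a}. \<forall>k\<in>E - {p,a}. h i < h j \<longrightarrow> h j < h k \<longrightarrow> R i = R k \<longrightarrow> R j = R i)"
proof -
  obtain s m where s: "sign_fun s" and m: "pos_on (E - {a}) (resign s \<chi>) m" using del unfolding pos_iso_def by blast
  interpret R: chiro E "resign s \<chi>" by (rule chiro_resign[OF s])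
  define R where "R i = s p * s i" for i
  have sq: "s t * s t = 1" for t by (rule sign_fun_sq[OF s])
  have spm: "s t = 1 \<or> s t = -1" for t using s unfolding sign_fun_def by blast
  have Rs: "sign_fun R" unfolding sign_fun_def R_def
  proof
    fix x show "s p * s x = 1 \<or> s p * s x = -1" using spm[of p] spm[of x] by (elim disjE) simp_all
  qed
  have pa: "p \<noteq> a" using a by blast
  let ?N = "E - {p,a}"
  \<comment> \<open>The side of \<open>p\<close> on which \<open>i\<close> lies in the order of the
    deletion.\<close>
  define \<alpha> where "\<alpha> i = sgn (m i - m p)" for i
  have mp: "m i \<noteq> m p" if "i \<in> ?N" for i using pos_on_neq[OF m, of i p] that p pa by auto
  have asq: "\<alpha> i * \<alpha> i = 1" if "i \<in> ?N" for i using mp[OF that] unfolding \<alpha>_def by (auto simp: sgn_if)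
  have e: "resign s \<chi> x y z = sg3 (m x) (m y) (m z)"
    if "x \<in> E - {a}" "y \<in> E - {a}" "z \<in> E - {a}" "x \<noteq> y" "x \<noteq> z" "y \<noteq> z" for x y z
    by (rule R.pos_on_eq[OF m that(1-3)]) (use resign_nz[OF s] nz[of x y z] that in auto)
  have ij: "sgn (m j - m i) = s p * s i * s j * (\<alpha> i * \<alpha> j) * sgn (h j - h i)"
    if ij: "i \<in> ?N" "j \<in> ?N" "i \<noteq> j" for i j
  proof -
    have "s p * s i * s j * sgn (h j - h i) = \<alpha> i * \<alpha> j * sgn (m j - m i)"
      using e[of p i j] h[of i j] ij p pa unfolding resign_def sg3_def \<alpha>_def by auto
    then have "s p * s i * s j * (\<alpha> i * \<alpha> j) * sgn (h j - h i) = (\<alpha> i * \<alpha> i) * (\<alpha> j * \<alpha> j) * sgn (m j - m i)"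
      by (metis (no_types, lifting) mult.assoc mult.commute)
    then show ?thesis unfolding asq[OF ij(1)] asq[OF ij(2)] by simp
  qed
  have 1: "\<chi> i j k * sg3 (h i) (h j) (h k) = R i * R j * R k"
    if n: "i \<in> ?N" "j \<in> ?N" "k \<in> ?N" "i \<noteq> j" "i \<noteq> k" "j \<noteq> k" for i j k
  proof -
    have "s i * s j * s k * \<chi> i j k = sgn (m j - m i) * sgn (m k - m i) * sgn (m k - m j)"
      using e[of i j k] n unfolding resign_def sg3_def by auto
    also have "\<dots> = s p * (s p * s p) * (s i * s i) * (s j * s j) * (s k * s k) * (\<alpha> i * \<alpha> i) * (\<alpha> j * \<alpha> j) * (\<alpha> k * \<alpha> k) *
        sg3 (h i) (h j) (h k)"
      unfolding ij[OF n(1,2,4)] ij[OF n(1,3,5)] ij[OF n(2,3,6)] sg3_def by (simp only: mult_ac)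
    also have "\<dots> = s p * sg3 (h i) (h j) (h k)" using sq asq n by simp
    finally have g: "s i * s j * s k * \<chi> i j k = s p * sg3 (h i) (h j) (h k)" .
    have "h i \<noteq> h j" "h i \<noteq> h k" "h j \<noteq> h k"
      using h[of i j] h[of i k] h[of j k] nz[of p i j] nz[of p i k] nz[of p j k] n p by auto
    then have g2: "sg3 (h i) (h j) (h k) * sg3 (h i) (h j) (h k) = 1" 
      unfolding sg3_def by (auto simp: sgn_if)
    have "\<chi> i j k * sg3 (h i) (h j) (h k) = (s i * s i) * (s j * s j) * (s k * s k) * \<chi> i j k * sg3 (h i) (h j) (h k)"
      using sq by simp
    also have "\<dots> = (s i * s j * s k) * (s i * s j * s k * \<chi> i j k) * sg3 (h i) (h j) (h k)" by (simp only: mult_ac)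
    also have "\<dots> = (s i * s j * s k) * s p * (sg3 (h i) (h j) (h k) * sg3 (h i) (h j) (h k))" unfolding g by (simp only: mult_ac)
    also have "\<dots> = (s p * s p) * (s i * s j * s k) * s p" unfolding g2 using sq by (simp add: mult_ac)
    finally show ?thesis unfolding R_def by (simp only: mult_ac)
  qed
  have 2: "R j = R i" if n: "i \<in> ?N" "j \<in> ?N" "k \<in> ?N" "h i < h j" "h j < h k" "R i = R k" for i j k
  proof (rule ccontr)
    assume "R j \<noteq> R i"
    then have sj: "s j = - s i" "s k = s i" using n(6) spm[of i] spm[of j] spm[of k] spm[of p] unfolding R_def by auto
    have d: "i \<noteq> j" "i \<noteq> k" "j \<noteq> k" using n by auto
    have "sgn (m j - m i) = - s p * \<alpha> i * \<alpha> j" "sgn (m k - m i) = s p * \<alpha> i * \<alpha> k" "sgn (m k - m j) = - s p * \<alpha> j * \<alpha> k"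
      using ij[OF n(1,2) d(1)] ij[OF n(1,3) d(2)] ij[OF n(2,3) d(3)] n(4,5) sq[of i] unfolding sj by (auto simp: mult_ac)
    then show False using no_double_change[OF mp[OF n(1)] mp[OF n(2)] mp[OF n(3)] spm[of p]] unfolding \<alpha>_def by blast
  qed
  show ?thesis by (rule exI[of _ R]) (use Rs 1 2 in blast)
qed

lemma three_avoiding:
  assumes "6 \<le> card N"
  obtains j k l where "j \<in> N - {a,b,i}" "k \<in> N - {a,b,i}" "l \<in> N - {a,b,i}" "j \<noteq> k" "j \<noteq> l" "k \<noteq> l"
proof -
  have "card N - card {a,b,i} \<le> card (N - {a,b,i})" by (rule diff_card_le_card_Diff) simp
  moreover have "card {a,b,i} \<le> 3" by (simp add: card_insert_if)
  ultimately have "3 \<le> card (N - {a,b,i})" using assms by linarith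
  then obtain M where M: "M \<subseteq> N - {a,b,i}" "card M = 3" by (meson obtain_subset_with_card_n)
  then obtain j k l where "M = {j,k,l}" "j \<noteq> k" "j \<noteq> l" "k \<noteq> l" unfolding card_3_iff by blast
  then show ?thesis using that M(1) by blast
qed

text \<open>The signs of any two deletions agree where both are defined, and any three points are
  contained in some deletion, so the glued signs \<open>G\<close> inherit the product formula and
  the single change along \<open>h\<close>. The place of that change is the place for
  \<open>p\<close>.\<close>

lemma uniform_sorted:
  assumes n: "7 \<le> card E" and p: "p \<in> E"
    and nz: "\<And>x y z. x \<in> E \<Longrightarrow> y \<in> E \<Longrightarrow> z \<in> E \<Longrightarrow> x \<noteq> y \<Longrightarrow> x \<noteq> z \<Longrightarrow> y \<noteq> z \<Longrightarrow> \<chi> x y z \<noteq> 0"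
    and h: "\<And>i j. i \<in> E - {p} \<Longrightarrow> j \<in> E - {p} \<Longrightarrow> \<chi> p i j = sgn (h j - h i)"
    and inj: "inj_on h (E - {p})"
    and del: "\<And>e. e \<in> E \<Longrightarrow> pos_iso (E - {e}) \<chi>"
  shows "pos_iso E \<chi>"
proof -
  let ?N = "E - {p}"
  define \<tau> where "\<tau> i j k = \<chi> i j k * sg3 (h i) (h j) (h k)" for i j k
  have cN: "6 \<le> card ?N" using n p fin by simp
  have fN: "finite ?N" using fin by simp
  have "\<forall>a\<in>?N. \<exists>R. sign_fun R \<and>
     (\<forall>i\<in>?N - {a}. \<forall>j\<in>?N - {a}. \<forall>k\<in>?N - {a}. i \<noteq> j \<longrightarrow> i \<noteq> k \<longrightarrow> j \<noteq> k \<longrightarrow> \<tau> i j k = R i * R j * R k) \<and>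
     (\<forall>i\<in>?N - {a}. \<forall>j\<in>?N - {a}. \<forall>k\<in>?N - {a}. h i < h j \<longrightarrow> h j < h k \<longrightarrow> R i = R k \<longrightarrow> R j = R i)"
  proof
    fix a assume a: "a \<in> ?N"
    have "E - {p, a} = ?N - {a}" by blast
    then show "\<exists>R. sign_fun R \<and>
     (\<forall>i\<in>?N - {a}. \<forall>j\<in>?N - {a}. \<forall>k\<in>?N - {a}. i \<noteq> j \<longrightarrow> i \<noteq> k \<longrightarrow> j \<noteq> k \<longrightarrow> \<tau> i j k = R i * R j * R k) \<and>
     (\<forall>i\<in>?N - {a}. \<forall>j\<in>?N - {a}. \<forall>k\<in>?N - {a}. h i < h j \<longrightarrow> h j < h k \<longrightarrow> R i = R k \<longrightarrow> R j = R i)"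
      using uniform_deletion[OF p a nz h del] a unfolding \<tau>_def by simp
  qed
  from bchoice[OF this] obtain R where "\<forall>a\<in>?N. sign_fun (R a) \<and>
     (\<forall>i\<in>?N - {a}. \<forall>j\<in>?N - {a}. \<forall>k\<in>?N - {a}. i \<noteq> j \<longrightarrow> i \<noteq> k \<longrightarrow> j \<noteq> k \<longrightarrow> \<tau> i j k = R a i * R a j * R a k) \<and>
     (\<forall>i\<in>?N - {a}. \<forall>j\<in>?N - {a}. \<forall>k\<in>?N - {a}. h i < h j \<longrightarrow> h j < h k \<longrightarrow> R a i = R a k \<longrightarrow> R a j = R a i)"
    by (elim exE)
  then have Rs: "\<And>a. a \<in> ?N \<Longrightarrow> sign_fun (R a)"
    and R\<tau>: "\<And>a i j k. a \<in> ?N \<Longrightarrow> i \<in> ?N - {a} \<Longrightarrow> j \<in> ?N - {a} \<Longrightarrow> k \<in> ?N - {a} \<Longrightarrow> i \<noteq> j \<Longrightarrow> i \<noteq> k \<Longrightarrow> j \<noteq> k \<Longrightarrow>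
        \<tau> i j k = R a i * R a j * R a k"
    and Rm: "\<And>a i j k. a \<in> ?N \<Longrightarrow> i \<in> ?N - {a} \<Longrightarrow> j \<in> ?N - {a} \<Longrightarrow> k \<in> ?N - {a} \<Longrightarrow> h i < h j \<Longrightarrow> h j < h k \<Longrightarrow>
        R a i = R a k \<Longrightarrow> R a j = R a i"
    by metis+
  have Req: "R a i = R b i" if ab: "a \<in> ?N" "b \<in> ?N" "i \<in> ?N" "i \<noteq> a" "i \<noteq> b" for a b i
  proof -
    obtain j k l where jkl: "j \<in> ?N - {a,b,i}" "k \<in> ?N - {a,b,i}" "l \<in> ?N - {a,b,i}" "j \<noteq> k" "j \<noteq> l" "k \<noteq> l"
      by (rule three_avoiding[OF cN])
    \<comment> \<open>In the product \<open>i\<close> occurs three times and \<open>j, k, l\<close>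
      twice, so the sign at \<open>i\<close> is determined by \<open>\<tau>\<close> alone and cannot
      depend on the deletion. Here \<open>E - {p}\<close> must have three points besides
      \<open>a, b, i\<close>.\<close>
    have "R c i = \<tau> i j k * \<tau> i j l * \<tau> i k l" if c: "c \<in> {a, b}" for c
    proof -
      have cN: "c \<in> ?N" using c ab by blast
      have "i \<in> ?N - {c}" "j \<in> ?N - {c}" "k \<in> ?N - {c}" "l \<in> ?N - {c}" using c ab jkl by blast+
      then have t: "\<tau> i j k = R c i * R c j * R c k" "\<tau> i j l = R c i * R c j * R c l" "\<tau> i k l = R c i * R c k * R c l"
        using R\<tau>[OF cN] jkl by blast+
      have "\<tau> i j k * \<tau> i j l * \<tau> i k l = R c i * (R c i * R c i) * (R c j * R c j) * (R c k * R c k) * (R c l * R c l)"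
        unfolding t by (simp only: mult_ac)
      then show ?thesis using sign_fun_sq[OF Rs[OF cN]] by simp
    qed
    then show ?thesis by simp
  qed
  \<comment> \<open>Any deleted point other than \<open>i\<close> gives the same sign at
    \<open>i\<close>. The default 1 leaves \<open>p\<close> unchanged.\<close>
  define G where "G i = (if i \<in> ?N then R (SOME a. a \<in> ?N - {i}) i else 1)" for i
  have GR: "G i = R a i" if "a \<in> ?N" "i \<in> ?N - {a}" for a i
  proof -
    have "\<exists>b. b \<in> ?N - {i}" using that by blast
    then have "(SOME a. a \<in> ?N - {i}) \<in> ?N - {i}" by (rule someI_ex)
    then show ?thesis using Req[of a "SOME a. a \<in> ?N - {i}" i] that unfolding G_def by auto
  qed
  have other: "\<exists>a\<in>?N. a \<noteq> i \<and> a \<noteq> j \<and> a \<noteq> k" for i j k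
    by (rule three_avoiding[OF cN, of i j k]) blast
  have Gs: "sign_fun G" unfolding sign_fun_def
  proof
    fix i show "G i = 1 \<or> G i = -1"
    proof (cases "i \<in> ?N")
      case True
      obtain a where a: "a \<in> ?N" "a \<noteq> i" using other by blast
      then have "G i = R a i" using GR True by blast
      then show ?thesis using Rs[OF a(1)] unfolding sign_fun_def by metis
    qed (simp only: G_def if_False simp_thms)
  qed
  have G\<tau>: "\<tau> i j k = G i * G j * G k" if "i \<in> ?N" "j \<in> ?N" "k \<in> ?N" "i \<noteq> j" "i \<noteq> k" "j \<noteq> k" for i j k
  proof -
    obtain a where a: "a \<in> ?N" "a \<noteq> i" "a \<noteq> j" "a \<noteq> k" using other by blast
    then have d: "i \<in> ?N - {a}" "j \<in> ?N - {a}" "k \<in> ?N - {a}" using that by auto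
    show ?thesis unfolding GR[OF a(1) d(1)] GR[OF a(1) d(2)] GR[OF a(1) d(3)] by (rule R\<tau>[OF a(1) d that(4-6)])
  qed
  have Gm: "G j = G i" if "i \<in> ?N" "j \<in> ?N" "k \<in> ?N" "h i < h j" "h j < h k" "G i = G k" for i j k
  proof -
    obtain a where a: "a \<in> ?N" "a \<noteq> i" "a \<noteq> j" "a \<noteq> k" using other by blast
    then have d: "i \<in> ?N - {a}" "j \<in> ?N - {a}" "k \<in> ?N - {a}" using that by auto
    show ?thesis using Rm[OF a(1) d that(4,5)] that(6) unfolding GR[OF a(1) d(1)] GR[OF a(1) d(2)] GR[OF a(1) d(3)] by blast
  qed
  have Gp: "G p = 1" unfolding G_def by simp
  have "?N \<noteq> {}" using cN by (metis card.empty not_numeral_le_zero)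
  then have "Min (h ` ?N) \<in> h ` ?N" using fN by (intro Min_in) auto
  then obtain f where f: "f \<in> ?N" "\<And>i. i \<in> ?N \<Longrightarrow> h f \<le> h i" using fN by (metis (no_types, lifting) Min_le finite_imageI image_iff)
  \<comment> \<open>The points with the sign of the first point \<open>f\<close>. By
    \<open>Gm\<close> they form an initial segment, with last value \<open>M\<close>.\<close>
  define I where "I = {i\<in>?N. G i = G f}"
  have fI: "finite I" "f \<in> I" unfolding I_def using fN f by auto
  define M where "M = Max (h ` I)"
  have M1: "h i \<le> M" if "i \<in> I" for i unfolding M_def using fI that by simp
  have "M \<in> h ` I" unfolding M_def using fI by (intro Max_in) auto
  then obtain m where m: "m \<in> I" "h m = M" by blast
  have M2: "M < h j" if j: "j \<in> ?N" "j \<notin> I" for j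
  proof (rule ccontr)
    assume "\<not> M < h j"
    moreover have "h j \<noteq> h m" "h j \<noteq> h f" using inj j m f fI unfolding inj_on_def I_def by auto
    ultimately have "h f < h j" "h j < h m" using f(2)[OF j(1)] m by auto
    then show False using Gm[of f j m] f j m unfolding I_def by auto
  qed
  \<comment> \<open>The odd value places \<open>p\<close> directly after the initial segment, so the
    side of \<open>p\<close> on which a point lies is given by its sign in \<open>G\<close>.\<close>
  define k where "k x = (if x = p then 2 * M + 1 else 2 * h x)" for x
  have s1: "sgn (k i - k p) = - (G i * G f)" if i: "i \<in> ?N" for i
  proof (cases "i \<in> I")
    case True
    then have "G i * G f = 1" using sign_fun_sq[OF Gs] unfolding I_def by simp
    then show ?thesis using M1[OF True] i unfolding k_def by (auto simp: sgn_if)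
  next
    case False
    then have "G i \<noteq> G f" using i unfolding I_def by blast
    then have "G i * G f = -1" using Gs unfolding sign_fun_def by (metis mult_1 mult_minus1)
    then show ?thesis using M2[OF i False] i unfolding k_def by (auto simp: sgn_if)
  qed
  have s2: "sgn (k j - k i) = sgn (h j - h i)" if "i \<in> ?N" "j \<in> ?N" for i j
    using that unfolding k_def by (auto simp: sgn_if)
  interpret G: chiro E "resign G \<chi>" by (rule chiro_resign[OF Gs])
  have injk: "inj_on k E"
  proof (rule inj_onI)
    fix x y assume a: "x \<in> E" "y \<in> E" "k x = k y"
    have "2 * M + 1 \<noteq> 2 * h y" "2 * h x \<noteq> 2 * M + 1" by presburger+
    then show "x = y" using a inj unfolding k_def inj_on_def by (auto split: if_splits)
  qed
  have "pos_on E (resign G \<chi>) k"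
  proof (rule G.pos_on_splitI[OF injk])
    fix x y assume xy: "x \<in> E - {p}" "y \<in> E - {p}"
    have "resign G \<chi> p x y * sg3 (k p) (k x) (k y) =
      (G x * sgn (h y - h x)) * (G x * sgn (h y - h x)) * (G f * G f) * (G y * G y)"
      unfolding resign_def sg3_def s1[OF xy(1)] s1[OF xy(2)] s2[OF xy] h[OF xy] Gp by (simp add: mult_ac)
    then show "0 \<le> resign G \<chi> p x y * sg3 (k p) (k x) (k y)" by (simp add: sign_fun_sq[OF Gs])
  next
    fix x y z assume xyz: "x \<in> E - {p}" "y \<in> E - {p}" "z \<in> E - {p}"
    show "0 \<le> resign G \<chi> x y z * sg3 (k x) (k y) (k z)"
    proof (cases "x = y \<or> x = z \<or> y = z")
      case False
      have "sg3 (k x) (k y) (k z) = sg3 (h x) (h y) (h z)" unfolding sg3_def using s2 xyz by simp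
      then have "resign G \<chi> x y z * sg3 (k x) (k y) (k z) = G x * G y * G z * \<tau> x y z"
        unfolding resign_def \<tau>_def by (simp only: mult_ac)
      also have "\<dots> = (G x * G x) * (G y * G y) * (G z * G z)" using G\<tau>[OF xyz] False by (simp add: mult_ac)
      finally show ?thesis using sign_fun_sq[OF Gs] by simp
    qed auto
  qed
  then show ?thesis unfolding pos_iso_def using Gs by blast
qed

theorem pos_iso_uniform:
  assumes n: "7 \<le> card E"
    and nz: "\<And>x y z. x \<in> E \<Longrightarrow> y \<in> E \<Longrightarrow> z \<in> E \<Longrightarrow> x \<noteq> y \<Longrightarrow> x \<noteq> z \<Longrightarrow> y \<noteq> z \<Longrightarrow> \<chi> x y z \<noteq> 0"
    and del: "\<And>e. e \<in> E \<Longrightarrow> pos_iso (E - {e}) \<chi>"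
  shows "pos_iso E \<chi>"
proof -
  obtain p where p: "p \<in> E" using n by fastforce
  obtain r h where r: "sign_fun r" and h: "inj_on h (E - {p})"
    "\<forall>i\<in>E - {p}. \<forall>j\<in>E - {p}. resign r \<chi> p i j = sgn (h j - h i)"
    by (rule sort_around[of "E - {p}" p]) (use nz p in auto)
  interpret R: chiro E "resign r \<chi>" by (rule chiro_resign[OF r])
  have "pos_iso E (resign r \<chi>)"
    by (rule R.uniform_sorted[OF n p]) (use nz h del resign_nz[OF r] pos_iso_resign[OF r] in auto)
  then show ?thesis using pos_iso_resign[OF r] by blast
qed

theorem pos_iso_of_deletions:
  assumes n: "7 \<le> card E" and del: "\<And>e. e \<in> E \<Longrightarrow> pos_iso (E - {e}) \<chi>"
  shows "pos_iso E \<chi>"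
proof (cases "\<exists>L. is_line L \<and> 4 \<le> card L")
  case True
  then show ?thesis using pos_iso_long_line[OF del] by blast
next
  case False
  then have nl4: "\<And>L. is_line L \<Longrightarrow> card L < 4" by force
  show ?thesis
  proof (cases "\<exists>x y z. x \<in> E \<and> y \<in> E \<and> z \<in> E \<and> x \<noteq> y \<and> x \<noteq> z \<and> y \<noteq> z \<and> \<chi> x y z = 0")
    case True
    then show ?thesis using pos_iso_three_point_line[OF nl4 n del] by blast
  next
    case False
    then show ?thesis using pos_iso_uniform[OF n _ del] by blast
  qed
qed

end

section \<open>From circuits to chirotopes\<close>

text \<open>The notion \<open>chirotope_of\<close> for the restriction to \<open>S\<close> in rank
  3, with three arguments instead of a list and the value 0 as soon as an argument is outside
  \<open>S\<close>.\<close>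

definition chir :: "'a signed_set set \<Rightarrow> 'a set \<Rightarrow> ('a \<Rightarrow> 'a \<Rightarrow> 'a \<Rightarrow> int) \<Rightarrow> bool" where
  "chir C S \<chi> \<longleftrightarrow>
     (\<forall>x y z. \<chi> x y z = 0 \<or> \<chi> x y z = 1 \<or> \<chi> x y z = -1) \<and>
     (\<forall>x y z. \<chi> y x z = - \<chi> x y z) \<and> (\<forall>x y z. \<chi> x z y = - \<chi> x y z) \<and>
     (\<forall>x y z. \<chi> x y z \<noteq> 0 \<longleftrightarrow> x \<in> S \<and> y \<in> S \<and> z \<in> S \<and> x \<noteq> y \<and> x \<noteq> z \<and> y \<noteq> z \<and> om_indep C {x, y, z}) \<and>
     (\<forall>X\<in>C. \<forall>e f x y. {e, f, x, y} \<subseteq> S \<longrightarrow> e \<noteq> f \<longrightarrow> e \<in> supp X \<longrightarrow> f \<in> supp X \<longrightarrow> supp X \<subseteq> {e, f, x, y} \<longrightarrow>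
        \<chi> f x y = - sgn_at X e * sgn_at X f * \<chi> e x y)"

lemma chirD:
  assumes "chir C S \<chi>"
  shows "\<chi> x y z = 0 \<or> \<chi> x y z = 1 \<or> \<chi> x y z = -1" "\<chi> y x z = - \<chi> x y z" "\<chi> x z y = - \<chi> x y z"
    "\<chi> x y z \<noteq> 0 \<longleftrightarrow> x \<in> S \<and> y \<in> S \<and> z \<in> S \<and> x \<noteq> y \<and> x \<noteq> z \<and> y \<noteq> z \<and> om_indep C {x, y, z}"
proof -
  note c = assms[unfolded chir_def]
  show "\<chi> x y z = 0 \<or> \<chi> x y z = 1 \<or> \<chi> x y z = -1" by (rule c[THEN conjunct1, rule_format])
  show "\<chi> y x z = - \<chi> x y z" by (rule c[THEN conjunct2, THEN conjunct1, rule_format])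
  show "\<chi> x z y = - \<chi> x y z" by (rule c[THEN conjunct2, THEN conjunct2, THEN conjunct1, rule_format])
  show "\<chi> x y z \<noteq> 0 \<longleftrightarrow> x \<in> S \<and> y \<in> S \<and> z \<in> S \<and> x \<noteq> y \<and> x \<noteq> z \<and> y \<noteq> z \<and> om_indep C {x, y, z}"
    by (rule c[THEN conjunct2, THEN conjunct2, THEN conjunct2, THEN conjunct1, rule_format])
qed

lemma chirI:
  assumes "\<And>x y z. \<chi> x y z = 0 \<or> \<chi> x y z = 1 \<or> \<chi> x y z = -1"
    and "\<And>x y z. \<chi> y x z = - \<chi> x y z" and "\<And>x y z. \<chi> x z y = - \<chi> x y z"
    and "\<And>x y z. \<chi> x y z \<noteq> 0 \<longleftrightarrow> x \<in> S \<and> y \<in> S \<and> z \<in> S \<and> x \<noteq> y \<and> x \<noteq> z \<and> y \<noteq> z \<and> om_indep C {x, y, z}"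
    and "\<And>X e f x y. X \<in> C \<Longrightarrow> {e, f, x, y} \<subseteq> S \<Longrightarrow> e \<noteq> f \<Longrightarrow> e \<in> supp X \<Longrightarrow> f \<in> supp X \<Longrightarrow>
      supp X \<subseteq> {e, f, x, y} \<Longrightarrow> \<chi> f x y = - sgn_at X e * sgn_at X f * \<chi> e x y"
  shows "chir C S \<chi>"
  unfolding chir_def
proof (intro conjI)
  show "\<forall>X\<in>C. \<forall>e f x y. {e, f, x, y} \<subseteq> S \<longrightarrow> e \<noteq> f \<longrightarrow> e \<in> supp X \<longrightarrow> f \<in> supp X \<longrightarrow> supp X \<subseteq> {e, f, x, y} \<longrightarrow>
        \<chi> f x y = - sgn_at X e * sgn_at X f * \<chi> e x y"
    by (intro ballI allI impI) (rule assms(5))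
qed (intro allI, rule assms(1-4))+

lemma chir_circuit:
  assumes "chir C S \<chi>" "X \<in> C" "{e, f, x, y} \<subseteq> S" "e \<noteq> f" "e \<in> supp X" "f \<in> supp X" "supp X \<subseteq> {e, f, x, y}"
  shows "\<chi> f x y = - sgn_at X e * sgn_at X f * \<chi> e x y"
  by (rule assms(1)[unfolded chir_def, THEN conjunct2, THEN conjunct2, THEN conjunct2, THEN conjunct2, rule_format])
    (use assms in simp_all)

text \<open>The locale bounds the rank from above only; where a basis matters, it is an explicit
  hypothesis.\<close>

locale om3 =
  fixes E :: "'a set" and C :: "'a signed_set set"
  assumes om: "oriented_matroid E C" and simple: "simple_om E C"
    and rank_le: "\<And>I. I \<subseteq> E \<Longrightarrow> om_indep C I \<Longrightarrow> card I \<le> 3"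
begin

abbreviation ind :: "'a \<Rightarrow> 'a \<Rightarrow> 'a \<Rightarrow> bool" where
  "ind x y z \<equiv> om_indep C {x, y, z}"

lemmas om_unfolded = om[unfolded oriented_matroid_def]
lemmas finE = om_unfolded[THEN conjunct1]
  and disj_supp = om_unfolded[THEN conjunct2, THEN conjunct1]
  and no_empty = om_unfolded[THEN conjunct2, THEN conjunct2, THEN conjunct1]
  and sneg_C' = om_unfolded[THEN conjunct2, THEN conjunct2, THEN conjunct2, THEN conjunct1]
  and incomparable = om_unfolded[THEN conjunct2, THEN conjunct2, THEN conjunct2, THEN conjunct2, THEN conjunct1]
  and signed_elim = om_unfolded[THEN conjunct2, THEN conjunct2, THEN conjunct2, THEN conjunct2, THEN conjunct2]

lemma supp_E: "X \<in> C \<Longrightarrow> supp X \<subseteq> E" and disj: "X \<in> C \<Longrightarrow> fst X \<inter> snd X = {}"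
  and sneg_C: "X \<in> C \<Longrightarrow> sneg X \<in> C"
  using disj_supp sneg_C' by blast+

lemma sgn_at_val: "sgn_at X e = 0 \<or> sgn_at X e = 1 \<or> sgn_at X e = -1"
  unfolding sgn_at_def by auto

lemma sgn_at_supp: "sgn_at X e \<noteq> 0 \<longleftrightarrow> e \<in> supp X"
  unfolding sgn_at_def supp_def by auto

lemma sgn_at_pm: "e \<in> supp X \<Longrightarrow> sgn_at X e = 1 \<or> sgn_at X e = -1"
  using sgn_at_val[of X e] sgn_at_supp[of X e] by blast

lemma sgn_at_sq: "e \<in> supp X \<Longrightarrow> sgn_at X e * sgn_at X e = 1"
  using sgn_at_pm[of e X] by auto

lemma sgn_at_sneg: "X \<in> C \<Longrightarrow> sgn_at (sneg X) e = - sgn_at X e"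
  using disj[of X] unfolding sgn_at_def sneg_def by auto

lemma supp_sneg [simp]: "supp (sneg X) = supp X"
  unfolding supp_def sneg_def by auto

lemma sneg_sneg [simp]: "sneg (sneg X) = X"
  unfolding sneg_def by simp

lemma elim_opp:
  assumes X: "X \<in> C" "Y \<in> C" "X \<noteq> sneg Y" and g: "sgn_at X g = - sgn_at Y g" "sgn_at Y g \<noteq> 0"
  shows "\<exists>Z\<in>C. sgn_at Z g = 0 \<and> (\<forall>h. sgn_at Z h = 0 \<or> sgn_at Z h = sgn_at X h \<or> sgn_at Z h = sgn_at Y h)"
proof -
  have elim: "\<And>X Y e. X \<in> C \<Longrightarrow> Y \<in> C \<Longrightarrow> X \<noteq> sneg Y \<Longrightarrow> e \<in> fst X \<inter> snd Y \<Longrightarrow>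
     \<exists>Z\<in>C. fst Z \<subseteq> (fst X \<union> fst Y) - {e} \<and> snd Z \<subseteq> (snd X \<union> snd Y) - {e}"
    using signed_elim by blast
  have "\<exists>Z\<in>C. fst Z \<subseteq> (fst X \<union> fst Y) - {g} \<and> snd Z \<subseteq> (snd X \<union> snd Y) - {g}"
  proof (cases "g \<in> fst X")
    case True
    then have "g \<in> snd Y" using g unfolding sgn_at_def by (auto split: if_splits)
    then show ?thesis using elim[OF X] True by blast
  next
    case False
    then have "g \<in> fst Y \<inter> snd X" using g unfolding sgn_at_def by (auto split: if_splits)
    moreover have "Y \<noteq> sneg X" using X(3) by auto
    ultimately have "\<exists>Z\<in>C. fst Z \<subseteq> (fst Y \<union> fst X) - {g} \<and> snd Z \<subseteq> (snd Y \<union> snd X) - {g}"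
      using elim[OF X(2,1)] by blast
    then show ?thesis by (simp only: Un_commute)
  qed
  then obtain Z where Z: "Z \<in> C" "fst Z \<subseteq> (fst X \<union> fst Y) - {g}" "snd Z \<subseteq> (snd X \<union> snd Y) - {g}" by blast
  have "sgn_at Z g = 0" using Z unfolding sgn_at_def by auto
  moreover have "sgn_at Z h = 0 \<or> sgn_at Z h = sgn_at X h \<or> sgn_at Z h = sgn_at Y h" for h
  proof -
    consider "h \<in> fst Z" | "h \<in> snd Z" "h \<notin> fst Z" | "h \<notin> fst Z" "h \<notin> snd Z" by blast
    then show ?thesis
    proof cases
      case 1 then show ?thesis using Z(2) unfolding sgn_at_def by auto
    next
      case 2
      then have "h \<in> snd X \<or> h \<in> snd Y" using Z(3) by blast
      then show ?thesis using 2 disj[OF X(1)] disj[OF X(2)] unfolding sgn_at_def by auto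
    next
      case 3 then show ?thesis unfolding sgn_at_def by simp
    qed
  qed
  ultimately show ?thesis using Z(1) by blast
qed

text \<open>The factor \<open>- (sgn_at X g * sgn_at Y g)\<close> selects \<open>Y\<close> or its
  negative, whichever has the sign at \<open>g\<close> opposite to that of \<open>X\<close>, so
  elimination applies to any common element.\<close>

lemma elim:
  assumes X: "X \<in> C" "Y \<in> C" "X \<noteq> Y" "X \<noteq> sneg Y" and g: "g \<in> supp X" "g \<in> supp Y"
  obtains Z where "Z \<in> C" "g \<notin> supp Z" "supp Z \<subseteq> supp X \<union> supp Y"
    "\<And>h. sgn_at Z h = 0 \<or> sgn_at Z h = sgn_at X h \<or> sgn_at Z h = - (sgn_at X g * sgn_at Y g) * sgn_at Y h"
proof -
  note result = that
  have *: thesis if Z: "Z \<in> C" "sgn_at Z g = 0"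
    "\<forall>h. sgn_at Z h = 0 \<or> sgn_at Z h = sgn_at X h \<or> sgn_at Z h = - (sgn_at X g * sgn_at Y g) * sgn_at Y h" for Z
  proof (rule result[OF Z(1)])
    show "g \<notin> supp Z" using Z(2) sgn_at_supp by metis
    show "supp Z \<subseteq> supp X \<union> supp Y"
    proof
      fix h assume "h \<in> supp Z"
      then have "sgn_at Z h \<noteq> 0" using sgn_at_supp by metis
      then have "sgn_at X h \<noteq> 0 \<or> sgn_at Y h \<noteq> 0" using Z(3)[rule_format, of h] by auto
      then show "h \<in> supp X \<union> supp Y" using sgn_at_supp[of X h] sgn_at_supp[of Y h] by auto
    qed
  qed (rule Z(3)[rule_format])
  consider "sgn_at X g = - sgn_at Y g" | "sgn_at X g = sgn_at Y g"
    using sgn_at_pm[OF g(1)] sgn_at_pm[OF g(2)] by auto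
  then show thesis
  proof cases
    case 1
    have p: "- (sgn_at X g * sgn_at Y g) = 1" using 1 sgn_at_sq[OF g(2)] by simp
    have n: "sgn_at Y g \<noteq> 0" using g sgn_at_supp by metis
    obtain Z where Z: "Z \<in> C" "sgn_at Z g = 0" "\<forall>h. sgn_at Z h = 0 \<or> sgn_at Z h = sgn_at X h \<or> sgn_at Z h = sgn_at Y h"
      using elim_opp[OF X(1,2,4) 1 n] by blast
    show thesis by (rule *[OF Z(1,2)]) (use Z(3) p in simp)
  next
    case 2
    have p: "- (sgn_at X g * sgn_at Y g) = -1" using 2 sgn_at_sq[OF g(2)] by simp
    have n: "sgn_at (sneg Y) g \<noteq> 0" using g sgn_at_supp sgn_at_sneg[OF X(2)] by (metis neg_equal_0_iff_equal)
    have o: "sgn_at X g = - sgn_at (sneg Y) g" using 2 sgn_at_sneg[OF X(2)] by simp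
    have "X \<noteq> sneg (sneg Y)" using X by simp
    from elim_opp[OF X(1) sneg_C[OF X(2)] this o n] obtain Z where Z: "Z \<in> C" "sgn_at Z g = 0"
      "\<forall>h. sgn_at Z h = 0 \<or> sgn_at Z h = sgn_at X h \<or> sgn_at Z h = sgn_at (sneg Y) h" by blast
    show thesis by (rule *[OF Z(1,2)]) (use Z(3) p sgn_at_sneg[OF X(2)] in simp)
  qed
qed

text \<open>This is where simplicity enters: every circuit has at least three elements. The case
  \<open>x = y\<close> covers loops.\<close>

lemma not_pair: "X \<in> C \<Longrightarrow> \<not> supp X \<subseteq> {x, y}"
proof
  assume X: "X \<in> C" and s: "supp X \<subseteq> {x, y}"
  obtain A B where AB: "X = (A, B)" by (cases X)
  have d: "A \<inter> B = {}" "A \<subseteq> {x,y}" "B \<subseteq> {x,y}" using disj[OF X] s unfolding AB supp_def by auto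
  have C1: "(A, B) \<in> C" "(B, A) \<in> C" using X sneg_C[OF X] unfolding AB sneg_def by auto
  note e = no_empty
  have l: "({u}, {}) \<notin> C" and p: "u \<noteq> v \<Longrightarrow> ({u}, {v}) \<notin> C" "u \<noteq> v \<Longrightarrow> ({u, v}, {}) \<notin> C" for u v
    using simple unfolding simple_om_def by blast+
  have A: "A = {} \<or> A = {x} \<or> A = {y} \<or> A = {x, y}" and B: "B = {} \<or> B = {x} \<or> B = {y} \<or> B = {x, y}"
    using d by blast+
  have l': "({}, {u}) \<notin> C" and p': "u \<noteq> v \<Longrightarrow> ({}, {u, v}) \<notin> C" for u v
    using l p(2) sneg_C unfolding sneg_def by fastforce+
  show False
  proof (cases "x = y")
    case True
    then have "A = {} \<or> A = {x}" "B = {} \<or> B = {x}" using A B by simp_all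
    then show False using C1(1) d(1) e l l' by (elim disjE) simp_all
  next
    case False
    note c = C1(1)
    show False using A
    proof (elim disjE)
      assume a: "A = {}"
      show False using B by (elim disjE) (use c e l' p'[OF False] in \<open>simp_all only: a simp_thms\<close>)
    next
      assume a: "A = {x}"
      then have "B = {} \<or> B = {y}" using B d(1) by auto
      then show False by (elim disjE) (use c l p(1)[OF False] in \<open>simp_all only: a simp_thms\<close>)
    next
      assume a: "A = {y}"
      then have "B = {} \<or> B = {x}" using B d(1) by auto
      then show False by (elim disjE) (use c l p(1)[OF False[symmetric]] in \<open>simp_all only: a simp_thms\<close>)
    next
      assume a: "A = {x, y}"
      then have "B = {}" using B d(1) by auto
      then show False using c p(2)[OF False] by (simp only: a simp_thms)
    qed
  qed
qed

lemma not_ind: "\<not> ind x y z \<longleftrightarrow> (\<exists>X\<in>C. supp X \<subseteq> {x, y, z})"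
  unfolding om_indep_def by blast

lemma supp_three: "X \<in> C \<Longrightarrow> supp X \<subseteq> {x, y, z} \<Longrightarrow> supp X = {x, y, z}"
  using not_pair[of X x y] not_pair[of X x z] not_pair[of X y z] by blast

lemma four_dep:
  assumes "{a, b, c, d} \<subseteq> E" "a \<noteq> b" "a \<noteq> c" "a \<noteq> d" "b \<noteq> c" "b \<noteq> d" "c \<noteq> d"
  obtains X where "X \<in> C" "supp X \<subseteq> {a, b, c, d}"
proof -
  have "card {a, b, c, d} = 4" using assms by simp
  then have "\<not> om_indep C {a, b, c, d}" using rank_le[OF assms(1)] by auto
  then show thesis using that unfolding om_indep_def by blast
qed

text \<open>Both circuits contain \<open>e\<close>, as \<open>f, x, y\<close> are independent;
  eliminating \<open>e\<close> from two essentially different ones would leave a circuit inside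
  \<open>{f, x, y}\<close>.\<close>

lemma circuit_unique:
  assumes "ind f x y" "X \<in> C" "Y \<in> C" "supp X \<subseteq> {e, f, x, y}" "supp Y \<subseteq> {e, f, x, y}"
  shows "X = Y \<or> X = sneg Y"
proof (rule ccontr)
  assume n: "\<not> ?thesis"
  have ex: "e \<in> supp X" "e \<in> supp Y" using assms unfolding om_indep_def by blast+
  have "X \<noteq> Y" "X \<noteq> sneg Y" using n by blast+
  then obtain Z where "Z \<in> C" "e \<notin> supp Z" "supp Z \<subseteq> supp X \<union> supp Y"
    by (rule elim[OF assms(2,3) _ _ ex])
  then have "supp Z \<subseteq> {f, x, y}" using assms(4,5) by blast
  then show False using assms(1) \<open>Z \<in> C\<close> unfolding om_indep_def by blast
qed

lemma circuit_unique_sgn: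
  assumes "ind f x y" "X \<in> C" "Y \<in> C" "supp X \<subseteq> {e, f, x, y}" "supp Y \<subseteq> {e, f, x, y}"
  shows "sgn_at X p * sgn_at X q = sgn_at Y p * sgn_at Y q" "supp X = supp Y"
  using circuit_unique[OF assms] sgn_at_sneg[OF assms(3)] by auto

lemma exchange:
  assumes "X \<in> C" "p \<in> supp X" "q \<in> supp X" "supp X \<subseteq> {p, q, x, y}" "p \<noteq> q" "p \<noteq> x" "p \<noteq> y" "ind p x y"
  shows "ind q x y"
proof (rule ccontr)
  assume "\<not> ind q x y"
  then obtain Q where Q: "Q \<in> C" "supp Q \<subseteq> {q, x, y}" unfolding not_ind by blast
  have "supp X = supp Q" by (rule circuit_unique_sgn(2)[OF assms(8,1) Q(1), of q]) (use assms Q in auto)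
  then show False using assms Q by auto
qed

lemma dep_trans:
  assumes d: "x \<noteq> y" "a \<noteq> x" "a \<noteq> y" "b \<noteq> x" "b \<noteq> y" "a \<noteq> b" and n: "\<not> ind x y a" "\<not> ind x y b"
  shows "\<not> ind x a b"
proof -
  obtain X where X: "X \<in> C" "supp X \<subseteq> {x,y,a}" using n(1) unfolding not_ind by blast
  obtain Y where Y: "Y \<in> C" "supp Y \<subseteq> {x,y,b}" using n(2) unfolding not_ind by blast
  have sX: "supp X = {x,y,a}" and sY: "supp Y = {x,y,b}" using supp_three X Y by blast+
  have "a \<in> supp X" "a \<notin> supp Y" unfolding sX sY using d by simp_all
  then have "X \<noteq> Y" "X \<noteq> sneg Y" using supp_sneg[of Y] by metis+
  moreover have "y \<in> supp X" "y \<in> supp Y" using sX sY by auto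
  ultimately obtain Z where "Z \<in> C" "y \<notin> supp Z" "supp Z \<subseteq> supp X \<union> supp Y"
    by (rule elim[OF X(1) Y(1)])
  then have "Z \<in> C" "supp Z \<subseteq> {x, a, b}" using sX sY by auto
  then show ?thesis unfolding om_indep_def by blast
qed

text \<open>Otherwise all of \<open>S\<close> lies on the line \<open>x y\<close>, and by
  transitivity of collinearity \<open>a, b, c\<close> would be dependent.\<close>

lemma ind_extend:
  assumes xy: "x \<noteq> y" and b: "a \<in> S" "b \<in> S" "c \<in> S" "a \<noteq> b" "a \<noteq> c" "b \<noteq> c" "ind a b c"
  obtains f where "f \<in> S" "f \<noteq> x" "f \<noteq> y" "ind f x y"
proof (rule ccontr)
  assume n: "\<not> thesis"
  have d: "\<not> ind x y f" if "f \<in> S" "f \<noteq> x" "f \<noteq> y" for f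
  proof
    assume "ind x y f"
    then have "ind f x y" by (simp add: insert_commute)
    then show False using that n \<open>\<And>f. f \<in> S \<Longrightarrow> f \<noteq> x \<Longrightarrow> f \<noteq> y \<Longrightarrow> ind f x y \<Longrightarrow> thesis\<close> by blast
  qed
  have d2: "\<not> ind x p q" if "p \<in> S" "q \<in> S" "p \<noteq> q" "p \<noteq> x" "q \<noteq> x" for p q
  proof (cases "p = y \<or> q = y")
    case True
    then show ?thesis using d[of p] d[of q] that by (auto simp: insert_commute)
  next
    case False
    then show ?thesis using dep_trans[of x y p q] d[of p] d[of q] that xy by auto
  qed
  have "\<not> ind a b c"
  proof (cases "x \<in> {a, b, c}")
    case True
    then show ?thesis using d2[of b c] d2[of a c] d2[of a b] b(1-6) by (auto simp: insert_commute)
  next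
    case False
    then have x: "x \<noteq> a" "x \<noteq> b" "x \<noteq> c" by auto
    have "\<not> ind a x b" "\<not> ind a x c" using d2[of a b] d2[of a c] b x by (auto simp: insert_commute)
    then show ?thesis using dep_trans[of a x b c] x b by auto
  qed
  then show False using b(7) by blast
qed

end


section \<open>Grassmann-Pluecker relations and uniqueness of the chirotope\<close>

context om3
begin

text \<open>The circuit on \<open>w, p, q\<close> makes \<open>p\<close> and \<open>q\<close>
  parallel in the contraction by \<open>w\<close>; \<open>\<kappa>\<close> is their relative
  sign.\<close>

lemma chir_nz_parallel:
  assumes c: "chir C E \<chi>" and E: "w \<in> E" "p \<in> E" "q \<in> E" "w \<noteq> p" "w \<noteq> q" "p \<noteq> q" and z: "\<chi> w p q = 0"
  obtains \<kappa> where "\<kappa> = 1 \<or> \<kappa> = -1" "\<And>t. \<chi> w q t = \<kappa> * \<chi> w p t"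
proof -
  note D = chirD[OF c]
  have "\<not> ind w p q" using D(4)[of w p q] E z by blast
  then obtain X where X: "X \<in> C" "supp X \<subseteq> {w,p,q}" unfolding not_ind by blast
  then have sX: "supp X = {w,p,q}" by (rule supp_three)
  define \<kappa> where "\<kappa> = - sgn_at X p * sgn_at X q"
  have 1: "\<kappa> = 1 \<or> \<kappa> = -1" using sgn_at_pm[of p X] sgn_at_pm[of q X] unfolding sX \<kappa>_def by auto
  have "\<chi> w q t = \<kappa> * \<chi> w p t" for t
  proof (cases "t \<in> E")
    case True
    have "\<chi> q w t = - sgn_at X p * sgn_at X q * \<chi> p w t"
      by (rule chir_circuit[OF c X(1)]) (use E True sX in auto)
    then show ?thesis using D(2)[of q w t] D(2)[of p w t] unfolding \<kappa>_def by simp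
  next
    case False
    then show ?thesis using D(4)[of w q t] D(4)[of w p t] by auto
  qed
  then show thesis using that 1 by blast
qed

text \<open>Eliminating \<open>a\<close> from the circuits \<open>U\<close> on
  \<open>w, a, b, c\<close> and \<open>V\<close> on \<open>w, a, b, d\<close> gives the circuit
  \<open>Z\<close> on \<open>w, b, c, d\<close>. Its sign at \<open>c\<close> comes from
  \<open>U\<close>, at \<open>d\<close> from \<open>V\<close>, at \<open>b\<close> from one of them.
  The first possibility for \<open>b\<close> contradicts \<open>neq\<close>, the second contradicts
  \<open>eq\<close>.\<close>

lemma chir_gp_generic:
  assumes c: "chir C E \<chi>" 
    and nz: "\<chi> w a b \<noteq> 0" "\<chi> w a c \<noteq> 0" "\<chi> w a d \<noteq> 0" "\<chi> w b c \<noteq> 0" "\<chi> w b d \<noteq> 0" "\<chi> w c d \<noteq> 0"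
    and eq: "\<chi> w a b * \<chi> w c d = \<chi> w a d * \<chi> w b c"
  shows "\<chi> w a c * \<chi> w b d = \<chi> w a b * \<chi> w c d"
proof (rule ccontr)
  assume neq: "\<not> ?thesis"
  note D = chirD[OF c]
  have E: "w \<in> E" "a \<in> E" "b \<in> E" "c \<in> E" "d \<in> E" and n: "w \<noteq> a" "w \<noteq> b" "w \<noteq> c" "w \<noteq> d"
     "a \<noteq> b" "a \<noteq> c" "a \<noteq> d" "b \<noteq> c" "b \<noteq> d" "c \<noteq> d"
    using nz D(4)[of w a b] D(4)[of w c d] D(4)[of w a c] D(4)[of w a d] D(4)[of w b c] D(4)[of w b d] by blast+
  define g where "g p q = \<chi> w p q" for p q
  have galt: "g q p = - g p q" for p q unfolding g_def by (rule D(3))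
  have gsq: "g p q * g p q = 1" if "g p q \<noteq> 0" for p q using that D(1)[of w p q] unfolding g_def by auto
  have gi: "ind w p q" if "g p q \<noteq> 0" for p q using that D(4)[of w p q] unfolding g_def by blast
  have gnz: "g a b \<noteq> 0" "g a c \<noteq> 0" "g a d \<noteq> 0" "g b c \<noteq> 0" "g b d \<noteq> 0" "g c d \<noteq> 0" using nz unfolding g_def .
  have rel: "sgn_at X p * sgn_at X q = - g p t * g q t"
    if X: "X \<in> C" "supp X \<subseteq> {w, p, q, t}" "p \<in> supp X" "q \<in> supp X" "p \<noteq> q" and "{p,q,t} \<subseteq> E" "g p t \<noteq> 0" for X p q t
  proof -
    have "\<chi> q w t = - sgn_at X p * sgn_at X q * \<chi> p w t"
      by (rule chir_circuit[OF c X(1)]) (use E that in auto)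
    then have "g q t = - sgn_at X p * sgn_at X q * g p t" using D(2)[of q w t] D(2)[of p w t] unfolding g_def by simp
    then have "g p t * g q t = - (sgn_at X p * sgn_at X q) * (g p t * g p t)" by (simp add: mult_ac)
    then show ?thesis using gsq[of p t] that by simp
  qed
  have full: "p \<in> supp X" if X: "X \<in> C" "supp X \<subseteq> {w, p, q, t}" and "g q t \<noteq> 0" for X p q t
  proof (rule ccontr)
    assume "p \<notin> supp X"
    then have "supp X \<subseteq> {w, q, t}" using X by blast
    then show False using gi[OF that(3)] X(1) unfolding om_indep_def by blast
  qed
  obtain U where U: "U \<in> C" "supp U \<subseteq> {w, a, b, c}" by (rule four_dep[of w a b c]) (use E n in auto)
  obtain V where V: "V \<in> C" "supp V \<subseteq> {w, a, b, d}" by (rule four_dep[of w a b d]) (use E n in auto)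
  have Us: "a \<in> supp U" "b \<in> supp U" "c \<in> supp U"
    using full[of U a b c] full[of U b a c] full[of U c a b] U gnz by (auto simp: insert_commute)
  have Vs: "a \<in> supp V" "b \<in> supp V" "d \<in> supp V"
    using full[of V a b d] full[of V b a d] full[of V d a b] V gnz by (auto simp: insert_commute)
  have U1: "sgn_at U b * sgn_at U c = - g a b * g a c"
    using rel[of U b c a] U Us n E gnz galt[of a b] galt[of a c] by (auto simp: insert_commute)
  have V1: "sgn_at V b * sgn_at V d = - g a b * g a d"
    using rel[of V b d a] V Vs n E gnz galt[of a b] galt[of a d] by (auto simp: insert_commute)
  have "c \<notin> supp V" "d \<notin> supp U" using U V n by auto
  then have "U \<noteq> V" "U \<noteq> sneg V" using Us supp_sneg[of V] by metis+
  then obtain Z where Z: "Z \<in> C" "a \<notin> supp Z" "supp Z \<subseteq> supp U \<union> supp V"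
    and Zs: "\<And>h. sgn_at Z h = 0 \<or> sgn_at Z h = sgn_at U h \<or> sgn_at Z h = - (sgn_at U a * sgn_at V a) * sgn_at V h"
    using elim[OF U(1) V(1) _ _ Us(1) Vs(1)] by metis
  have ZE: "supp Z \<subseteq> {w, b, c, d}" using Z U V by blast
  have Zs': "b \<in> supp Z" "c \<in> supp Z" "d \<in> supp Z"
    using full[of Z b c d] full[of Z c b d] full[of Z d b c] Z ZE gnz by (auto simp: insert_commute)
  have Zbc: "sgn_at Z b * sgn_at Z c = - g b d * g c d" using rel[of Z b c d] Z ZE Zs' n E gnz by auto
  have Zbd: "sgn_at Z b * sgn_at Z d = g b c * g c d"
    using rel[of Z b d c] Z ZE Zs' n E gnz galt[of c d] by (auto simp: insert_commute)
  have s0: "sgn_at V c = 0" "sgn_at U d = 0" using \<open>c \<notin> supp V\<close> \<open>d \<notin> supp U\<close> sgn_at_supp by metis+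
  have nZ: "sgn_at Z b \<noteq> 0" "sgn_at Z c \<noteq> 0" "sgn_at Z d \<noteq> 0" using Zs' sgn_at_supp by metis+
  have Zc: "sgn_at Z c = sgn_at U c" using Zs[of c] s0 nZ by auto
  have Zd: "sgn_at Z d = - (sgn_at U a * sgn_at V a) * sgn_at V d" using Zs[of d] s0 nZ by auto
  have X: "(\<chi> w p q = 1 \<or> \<chi> w p q = -1)" if "\<chi> w p q \<noteq> 0" for p q using D(1)[of w p q] that by blast
  note xs = X[OF nz(1)] X[OF nz(2)] X[OF nz(3)] X[OF nz(4)] X[OF nz(5)] X[OF nz(6)]
  from Zs[of b] nZ(1) consider "sgn_at Z b = sgn_at U b" | "sgn_at Z b = - (sgn_at U a * sgn_at V a) * sgn_at V b" by blast
  then show False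
  proof cases
    case 1
    then have "- g b d * g c d = - g a b * g a c" using Zbc U1 unfolding Zc by simp
    then show False using neq xs unfolding g_def by (elim disjE) simp_all
  next
    case 2
    have "sgn_at Z b * sgn_at Z d = (sgn_at U a * sgn_at U a) * (sgn_at V a * sgn_at V a) * (sgn_at V b * sgn_at V d)"
      unfolding 2 Zd by (simp add: mult_ac)
    then have "g b c * g c d = - g a b * g a d" using Zbd V1 sgn_at_sq[OF Us(1)] sgn_at_sq[OF Vs(1)] by simp
    then show False using eq xs unfolding g_def by (elim disjE) simp_all
  qed
qed

text \<open>If one of the six values vanishes, two of the points are parallel in the contraction by
  \<open>w\<close> and the relation follows by substituting one for the other. If none vanishes,
  \<open>pre\<close> forces the two terms on the right to be equal.\<close>

lemma chir_gp:
  assumes c: "chir C E \<chi>" and pre: "0 \<le> (\<chi> w a b * \<chi> w c d) * (\<chi> w a d * \<chi> w b c)"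
  shows "\<chi> w a c * \<chi> w b d = sgn (\<chi> w a b * \<chi> w c d + \<chi> w a d * \<chi> w b c)"
proof -
  note D = chirD[OF c]
  have val: "sgn (\<chi> w p q * \<chi> w s t) = \<chi> w p q * \<chi> w s t" for p q s t
    using D(1)[of w p q] D(1)[of w s t] by (elim disjE) simp_all
  have nE: "\<chi> w p q = 0" if "p \<notin> E \<or> q \<notin> E \<or> w \<notin> E \<or> w = p \<or> w = q" for p q using D(4)[of w p q] that by blast
  have par: "(\<exists>\<kappa>. (\<kappa> = 1 \<or> \<kappa> = -1) \<and> (\<forall>t. \<chi> w q t = \<kappa> * \<chi> w p t))" 
    if "\<chi> w p q = 0" "p \<in> E" "q \<in> E" "w \<in> E" "w \<noteq> p" "w \<noteq> q" for p q
  proof (cases "p = q")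
    case True then show ?thesis by (intro exI[of _ 1]) simp
  next
    case False
    show ?thesis by (rule chir_nz_parallel[OF c that(4,2,3,5,6) False that(1)]) blast
  qed
  show ?thesis
  proof (cases "w \<in> E \<and> a \<in> E \<and> b \<in> E \<and> c \<in> E \<and> d \<in> E \<and> w \<noteq> a \<and> w \<noteq> b \<and> w \<noteq> c \<and> w \<noteq> d")
    case False
    then show ?thesis using nE by auto
  next
    case True
    consider (ab) "\<chi> w a b = 0" | (cd) "\<chi> w c d = 0" | (ad) "\<chi> w a d = 0" | (bc) "\<chi> w b c = 0"
      | (ac) "\<chi> w a c = 0" | (bd) "\<chi> w b d = 0"
      | (nz) "\<chi> w a b \<noteq> 0" "\<chi> w a c \<noteq> 0" "\<chi> w a d \<noteq> 0" "\<chi> w b c \<noteq> 0" "\<chi> w b d \<noteq> 0" "\<chi> w c d \<noteq> 0" by blast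
    then show ?thesis
    proof cases
      case ab
      obtain k where k: "k = 1 \<or> k = -1" "\<forall>t. \<chi> w b t = k * \<chi> w a t" using par[OF ab] True by blast
      have "\<chi> w a c * \<chi> w b d = \<chi> w a d * \<chi> w b c" using k(2) by simp
      then show ?thesis using ab val by simp
    next
      case cd
      obtain k where k: "k = 1 \<or> k = -1" "\<forall>t. \<chi> w d t = k * \<chi> w c t" using par[OF cd] True by blast
      have "\<chi> w a d = k * \<chi> w a c" "\<chi> w b d = k * \<chi> w b c" 
        using k(2) D(3)[of w a d] D(3)[of w b d] D(3)[of w a c] D(3)[of w b c] by simp_all
      then have "\<chi> w a c * \<chi> w b d = \<chi> w a d * \<chi> w b c" by simp
      then show ?thesis using cd val by simp
    next
      case ad
      obtain k where k: "k = 1 \<or> k = -1" "\<forall>t. \<chi> w d t = k * \<chi> w a t" using par[OF ad] True by blast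
      have "\<chi> w c d = - k * \<chi> w a c" "\<chi> w b d = - k * \<chi> w a b" 
        using k(2) D(3)[of w d c] D(3)[of w d b] by simp_all
      then have "\<chi> w a c * \<chi> w b d = \<chi> w a b * \<chi> w c d" by simp
      then show ?thesis using ad val by simp
    next
      case bc
      obtain k where k: "k = 1 \<or> k = -1" "\<forall>t. \<chi> w c t = k * \<chi> w b t" using par[OF bc] True by blast
      have "\<chi> w c d = k * \<chi> w b d" "\<chi> w a c = k * \<chi> w a b" 
        using k(2) D(3)[of w c a] D(3)[of w b a] by simp_all
      then have "\<chi> w a c * \<chi> w b d = \<chi> w a b * \<chi> w c d" by simp
      then show ?thesis using bc val by simp
    next
      case ac
      obtain k where k: "k = 1 \<or> k = -1" "\<forall>t. \<chi> w c t = k * \<chi> w a t" using par[OF ac] True by blast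
      have 1: "\<chi> w c d = k * \<chi> w a d" "\<chi> w b c = - k * \<chi> w a b" 
        using k(2) D(3)[of w b c] D(3)[of w b a] by simp_all
      show ?thesis using pre k(1) D(1)[of w a d] D(1)[of w a b] ac unfolding 1 by (elim disjE) simp_all
    next
      case bd
      obtain k where k: "k = 1 \<or> k = -1" "\<forall>t. \<chi> w d t = k * \<chi> w b t" using par[OF bd] True by blast
      have 1: "\<chi> w c d = - k * \<chi> w b c" "\<chi> w a d = k * \<chi> w a b" 
        using k(2) D(3)[of w d c] D(3)[of w d a] D(3)[of w b a] by simp_all
      show ?thesis using pre k(1) D(1)[of w b c] D(1)[of w a b] bd unfolding 1 by (elim disjE) simp_all
    next
      case nz
      have X: "(\<chi> w p q = 1 \<or> \<chi> w p q = -1)" if "\<chi> w p q \<noteq> 0" for p q using D(1)[of w p q] that by blast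
      have "\<chi> w a b * \<chi> w c d = \<chi> w a d * \<chi> w b c"
        using pre X[OF nz(1)] X[OF nz(3)] X[OF nz(4)] X[OF nz(6)] by (elim disjE) simp_all
      moreover from chir_gp_generic[OF c nz this] have "\<chi> w a c * \<chi> w b d = \<chi> w a b * \<chi> w c d" .
      moreover have "sgn (t + t) = sgn t" for t :: int by (simp add: sgn_if)
      ultimately show ?thesis using val by simp
    qed
  qed
qed

lemma chiro_of_chir:
  assumes c: "chir C E \<chi>" and b: "\<chi> a b d \<noteq> 0"
  shows "chiro E \<chi>"
proof
  note D = chirD[OF c]
  show "finite E" by (rule finE)
  show "\<chi> x y z = 0 \<or> \<chi> x y z = 1 \<or> \<chi> x y z = -1" "\<chi> y x z = - \<chi> x y z" "\<chi> x z y = - \<chi> x y z" for x y z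
    by (rule D)+
  show "\<chi> w a c * \<chi> w b d = sgn (\<chi> w a b * \<chi> w c d + \<chi> w a d * \<chi> w b c)"
    if "0 \<le> \<chi> w a b * \<chi> w c d * (\<chi> w a d * \<chi> w b c)" for w a b c d by (rule chir_gp[OF c that])
  show "\<exists>z\<in>E. \<chi> x y z \<noteq> 0" if xy: "x \<in> E" "y \<in> E" "x \<noteq> y" for x y
  proof -
    obtain f where f: "f \<in> E" "f \<noteq> x" "f \<noteq> y" "ind f x y"
      using ind_extend[OF xy(3), of a E b d] D(4)[of a b d] b by blast
    have "ind x y f" using f(4) by (simp add: insert_commute)
    then have "\<chi> x y f \<noteq> 0" using D(4)[of x y f] f xy by blast
    then show ?thesis using f(1) by blast
  qed
qed

text \<open>The product of the two chirotopes is constant on bases: it does not change when one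
  element is exchanged, since both obey the same circuit, and any two bases are joined by such
  exchanges.\<close>

lemma chir_unique:
  assumes c: "chir C E \<chi>" and d: "chir C S \<delta>" and S: "S \<subseteq> E"
  obtains \<epsilon> where "\<epsilon> = 1 \<or> \<epsilon> = -1" "\<And>x y z. x \<in> S \<Longrightarrow> y \<in> S \<Longrightarrow> z \<in> S \<Longrightarrow> \<delta> x y z = \<epsilon> * \<chi> x y z"
proof -
  note Dc = chirD[OF c] note Dd = chirD[OF d]
  have z: "\<delta> x y z = 0 \<longleftrightarrow> \<chi> x y z = 0" if "x \<in> S" "y \<in> S" "z \<in> S" for x y z
    using Dc(4)[of x y z] Dd(4)[of x y z] that S by blast
  show thesis
  proof (cases "\<exists>a\<in>S. \<exists>b\<in>S. \<exists>e\<in>S. \<chi> a b e \<noteq> 0")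
    case False
    show thesis by (rule that[of 1]) (use False z in auto)
  next
    case True
    then obtain a b e where B: "a \<in> S" "b \<in> S" "e \<in> S" "\<chi> a b e \<noteq> 0" by blast
    interpret chiro E \<chi> by (rule chiro_of_chir[OF c B(4)])
    define P where "P x y z = \<delta> x y z * \<chi> x y z" for x y z
    have Pcyc: "P y z x = P x y z" for x y z
      unfolding P_def using Dd(2,3) alt1 alt2 by (metis (no_types, opaque_lifting) minus_mult_minus)
    have step: "P q x y = P p x y" if s: "p \<in> S" "q \<in> S" "x \<in> S" "y \<in> S" "\<chi> p x y \<noteq> 0" "\<chi> q x y \<noteq> 0" for p q x y
    proof (cases "p = q")
      case False
      have n: "p \<noteq> x" "p \<noteq> y" "q \<noteq> x" "q \<noteq> y" "x \<noteq> y" "ind p x y" "ind q x y" using s Dc(4) by blast+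
      obtain X where X: "X \<in> C" "supp X \<subseteq> {p, q, x, y}"
        by (rule four_dep[of p q x y]) (use s n False S in auto)
      have m: "p \<in> supp X" "q \<in> supp X" using X n(6,7) unfolding om_indep_def by blast+
      have "\<chi> q x y = - sgn_at X p * sgn_at X q * \<chi> p x y"
        by (rule chir_circuit[OF c X(1)]) (use s S m X False in auto)
      moreover have "\<delta> q x y = - sgn_at X p * sgn_at X q * \<delta> p x y"
        by (rule chir_circuit[OF d X(1)]) (use s S m X False in auto)
      ultimately have "P q x y = (sgn_at X p * sgn_at X p) * (sgn_at X q * sgn_at X q) * P p x y"
        unfolding P_def by (simp add: mult_ac)
      then show ?thesis using sgn_at_sq[OF m(1)] sgn_at_sq[OF m(2)] by simp
    qed simp
    have conn: "P x y z = P a b e" if xyz: "x \<in> S" "y \<in> S" "z \<in> S" "\<chi> x y z \<noteq> 0" for x y z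
    proof -
      \<comment> \<open>The elements \<open>a\<close>, \<open>b\<close>, \<open>e\<close> are
        replaced in turn by those of the basis \<open>x, y, z\<close>. Some element of it is off the
        line \<open>b e\<close>, since these three are not collinear, and replaces
        \<open>a\<close>.\<close>
      have "\<exists>t\<in>{x,y,z}. \<chi> t b e \<noteq> 0"
      proof (rule ccontr)
        assume "\<not> ?thesis"
        then have t: "\<chi> b e x = 0" "\<chi> b e y = 0" "\<chi> b e z = 0" using cyc by auto
        have "b \<in> E" "e \<in> E" "b \<noteq> e" using B S Dc(4) by auto
        then have "\<chi> x y z = 0"
          using line_trans3[of b e x y z] line_trans[of b e y z] t xyz S by (cases "x = b") auto
        then show False using xyz by blast
      qed
      then obtain x' y' z' where x': "\<chi> x' b e \<noteq> 0" "P x' y' z' = P x y z" "\<chi> x' y' z' \<noteq> 0" "x' \<in> S" "y' \<in> S" "z' \<in> S"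
      proof (elim bexE insertE emptyE)
        fix t assume "\<chi> t b e \<noteq> 0" "t = x" then show thesis using that[of x y z] xyz by auto
      next
        fix t assume "\<chi> t b e \<noteq> 0" "t = y" then show thesis using that[of y z x] xyz Pcyc cyc by auto
      next
        fix t assume "\<chi> t b e \<noteq> 0" "t = z" then show thesis using that[of z x y] xyz Pcyc cyc by metis
      qed
      \<comment> \<open>The line \<open>x' e\<close> misses one of the two remaining elements, which
        replaces \<open>b\<close>; the last one then replaces \<open>e\<close>.\<close>
      have "\<exists>t\<in>{y',z'}. \<chi> x' e t \<noteq> 0"
      proof (rule ccontr)
        assume "\<not> ?thesis"
        then have t: "\<chi> x' e y' = 0" "\<chi> x' e z' = 0" by auto
        have "x' \<in> E" "e \<in> E" "x' \<noteq> e" using B S x' Dc(4) by auto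
        then have "\<chi> x' y' z' = 0" using line_trans[of x' e y' z'] t by blast
        then show False using x' by blast
      qed
      moreover have nz1: "\<chi> b e x' \<noteq> 0" using x'(1) cyc[of b e x'] by simp
      moreover have nz2: "\<chi> u e x' \<noteq> 0" and nz2': "\<chi> e x' u \<noteq> 0" if "\<chi> x' e u \<noteq> 0" for u
        using that cyc[of u e x'] alt2[of x' u e] cyc[of e x' u] by simp_all
      moreover have nz3: "\<chi> z' x' y' \<noteq> 0" "\<chi> y' x' z' \<noteq> 0" using x'(3) cyc[of x' y' z'] alt1[of y' x' z'] by simp_all
      moreover have Psw: "P y x z = P x y z" for x y z unfolding P_def using Dd(2)[of y x z] alt1[of y x z] by simp
      ultimately have "P x' y' z' = P a b e"
      proof (elim bexE insertE emptyE)
        fix t assume t: "\<chi> x' e t \<noteq> 0" "t = y'"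
        have "P a b e = P x' b e" by (rule step[OF x'(4) B(1-3) x'(1) B(4)])
        also have "\<dots> = P b e x'" by (rule Pcyc[symmetric])
        also have "\<dots> = P y' e x'" by (rule step[OF x'(5) B(2,3) x'(4) nz2[OF t(1)[unfolded t(2)]] nz1])
        also have "\<dots> = P e x' y'" by (rule Pcyc[symmetric])
        also have "\<dots> = P z' x' y'" by (rule step[OF x'(6) B(3) x'(4,5) nz3(1) nz2'[OF t(1)[unfolded t(2)]]])
        finally show ?thesis using Pcyc[of x' y' z'] by simp
      next
        fix t assume t: "\<chi> x' e t \<noteq> 0" "t = z'"
        have "P a b e = P x' b e" by (rule step[OF x'(4) B(1-3) x'(1) B(4)])
        also have "\<dots> = P b e x'" by (rule Pcyc[symmetric])
        also have "\<dots> = P z' e x'" by (rule step[OF x'(6) B(2,3) x'(4) nz2[OF t(1)[unfolded t(2)]] nz1])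
        also have "\<dots> = P e x' z'" by (rule Pcyc[symmetric])
        also have "\<dots> = P y' x' z'" by (rule step[OF x'(5) B(3) x'(4,6) nz3(2) nz2'[OF t(1)[unfolded t(2)]]])
        finally show ?thesis using Psw[of x' y' z'] by simp
      qed
      then show ?thesis using x' by simp
    qed
    have "P a b e = 1 \<or> P a b e = -1"
      using B Dc(1)[of a b e] Dd(1)[of a b e] z[of a b e] unfolding P_def by auto
    moreover have "\<delta> x y z = P a b e * \<chi> x y z" if "x \<in> S" "y \<in> S" "z \<in> S" for x y z
    proof (cases "\<chi> x y z = 0")
      case True then show ?thesis using z that by simp
    next
      case False
      have "P a b e * \<chi> x y z = \<delta> x y z * (\<chi> x y z * \<chi> x y z)"
        using conn[OF that False] unfolding P_def by (simp add: mult_ac)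
      then show ?thesis using Dc(1)[of x y z] False by auto
    qed
    ultimately show thesis by (rule that)
  qed
qed

end


section \<open>Extending a chirotope by one element\<close>

context om3
begin

text \<open>The value \<open>ext_val S c e x y\<close> is the sign of \<open>(e, x, y)\<close> read off from a circuit on
  \<open>e, f, x, y\<close>, where \<open>f\<close> is any element with \<open>c f x y \<noteq> 0\<close>.\<close>

definition ext_val :: "'a set \<Rightarrow> ('a \<Rightarrow> 'a \<Rightarrow> 'a \<Rightarrow> int) \<Rightarrow> 'a \<Rightarrow> 'a \<Rightarrow> 'a \<Rightarrow> int" where
  "ext_val S c e x y = (if x = y \<or> x \<notin> S \<or> y \<notin> S then 0 else
     let p = (SOME p. c (fst p) x y \<noteq> 0 \<and> snd p \<in> C \<and> supp (snd p) \<subseteq> {e, fst p, x, y})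
     in - sgn_at (snd p) e * sgn_at (snd p) (fst p) * c (fst p) x y)"

text \<open>The circuit relation leaves no choice for the values at triples through
  \<open>e\<close>. It has to be shown that the choice of \<open>f\<close> does not matter and that
  the resulting map satisfies the circuit relation in every position of \<open>e\<close>.\<close>

lemma chir_extend:
  assumes c: "chir C (E - {e}) c" and e: "e \<in> E" and base: "c a b d \<noteq> 0"
  obtains \<chi> where "chir C E \<chi>"
proof -
  let ?S = "E - {e}"
  note D = chirD[OF c]
  have inS: "f \<in> ?S" "x \<in> ?S" "y \<in> ?S" "f \<noteq> x" "f \<noteq> y" "x \<noteq> y" "ind f x y" if "c f x y \<noteq> 0" for f x y
    using D(4)[of f x y] that by blast+
  define Q where "Q = ext_val ?S c e"
  have circ4: "\<exists>X\<in>C. supp X \<subseteq> {p, q, x, y}" if "{p,q,x,y} \<subseteq> E" "p \<noteq> q" "p \<noteq> x" "p \<noteq> y" "q \<noteq> x" "q \<noteq> y" "x \<noteq> y" for p q x y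
    by (rule four_dep[OF that]) blast
  have e_in: "e \<in> supp X" if "c f x y \<noteq> 0" "X \<in> C" "supp X \<subseteq> {e, f, x, y}" for f x y X
    using inS(7)[OF that(1)] that(2,3) unfolding om_indep_def by blast
  have f_in: "f \<in> supp X \<longleftrightarrow> ind e x y" if f: "c f x y \<noteq> 0" "X \<in> C" "supp X \<subseteq> {e, f, x, y}" for f x y X
  proof
    assume "f \<in> supp X"
    then show "ind e x y"
      using exchange[OF f(2) \<open>f \<in> supp X\<close> e_in[OF f], of x y] inS[OF f(1)] f(3) by (auto simp: insert_commute)
  next
    assume i: "ind e x y"
    show "f \<in> supp X"
    proof (rule ccontr)
      assume "f \<notin> supp X"
      then have "supp X \<subseteq> {e, x, y}" using f(3) by blast
      then show False using i f(2) unfolding om_indep_def by blast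
    qed
  qed
  \<comment> \<open>Eliminating \<open>e\<close> from the circuits for \<open>f\<close> and for
    \<open>g\<close> gives a circuit on \<open>f, g, x, y\<close>, and its relation holds already
    for \<open>c\<close>. If \<open>e, x, y\<close> are dependent, both sides vanish.\<close>
  have indep_choice: "sgn_at X e * sgn_at X f * c f x y = sgn_at Y e * sgn_at Y g * c g x y"
    if f: "c f x y \<noteq> 0" "X \<in> C" "supp X \<subseteq> {e, f, x, y}" and g: "c g x y \<noteq> 0" "Y \<in> C" "supp Y \<subseteq> {e, g, x, y}" for f g x y X Y
  proof (cases "ind e x y")
    case False
    then have "f \<notin> supp X" "g \<notin> supp Y" using f_in[OF f] f_in[OF g] by auto
    then have "sgn_at X f = 0" "sgn_at Y g = 0" using sgn_at_supp by metis+
    then show ?thesis by simp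
  next
    case True
    have fX: "f \<in> supp X" "e \<in> supp X" and gY: "g \<in> supp Y" "e \<in> supp Y"
      using f_in[OF f] f_in[OF g] True e_in[OF f] e_in[OF g] by auto
    show ?thesis
    proof (cases "f = g")
      case True
      then show ?thesis using circuit_unique_sgn(1)[OF inS(7)[OF f(1)] f(2) g(2) f(3)] g(3) by simp
    next
      case fg: False
      have n: "f \<in> E" "g \<in> E" "x \<in> E" "y \<in> E" "e \<noteq> f" "e \<noteq> g" "e \<noteq> x" "e \<noteq> y" "f \<noteq> x" "f \<noteq> y" "g \<noteq> x" "g \<noteq> y" "x \<noteq> y"
        using inS[OF f(1)] inS[OF g(1)] by auto
      have ff: "f \<notin> supp Y" "g \<notin> supp X" using f(3) g(3) n fg by auto
      then have XY: "X \<noteq> Y" "X \<noteq> sneg Y" using fX supp_sneg[of Y] by metis+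
      obtain Z where Z: "Z \<in> C" "e \<notin> supp Z" "supp Z \<subseteq> supp X \<union> supp Y"
        and Zs: "\<And>h. sgn_at Z h = 0 \<or> sgn_at Z h = sgn_at X h \<or> sgn_at Z h = - (sgn_at X e * sgn_at Y e) * sgn_at Y h"
        by (rule elim[OF f(2) g(2) XY fX(2) gY(2)]) blast
      have Zsub: "supp Z \<subseteq> {f, g, x, y}" using Z f(3) g(3) by blast
      have fgZ: "f \<in> supp Z" "g \<in> supp Z"
        using Zsub Z(1) inS(7)[OF f(1)] inS(7)[OF g(1)] unfolding om_indep_def by blast+
      have s0: "sgn_at Y f = 0" "sgn_at X g = 0" using ff sgn_at_supp by metis+
      have nZ: "sgn_at Z f \<noteq> 0" "sgn_at Z g \<noteq> 0" using fgZ sgn_at_supp by metis+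
      have Zf: "sgn_at Z f = sgn_at X f" using Zs[of f] s0 nZ by auto
      have Zg: "sgn_at Z g = - (sgn_at X e * sgn_at Y e) * sgn_at Y g" using Zs[of g] s0 nZ by auto
      have "c g x y = - sgn_at Z f * sgn_at Z g * c f x y"
        by (rule chir_circuit[OF c Z(1)]) (use n Zsub fgZ fg in auto)
      then have "sgn_at Y e * sgn_at Y g * c g x y =
          (sgn_at Y e * sgn_at Y e) * (sgn_at Y g * sgn_at Y g) * (sgn_at X e * sgn_at X f * c f x y)"
        unfolding Zf Zg by (simp add: mult_ac)
      then show ?thesis using sgn_at_sq[OF gY(1)] sgn_at_sq[OF gY(2)] by simp
    qed
  qed
  have Qspec: "Q x y = - sgn_at X e * sgn_at X f * c f x y" if f: "c f x y \<noteq> 0" "X \<in> C" "supp X \<subseteq> {e, f, x, y}" for f x y X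
  proof -
    let ?P = "\<lambda>p. c (fst p) x y \<noteq> 0 \<and> snd p \<in> C \<and> supp (snd p) \<subseteq> {e, fst p, x, y}"
    define p where "p = (SOME p. ?P p)"
    have "?P (f, X)" using f by simp
    then have p: "?P p" unfolding p_def by (rule someI)
    have "Q x y = - sgn_at (snd p) e * sgn_at (snd p) (fst p) * c (fst p) x y"
      using inS[OF f(1)] unfolding Q_def ext_val_def p_def Let_def by auto
    then show ?thesis using indep_choice[of "fst p" x y "snd p" f X] p f by auto
  qed
  have Qout: "Q x y = 0" if "x = y \<or> x \<notin> ?S \<or> y \<notin> ?S" for x y using that unfolding Q_def ext_val_def by auto
  have ext: "\<exists>f. c f x y \<noteq> 0" if xy: "x \<in> ?S" "y \<in> ?S" "x \<noteq> y" for x y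
  proof -
    obtain f where f: "f \<in> ?S" "f \<noteq> x" "f \<noteq> y" "ind f x y"
      using ind_extend[OF xy(3), of a ?S b d] inS[OF base] by blast
    then show ?thesis using D(4)[of f x y] xy by blast
  qed
  have fX: "\<exists>f X. c f x y \<noteq> 0 \<and> X \<in> C \<and> supp X \<subseteq> {e, f, x, y}" if xy: "x \<in> ?S" "y \<in> ?S" "x \<noteq> y" for x y
  proof -
    obtain f where f: "c f x y \<noteq> 0" using ext[OF xy] by blast
    obtain X where "X \<in> C" "supp X \<subseteq> {e, f, x, y}" using circ4[of e f x y] inS[OF f] e by blast
    then show ?thesis using f by blast
  qed
  have Qval: "Q x y = 0 \<or> Q x y = 1 \<or> Q x y = -1" and Qnz: "Q x y \<noteq> 0 \<longleftrightarrow> x \<in> ?S \<and> y \<in> ?S \<and> x \<noteq> y \<and> ind e x y"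
    and Qalt: "Q y x = - Q x y" for x y
  proof -
    have "(Q x y = 0 \<or> Q x y = 1 \<or> Q x y = -1) \<and> (Q x y \<noteq> 0 \<longleftrightarrow> x \<in> ?S \<and> y \<in> ?S \<and> x \<noteq> y \<and> ind e x y) \<and> Q y x = - Q x y"
    proof (cases "x = y \<or> x \<notin> ?S \<or> y \<notin> ?S")
      case True
      then show ?thesis using Qout[of x y] Qout[of y x] by auto
    next
      case False
      then obtain f X where f: "c f x y \<noteq> 0" "X \<in> C" "supp X \<subseteq> {e, f, x, y}" using fX by blast
      have q: "Q x y = - sgn_at X e * sgn_at X f * c f x y" by (rule Qspec[OF f])
      have cf: "c f y x = - c f x y" by (rule D(3))
      have "Q y x = - sgn_at X e * sgn_at X f * c f y x"
        by (rule Qspec) (use f cf in auto)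
      moreover have "sgn_at X e = 1 \<or> sgn_at X e = -1" by (rule sgn_at_pm[OF e_in[OF f]])
      moreover have "sgn_at X f \<noteq> 0 \<longleftrightarrow> ind e x y" using f_in[OF f] sgn_at_supp by metis
      ultimately show ?thesis using q cf D(1)[of f x y] f(1) sgn_at_val[of X f] False by auto
    qed
    then show "Q x y = 0 \<or> Q x y = 1 \<or> Q x y = -1" "Q x y \<noteq> 0 \<longleftrightarrow> x \<in> ?S \<and> y \<in> ?S \<and> x \<noteq> y \<and> ind e x y"
      "Q y x = - Q x y" by blast+
  qed
  \<comment> \<open>Moving \<open>e\<close> to the front takes one transposition from the second
    place and two from the third.\<close>
  define \<chi> where "\<chi> x y z = (if x = e then Q y z else if y = e then - Q x z else if z = e then Q x y else c x y z)" for x y z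
  have Qe: "Q e x = 0" "Q x e = 0" for x using Qout by auto
  have Qr: "Q x x = 0" for x using Qout by auto
  have v: "\<chi> x y z = 0 \<or> \<chi> x y z = 1 \<or> \<chi> x y z = -1" for x y z
    using Qval[of y z] Qval[of x z] Qval[of x y] D(1)[of x y z] unfolding \<chi>_def by auto
  have a1: "\<chi> y x z = - \<chi> x y z" for x y z
    using D(2)[of x y z] D(2)[of y x z] Qalt[of x y] Qalt[of y x] Qe Qr unfolding \<chi>_def by auto
  have a2: "\<chi> x z y = - \<chi> x y z" for x y z
    using D(3)[of x y z] D(3)[of x z y] Qalt[of z y] Qalt[of y z] Qalt[of x z] Qe Qr unfolding \<chi>_def by auto
  have nz: "\<chi> x y z \<noteq> 0 \<longleftrightarrow> x \<in> E \<and> y \<in> E \<and> z \<in> E \<and> x \<noteq> y \<and> x \<noteq> z \<and> y \<noteq> z \<and> ind x y z" for x y z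
  proof -
    consider "x = e" | "x \<noteq> e" "y = e" | "x \<noteq> e" "y \<noteq> e" "z = e" | "x \<noteq> e" "y \<noteq> e" "z \<noteq> e" by blast
    then show ?thesis
    proof cases
      case 1 then show ?thesis using Qnz[of y z] e unfolding \<chi>_def by auto
    next
      case 2
      have "ind e x z \<longleftrightarrow> ind x y z" using 2 by (simp add: insert_commute)
      then show ?thesis using Qnz[of x z] e 2 unfolding \<chi>_def by auto
    next
      case 3
      have "ind e x y \<longleftrightarrow> ind x y z" using 3 by (simp add: insert_commute)
      then show ?thesis using Qnz[of x y] e 3 unfolding \<chi>_def by auto
    next
      case 4 then show ?thesis using D(4)[of x y z] unfolding \<chi>_def by auto
    qed
  qed
  have rel_e: "\<chi> q x y = - sgn_at X e * sgn_at X q * \<chi> e x y"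
    if h: "X \<in> C" "e \<in> supp X" "q \<in> supp X" "q \<noteq> e" "supp X \<subseteq> {e, q, x, y}" "{q, x, y} \<subseteq> ?S" "q \<noteq> x" "q \<noteq> y" "x \<noteq> y" for X q x y
  proof (cases "c q x y = 0")
    case False
    have "Q x y = - sgn_at X e * sgn_at X q * c q x y" by (rule Qspec[OF False h(1,5)])
    then have "- sgn_at X e * sgn_at X q * Q x y = (sgn_at X e * sgn_at X e) * (sgn_at X q * sgn_at X q) * c q x y"
      by (simp add: mult_ac)
    then show ?thesis using sgn_at_sq[OF h(2)] sgn_at_sq[OF h(3)] h(4,6) unfolding \<chi>_def by auto
  next
    case True
    then have "\<not> ind q x y" using D(4)[of q x y] h by auto
    then have "\<not> ind e x y" using exchange[OF h(1,2,3,5)] h by auto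
    then have "Q x y = 0" using Qnz by blast
    then show ?thesis using True h unfolding \<chi>_def by auto
  qed
  \<comment> \<open>Here \<open>e\<close> is one of the fixed arguments of the circuit relation and
    \<open>p\<close> is exchanged with \<open>q\<close>.\<close>
  have rel_x: "Q q y = - sgn_at X p * sgn_at X q * Q p y"
    if h: "X \<in> C" "p \<in> supp X" "q \<in> supp X" "p \<noteq> q" "supp X \<subseteq> {p, q, e, y}" "{p, q, y} \<subseteq> ?S" "p \<noteq> y" "q \<noteq> y" for X p q y
  proof (cases "c p q y = 0")
    case False
    have cq: "c q p y = - c p q y" by (rule D(2))
    \<comment> \<open>The same circuit \<open>X\<close> computes both values, with \<open>p\<close>
      and with \<open>q\<close> in the role of the auxiliary element.\<close>
    have 1: "Q q y = - sgn_at X e * sgn_at X p * c p q y" by (rule Qspec) (use False h in auto)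
    have 2: "Q p y = - sgn_at X e * sgn_at X q * c q p y" by (rule Qspec) (use False h cq in auto)
    have "- sgn_at X p * sgn_at X q * Q p y = - (sgn_at X q * sgn_at X q) * (sgn_at X e * sgn_at X p * c p q y)"
      unfolding 2 cq by (simp add: mult_ac)
    then show ?thesis unfolding 1 sgn_at_sq[OF h(3)] by auto
  next
    case True
    have iff: "ind e p y \<longleftrightarrow> ind e q y"
    proof -
      have "ind p e y \<longleftrightarrow> ind q e y"
        using exchange[OF h(1,2,3), of e y] exchange[OF h(1,3,2), of e y] h by auto
      then show ?thesis by (simp add: insert_commute)
    qed
    show ?thesis
    proof (cases "ind e p y")
      case False
      then have "Q q y = 0" "Q p y = 0" using iff Qnz by blast+
      then show ?thesis by simp
    next
      case ip: True
      \<comment> \<open>By uniqueness \<open>X\<close> is the circuit on \<open>p, q, y\<close> and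
        avoids \<open>e\<close>. Both values are therefore computed with an auxiliary element
        \<open>f\<close> off this line.\<close>
      have "\<not> ind p q y" using True D(4)[of p q y] h by auto
      then obtain R where R: "R \<in> C" "supp R \<subseteq> {p, q, y}" unfolding not_ind by blast
      have "supp X = supp R"
        by (rule circuit_unique_sgn(2)[OF ip h(1) R(1), of q]) (use h R in auto)
      then have sX: "supp X \<subseteq> {p, q, y}" using R by simp
      have "\<exists>f. c f q y \<noteq> 0" by (rule ext) (use h in auto)
      then obtain f where f: "c f q y \<noteq> 0" ..
      note fn = inS(1,4,5,7)[OF f]
      have fp: "f \<noteq> p" using f True by blast
      have r: "c q f y = - sgn_at X p * sgn_at X q * c p f y"
        by (rule chir_circuit[OF c h(1)]) (use h fn sX in auto)
      have "c f q y = - c q f y" "c f p y = - c p f y" by (rule D(2))+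
      then have r': "c f q y = - sgn_at X p * sgn_at X q * c f p y" using r by simp
      then have f': "c f p y \<noteq> 0" using f by auto
      obtain Z where Z: "Z \<in> C" "supp Z \<subseteq> {e, f, q, y}" using circ4[of e f q y] fn h e by auto
      obtain W where W: "W \<in> C" "supp W \<subseteq> {e, f, p, y}" using circ4[of e f p y] fn fp h e by auto
      have Zin: "e \<in> supp Z" "f \<in> supp Z" using e_in[OF f Z] f_in[OF f Z] iff ip by auto
      \<comment> \<open>Eliminating \<open>q\<close> from \<open>Z\<close> and \<open>X\<close>
        gives a circuit on \<open>e, f, p, y\<close>. As \<open>X\<close> contains neither
        \<open>e\<close> nor \<open>f\<close>, it keeps the signs of \<open>Z\<close> there, and
        uniqueness identifies it with \<open>W\<close> up to sign.\<close>
      have eq: "sgn_at Z e * sgn_at Z f = sgn_at W e * sgn_at W f"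
      proof (cases "q \<in> supp Z")
        case False
        then have "supp Z \<subseteq> {e, f, p, y}" using Z by blast
        then show ?thesis using circuit_unique_sgn(1)[OF inS(7)[OF f'] Z(1) W(1)] W(2) by blast
      next
        case qZ: True
        have en: "e \<notin> supp X" "f \<notin> supp X" using sX fn fp h by auto
        have "Z \<noteq> X" "Z \<noteq> sneg X" using en Zin supp_sneg[of X] by metis+
        then obtain V where V: "V \<in> C" "q \<notin> supp V" "supp V \<subseteq> supp Z \<union> supp X"
          and Vs: "\<And>h. sgn_at V h = 0 \<or> sgn_at V h = sgn_at Z h \<or> sgn_at V h = - (sgn_at Z q * sgn_at X q) * sgn_at X h"
          using elim[OF Z(1) h(1) _ _ qZ h(3)] by metis
        have Vsub: "supp V \<subseteq> {e, f, p, y}" using V Z(2) sX by blast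
        have Vin: "e \<in> supp V" "f \<in> supp V" using e_in[OF f' V(1) Vsub] f_in[OF f' V(1) Vsub] ip by auto
        have "sgn_at X e = 0" "sgn_at X f = 0" "sgn_at V e \<noteq> 0" "sgn_at V f \<noteq> 0" using en Vin sgn_at_supp by metis+
        then have "sgn_at V e = sgn_at Z e" "sgn_at V f = sgn_at Z f" using Vs[of e] Vs[of f] by auto
        then show ?thesis using circuit_unique_sgn(1)[OF inS(7)[OF f'] V(1) W(1) Vsub W(2), of e f] by simp
      qed
      have "Q q y = - (sgn_at Z e * sgn_at Z f) * c f q y" using Qspec[OF f Z] by simp
      moreover have "Q p y = - (sgn_at W e * sgn_at W f) * c f p y" using Qspec[OF f' W] by simp
      ultimately show ?thesis unfolding eq r' by (simp add: mult_ac)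
    qed
  qed
  have circ: "\<chi> q x y = - sgn_at X p * sgn_at X q * \<chi> p x y"
    if h: "X \<in> C" "{p, q, x, y} \<subseteq> E" "p \<noteq> q" "p \<in> supp X" "q \<in> supp X" "supp X \<subseteq> {p, q, x, y}" for X p q x y
  proof (cases "x = y \<or> p = x \<or> p = y \<or> q = x \<or> q = y")
    case True
    have "\<chi> q x y = 0 \<and> \<chi> p x y = 0"
    proof (cases "x = y")
      case True then show ?thesis using nz[of q x x] nz[of p x x] by blast
    next
      case False
      with True have "p = x \<or> p = y \<or> q = x \<or> q = y" by blast
      then show ?thesis
      proof (cases "p = x \<or> p = y")
        case True
        then have "supp X \<subseteq> {q, x, y}" using h by auto
        then have "\<not> ind q x y" using h(1) unfolding om_indep_def by blast
        then show ?thesis using nz[of q x y] nz[of p x y] True by blast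
      next
        case False
        then have qq: "q = x \<or> q = y" using \<open>p = x \<or> p = y \<or> q = x \<or> q = y\<close> by blast
        then have "supp X \<subseteq> {p, x, y}" using h by auto
        then have "\<not> ind p x y" using h(1) unfolding om_indep_def by blast
        then show ?thesis using nz[of q x y] nz[of p x y] qq by blast
      qed
    qed
    then show ?thesis by simp
  next
    case False
    then have n: "x \<noteq> y" "p \<noteq> x" "p \<noteq> y" "q \<noteq> x" "q \<noteq> y" by auto
    consider "p = e" | "q = e" | "x = e" | "y = e" | "e \<notin> {p, q, x, y}" by blast
    then show ?thesis
    proof cases
      case 1 then show ?thesis using rel_e[OF h(1), of q x y] h n by auto
    next
      case 2
      have "\<chi> p x y = - sgn_at X e * sgn_at X p * \<chi> e x y"
        by (rule rel_e[OF h(1)]) (use h n 2 in auto)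
      then have "- sgn_at X p * sgn_at X q * \<chi> p x y = (sgn_at X p * sgn_at X p) * (sgn_at X q * sgn_at X q) * \<chi> q x y"
        using 2 by (simp add: mult_ac)
      then show ?thesis using sgn_at_sq[OF h(4)] sgn_at_sq[OF h(5)] by simp
    next
      case 3
      have "Q q y = - sgn_at X p * sgn_at X q * Q p y"
        by (rule rel_x[OF h(1)]) (use h n 3 in auto)
      then show ?thesis using 3 n unfolding \<chi>_def by auto
    next
      case 4
      have "Q q x = - sgn_at X p * sgn_at X q * Q p x"
        by (rule rel_x[OF h(1)]) (use h n 4 in auto)
      then show ?thesis using 4 n unfolding \<chi>_def by auto
    next
      case 5
      have "c q x y = - sgn_at X p * sgn_at X q * c p x y"
        by (rule chir_circuit[OF c h(1)]) (use h n 5 in auto)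
      then show ?thesis using 5 unfolding \<chi>_def by auto
    qed
  qed
  have "chir C E \<chi>" by (rule chirI[OF v a1 a2 nz circ])
  then show thesis by (rule that)
qed

end

section \<open>Translating positivity\<close>

lemma pos_on_sortedI:
  assumes alt: "\<And>x y z. \<chi> y x z = - \<chi> x y z" "\<And>x y z. \<chi> x z y = - \<chi> x y z" and inj: "inj_on h S"
    and srt: "\<And>x y z. x \<in> S \<Longrightarrow> y \<in> S \<Longrightarrow> z \<in> S \<Longrightarrow> h x < h y \<Longrightarrow> h y < h z \<Longrightarrow> 0 \<le> \<chi> x y z"
  shows "pos_on S \<chi> h"
  unfolding pos_on_def
proof (intro conjI ballI inj)
  fix x y z assume S: "x \<in> S" "y \<in> S" "z \<in> S"
  have c: "\<chi> y z x = \<chi> x y z" for x y z using alt[of x y z] alt[of y x z] by simp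
  have pos: "0 \<le> \<chi> x y z * sg3 (h x) (h y) (h z)"
    if "h x < h y" "h y < h z" "x \<in> S" "y \<in> S" "z \<in> S" for x y z using srt[OF that(3-5,1,2)] that by simp
  consider "h x = h y \<or> h x = h z \<or> h y = h z" | "h x < h y" "h y < h z" | "h x < h z" "h z < h y"
    | "h y < h x" "h x < h z" | "h y < h z" "h z < h x" | "h z < h x" "h x < h y" | "h z < h y" "h y < h x" by linarith
  then show "0 \<le> \<chi> x y z * sg3 (h x) (h y) (h z)"
  proof cases
    case 1 then show ?thesis by auto
  next
    case 2 then show ?thesis by (rule pos[OF _ _ S])
  next
    case 3
    then have "0 \<le> \<chi> x z y * sg3 (h x) (h z) (h y)" by (rule pos[OF _ _ S(1,3,2)])
    then show ?thesis using alt(2)[of x z y] sg3_swap(2)[of "h x" "h z" "h y"] by simp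
  next
    case 4
    then have "0 \<le> \<chi> y x z * sg3 (h y) (h x) (h z)" by (rule pos[OF _ _ S(2,1,3)])
    then show ?thesis using alt(1)[of y x z] sg3_swap(1)[of "h y" "h x" "h z"] by simp
  next
    case 5
    then have "0 \<le> \<chi> y z x * sg3 (h y) (h z) (h x)" by (rule pos[OF _ _ S(2,3,1)])
    then show ?thesis using c[of y z x] sg3_cyc[of "h y" "h z" "h x"] by simp
  next
    case 6
    then have "0 \<le> \<chi> z x y * sg3 (h z) (h x) (h y)" by (rule pos[OF _ _ S(3,1,2)])
    then show ?thesis using c[of x y z] c[of z x y] sg3_cyc[of "h x" "h y" "h z"] sg3_cyc[of "h z" "h x" "h y"] by simp
  next
    case 7
    then have "0 \<le> \<chi> z y x * sg3 (h z) (h y) (h x)" by (rule pos[OF _ _ S(3,2,1)])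
    moreover have "\<chi> z y x = - \<chi> x y z" using c[of x z y] alt(1)[of y z x] alt(2)[of z x y] c alt by metis
    moreover have "sg3 (h z) (h y) (h x) = - sg3 (h x) (h y) (h z)"
      using sg3_cyc[of "h z" "h y" "h x"] sg3_swap by metis
    ultimately show ?thesis by simp
  qed
qed

lemma om_rank_eqI:
  assumes f: "finite E" and le: "\<And>I. I \<subseteq> E \<Longrightarrow> om_indep C I \<Longrightarrow> card I \<le> n"
    and ex: "J \<subseteq> E" "om_indep C J" "card J = n"
  shows "om_rank E C = n"
  unfolding om_rank_def by (rule Max_eqI) (use assms in \<open>auto simp: finite_subset intro: finite_subset[of _ "{..n}"]\<close>)

lemma supp_relabel: "supp (relabel s X) = s ` supp X"
  unfolding supp_def relabel_def by auto

lemma supp_reorient: "supp (reorient A X) = supp X"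
  unfolding supp_def reorient_def by auto

lemma sgn_at_reorient:
  assumes "fst X \<inter> snd X = {}"
  shows "sgn_at (reorient A X) p = (if p \<in> A then -1 else 1) * sgn_at X p"
  using assms unfolding sgn_at_def reorient_def by auto

lemma sgn_at_relabel:
  assumes s: "inj_on s S" and X: "supp X \<subseteq> S" and p: "p \<in> S"
  shows "sgn_at (relabel s X) (s p) = sgn_at X p"
proof -
  have "s p \<in> s ` fst X \<longleftrightarrow> p \<in> fst X" "s p \<in> s ` snd X \<longleftrightarrow> p \<in> snd X"
    by (rule inj_on_image_mem_iff[OF s p]; use X in \<open>auto simp: supp_def\<close>)+
  then show ?thesis unfolding sgn_at_def relabel_def by simp
qed

section \<open>Passing between isomorphisms of circuits and signs of chirotopes\<close>

context om3
begin

text \<open>The basis avoiding \<open>e\<close> ensures that the deletion has rank 3, so that the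
  chirotope of the isomorphic copy is a map on triples. Pulled back along \<open>s\<close> it is
  positive; with the reorientation undone it is a chirotope of the circuits in
  \<open>C\<close>.\<close>

lemma chirotope_of_deletion:
  assumes del: "iso_to_positively_oriented (E - {e}) {X \<in> C. e \<notin> supp X}"
    and b: "{a, b, d} \<subseteq> E - {e}" "a \<noteq> b" "a \<noteq> d" "b \<noteq> d" "ind a b d"
  obtains c r h where "sign_fun r" "chir C (E - {e}) c" "pos_on (E - {e}) (resign r c) h"
proof -
  let ?S = "E - {e}" let ?D = "{X \<in> C. e \<notin> supp X}"
  obtain E' :: "'a set" and C' where pos: "positively_oriented E' C'" and iso: "om_iso ?S ?D E' C'"
    using del unfolding iso_to_positively_oriented_def by blast
  obtain A s where s: "bij_betw s ?S E'" and C': "C' = (\<lambda>X. relabel s (reorient A X)) ` ?D"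
    using iso unfolding om_iso_def by blast
  have inj: "inj_on s ?S" and im: "s ` ?S = E'" using s unfolding bij_betw_def by auto
  have suppD: "supp X \<subseteq> ?S" if "X \<in> ?D" for X using supp_E that by blast
  have ind: "om_indep C' (s ` I) \<longleftrightarrow> om_indep C I" if I: "I \<subseteq> ?S" for I
  proof -
    have "om_indep C' (s ` I) \<longleftrightarrow> (\<forall>X\<in>?D. \<not> s ` supp X \<subseteq> s ` I)"
      unfolding om_indep_def C' by (simp add: supp_relabel supp_reorient)
    also have "\<dots> \<longleftrightarrow> (\<forall>X\<in>?D. \<not> supp X \<subseteq> I)"
    proof (rule ball_cong[OF refl])
      fix X assume "X \<in> ?D"
      then have "supp X \<subseteq> ?S" by (rule suppD)
      then have "s ` supp X \<subseteq> s ` I \<longleftrightarrow> supp X \<subseteq> I"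
        using inj I inj_on_image_mem_iff[OF inj _ I] by blast
      then show "(\<not> s ` supp X \<subseteq> s ` I) = (\<not> supp X \<subseteq> I)" by simp
    qed
    also have "\<dots> \<longleftrightarrow> om_indep C I" unfolding om_indep_def using I by auto
    finally show ?thesis .
  qed
  have cardI: "card (s ` I) = card I" if "I \<subseteq> ?S" for I
    by (rule card_image) (rule inj_on_subset[OF inj that])
  have rank: "om_rank E' C' = 3"
  proof (rule om_rank_eqI)
    show "finite E'" using finE im by auto
    show "card J \<le> 3" if J: "J \<subseteq> E'" "om_indep C' J" for J
    proof -
      obtain I where I: "I \<subseteq> ?S" "J = s ` I" using J(1) im by (metis subset_imageE)
      then show ?thesis using J(2) ind[OF I(1)] rank_le[of I] cardI[OF I(1)] by auto
    qed
    show "s ` {a, b, d} \<subseteq> E'" using b im by blast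
    show "om_indep C' (s ` {a, b, d})" using ind[OF b(1)] b(5) by blast
    show "card (s ` {a, b, d}) = 3" using cardI[OF b(1)] b by simp
  qed
  obtain ord chi where ord: "inj_on ord E'" and chi: "chirotope_of E' C' chi"
    and p: "\<forall>xs. set xs \<subseteq> E' \<and> length xs = 3 \<and> sorted_wrt (\<lambda>x y. (ord x :: nat) < ord y) xs \<longrightarrow> chi xs \<ge> 0"
    using pos unfolding positively_oriented_def rank by blast
  note ch = chi[unfolded chirotope_of_def rank Let_def]
  have ch_val: "chi xs = -1 \<or> chi xs = 0 \<or> chi xs = 1" for xs
    using ch[THEN conjunct1, rule_format, of xs] by blast
  have ch_nz: "chi xs \<noteq> 0 \<longleftrightarrow> distinct xs \<and> om_basis E' C' (set xs)" if "set xs \<subseteq> E'" "length xs = 3" for xs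
    using ch[THEN conjunct2, THEN conjunct1, rule_format, of xs] that by blast
  have ch_alt: "chi (xs[i := xs ! j, j := xs ! i]) = - chi xs" if "set xs \<subseteq> E'" "length xs = 3" "i < j" "j < 3" for xs i j
    using ch[THEN conjunct2, THEN conjunct2, THEN conjunct1, rule_format, of xs i j] that by blast
  have ch_circ: "chi (f # xs) = - sgn_at X p * sgn_at X f * chi (p # xs)"
    if "X \<in> C'" "p \<in> supp X" "f \<in> supp X" "p \<noteq> f" "set xs \<subseteq> E'" "length xs + 1 = 3" "supp X \<subseteq> {p, f} \<union> set xs" for X p f xs
    by (rule ch[THEN conjunct2, THEN conjunct2, THEN conjunct2, rule_format, OF that(1)]) (use that in simp)
  define r :: "'a \<Rightarrow> int" where "r x = (if x \<in> A then -1 else 1)" for x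
  have r: "sign_fun r" unfolding sign_fun_def r_def by simp
  \<comment> \<open>The factors \<open>r\<close> undo the reorientation by \<open>A\<close>;
    applying \<open>resign r\<close> once more restores the positive map.\<close>
  define c where "c x y z = (if x \<in> ?S \<and> y \<in> ?S \<and> z \<in> ?S then r x * r y * r z * chi [s x, s y, s z] else 0)" for x y z
  have sE: "s x \<in> E'" if "x \<in> ?S" for x using im that by blast
  have rpm: "r x = 1 \<or> r x = -1" for x unfolding r_def by simp
  have seq: "s x = s y \<longleftrightarrow> x = y" if "x \<in> ?S" "y \<in> ?S" for x y using inj that unfolding inj_on_def by blast
  have v: "c x y z = 0 \<or> c x y z = 1 \<or> c x y z = -1" for x y z
    using rpm[of x] rpm[of y] rpm[of z] ch_val[of "[s x, s y, s z]"] unfolding c_def by auto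
  have a1: "c y x z = - c x y z" for x y z
    using ch_alt[of "[s x, s y, s z]" 0 1] sE[of x] sE[of y] sE[of z] unfolding c_def by (simp add: mult_ac)
  have a2: "c x z y = - c x y z" for x y z
    using ch_alt[of "[s x, s y, s z]" 1 2] sE[of x] sE[of y] sE[of z] unfolding c_def by (simp add: mult_ac numeral_2_eq_2)
  have nz: "c x y z \<noteq> 0 \<longleftrightarrow> x \<in> ?S \<and> y \<in> ?S \<and> z \<in> ?S \<and> x \<noteq> y \<and> x \<noteq> z \<and> y \<noteq> z \<and> om_indep C {x, y, z}" for x y z
  proof (cases "x \<in> ?S \<and> y \<in> ?S \<and> z \<in> ?S")
    case False
    then show ?thesis unfolding c_def by auto
  next
    case True
    then have I: "{x, y, z} \<subseteq> ?S" by blast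
    have "c x y z \<noteq> 0 \<longleftrightarrow> chi [s x, s y, s z] \<noteq> 0"
      using True rpm[of x] rpm[of y] rpm[of z] unfolding c_def by auto
    also have "\<dots> \<longleftrightarrow> distinct [s x, s y, s z] \<and> om_basis E' C' (s ` {x, y, z})"
      using ch_nz[of "[s x, s y, s z]"] sE True by simp
    also have "\<dots> \<longleftrightarrow> x \<noteq> y \<and> x \<noteq> z \<and> y \<noteq> z \<and> om_indep C {x, y, z}"
    proof -
      have "distinct [s x, s y, s z] \<longleftrightarrow> x \<noteq> y \<and> x \<noteq> z \<and> y \<noteq> z" using seq True by auto
      moreover have "om_basis E' C' (s ` {x, y, z}) \<longleftrightarrow> om_indep C {x, y, z} \<and> card {x, y, z} = 3"
        unfolding om_basis_def rank ind[OF I] cardI[OF I] using I im by blast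
      ultimately show ?thesis by auto
    qed
    finally show ?thesis using True by blast
  qed
  have circ: "c f x y = - sgn_at X p * sgn_at X f * c p x y"
    if h: "X \<in> C" "{p, f, x, y} \<subseteq> ?S" "p \<noteq> f" "p \<in> supp X" "f \<in> supp X" "supp X \<subseteq> {p, f, x, y}" for X p f x y
  proof -
    let ?Y = "relabel s (reorient A X)"
    have S: "p \<in> ?S" "f \<in> ?S" "x \<in> ?S" "y \<in> ?S" "supp X \<subseteq> ?S" using h by auto
    have Y: "?Y \<in> C'" unfolding C' using h S by blast
    have sY: "supp ?Y = s ` supp X" by (simp add: supp_relabel supp_reorient)
    have sg: "sgn_at ?Y (s q) = r q * sgn_at X q" if "q \<in> ?S" for q
      using sgn_at_relabel[OF inj _ that, of "reorient A X"] sgn_at_reorient[OF disj[OF h(1)], of A q] S(5)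
      unfolding supp_reorient r_def by simp
    have "chi [s f, s x, s y] = - sgn_at ?Y (s p) * sgn_at ?Y (s f) * chi [s p, s x, s y]"
    proof (rule ch_circ[OF Y])
      show "s p \<in> supp ?Y" "s f \<in> supp ?Y" unfolding sY using h by blast+
      show "s p \<noteq> s f" using seq S h by blast
      show "set [s x, s y] \<subseteq> E'" using sE S by simp
      show "supp ?Y \<subseteq> {s p, s f} \<union> set [s x, s y]" unfolding sY using h(6) by auto
    qed simp
    then have "c f x y = - (r f * r f) * (r x * r y * (r p * sgn_at X p) * sgn_at X f * chi [s p, s x, s y])"
      using S unfolding c_def sg[OF S(1)] sg[OF S(2)] by (simp add: mult_ac)
    also have "\<dots> = - sgn_at X p * sgn_at X f * c p x y"
      using S sign_fun_sq[OF r, of f] unfolding c_def by (simp add: mult_ac)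
    finally show ?thesis .
  qed
  have chirc: "chir C ?S c" by (rule chirI[OF v a1 a2 nz circ])
  define h where "h x = int (ord (s x))" for x
  have "pos_on ?S (resign r c) h"
  proof (rule pos_on_sortedI)
    show "resign r c y x z = - resign r c x y z" for x y z unfolding resign_def by (subst a1) simp
    show "resign r c x z y = - resign r c x y z" for x y z unfolding resign_def by (subst a2) simp
    show "inj_on h ?S" unfolding inj_on_def h_def using ord inj im unfolding inj_on_def by auto
    fix x y z assume xyz: "x \<in> ?S" "y \<in> ?S" "z \<in> ?S" "h x < h y" "h y < h z"
    then have "0 \<le> chi [s x, s y, s z]" using p[rule_format, of "[s x, s y, s z]"] sE unfolding h_def by simp
    moreover have "resign r c x y z = (r x * r x) * (r y * r y) * (r z * r z) * chi [s x, s y, s z]"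
      unfolding resign_def c_def using xyz by (simp add: mult_ac)
    ultimately show "0 \<le> resign r c x y z" using sign_fun_sq[OF r] by simp
  qed
  then show thesis using that[OF r chirc] by blast
qed

lemma pos_iso_deletion:
  assumes c: "chir C E \<chi>" and del: "iso_to_positively_oriented (E - {e}) {X \<in> C. e \<notin> supp X}"
  shows "pos_iso (E - {e}) \<chi>"
proof (cases "\<exists>a\<in>E - {e}. \<exists>b\<in>E - {e}. \<exists>d\<in>E - {e}. \<chi> a b d \<noteq> 0")
  \<comment> \<open>If the deletion contains no basis, \<open>\<chi>\<close> vanishes on it and any
    injective numbering will do.\<close>
  case False
  have "finite (E - {e})" using finE by simp
  then obtain f :: "'a \<Rightarrow> nat" where "inj_on f (E - {e})" using finite_imp_inj_to_nat_seg by blast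
  then have "inj_on (\<lambda>x. int (f x)) (E - {e})" unfolding inj_on_def by simp
  then have "pos_on (E - {e}) \<chi> (\<lambda>x. int (f x))" unfolding pos_on_def using False by auto
  then show ?thesis by (rule pos_iso_of_pos_on)
next
  case True
  then obtain a b d where b: "a \<in> E - {e}" "b \<in> E - {e}" "d \<in> E - {e}" "\<chi> a b d \<noteq> 0" by blast
  have abd: "{a, b, d} \<subseteq> E - {e}" using b by blast
  have n: "a \<noteq> b" "a \<noteq> d" "b \<noteq> d" "ind a b d" using iffD1[OF chirD(4)[OF c] b(4)] by blast+
  obtain \<delta> r h where d: "sign_fun r" "chir C (E - {e}) \<delta>" "pos_on (E - {e}) (resign r \<delta>) h"
    by (rule chirotope_of_deletion[OF del abd n])
  obtain \<epsilon> where eps: "\<epsilon> = 1 \<or> \<epsilon> = -1" "\<And>x y z. x \<in> E - {e} \<Longrightarrow> y \<in> E - {e} \<Longrightarrow> z \<in> E - {e} \<Longrightarrow> \<delta> x y z = \<epsilon> * \<chi> x y z"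
    by (rule chir_unique[OF c d(2)]) blast+
  \<comment> \<open>The global sign is absorbed by multiplying every sign by
    \<open>\<epsilon>\<close>, as its third power is \<open>\<epsilon>\<close> again.\<close>
  define R where "R x = \<epsilon> * r x" for x
  have R: "sign_fun R" unfolding R_def by (rule sign_fun_mult[OF _ d(1)]) (use eps in \<open>simp add: sign_fun_def\<close>)
  have "resign R \<chi> x y z = resign r \<delta> x y z" if "x \<in> E - {e}" "y \<in> E - {e}" "z \<in> E - {e}" for x y z
    using eps(1) eps(2)[OF that] unfolding resign_def R_def by (elim disjE) simp_all
  then have "pos_on (E - {e}) (resign R \<chi>) h" using d(3) unfolding pos_on_def by simp
  then show ?thesis unfolding pos_iso_def using R by blast
qed

text \<open>Reorientation commutes with negation and preserves supports. In the elimination axiom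
  the two circuits change roles when the eliminated element is in \<open>A\<close>.\<close>

lemma oriented_matroid_reorient: "oriented_matroid E (reorient A ` C)"
proof -
  have 1: "sneg (reorient A X) = reorient A (sneg X)" for X :: "'a signed_set"
    unfolding sneg_def reorient_def by simp
  have 2: "reorient A X = ({}, {}) \<longleftrightarrow> X = ({}, {})" for X :: "'a signed_set"
    unfolding reorient_def by (cases X) auto
  have 3: "fst (reorient A X) \<inter> snd (reorient A X) = {}" if "fst X \<inter> snd X = {}" for X :: "'a signed_set"
    using that unfolding reorient_def by auto
  have 4: "\<exists>Z\<in>C. fst (reorient A Z) \<subseteq> (fst (reorient A X) \<union> fst (reorient A Y)) - {g} \<and>
      snd (reorient A Z) \<subseteq> (snd (reorient A X) \<union> snd (reorient A Y)) - {g}"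
    if XY: "X \<in> C" "Y \<in> C" "X \<noteq> sneg Y" and g: "g \<in> fst (reorient A X) \<inter> snd (reorient A Y)" for X Y g
  proof -
    have "\<exists>Z\<in>C. fst Z \<subseteq> (fst X \<union> fst Y) - {g} \<and> snd Z \<subseteq> (snd X \<union> snd Y) - {g}"
    proof (cases "g \<in> A")
      case False
      then have "g \<in> fst X \<inter> snd Y" using g unfolding reorient_def by auto
      then show ?thesis using signed_elim XY by blast
    next
      case True
      then have "g \<in> fst Y \<inter> snd X" using g unfolding reorient_def by auto
      moreover have "Y \<noteq> sneg X" using XY(3) by auto
      ultimately have "\<exists>Z\<in>C. fst Z \<subseteq> (fst Y \<union> fst X) - {g} \<and> snd Z \<subseteq> (snd Y \<union> snd X) - {g}"
        using signed_elim XY(1,2) by blast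
      then show ?thesis by (simp only: Un_commute)
    qed
    then obtain Z where "Z \<in> C" "fst Z \<subseteq> (fst X \<union> fst Y) - {g}" "snd Z \<subseteq> (snd X \<union> snd Y) - {g}" by blast
    then show ?thesis unfolding reorient_def by (intro bexI[of _ Z]) auto
  qed
  show ?thesis unfolding oriented_matroid_def
  proof (intro conjI ballI allI impI)
    show "finite E" by (rule finE)
    show "({}, {}) \<notin> reorient A ` C" using no_empty 2 by (metis imageE)
  next
    fix X assume "X \<in> reorient A ` C"
    then obtain X0 where X0: "X0 \<in> C" "X = reorient A X0" by blast
    show "fst X \<inter> snd X = {}" unfolding X0 by (rule 3[OF disj[OF X0(1)]])
    show "supp X \<subseteq> E" unfolding X0 supp_reorient by (rule supp_E[OF X0(1)])
    show "sneg X \<in> reorient A ` C" unfolding X0 1 using sneg_C[OF X0(1)] by blast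
  next
    fix X Y assume "X \<in> reorient A ` C" "Y \<in> reorient A ` C" and s: "supp X \<subseteq> supp Y"
    then obtain X0 Y0 where X0: "X0 \<in> C" "X = reorient A X0" and Y0: "Y0 \<in> C" "Y = reorient A Y0" by blast
    have "supp X0 \<subseteq> supp Y0" using s unfolding X0 Y0 supp_reorient .
    then have "X0 = Y0 \<or> X0 = sneg Y0" using incomparable X0(1) Y0(1) by blast
    then show "X = Y \<or> X = sneg Y" unfolding X0 Y0 1 by metis
  next
    fix X Y g assume "X \<in> reorient A ` C" "Y \<in> reorient A ` C" and g: "X \<noteq> sneg Y \<and> g \<in> fst X \<inter> snd Y"
    then obtain X0 Y0 where X0: "X0 \<in> C" "X = reorient A X0" and Y0: "Y0 \<in> C" "Y = reorient A Y0" by blast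
    have "X0 \<noteq> sneg Y0" using g unfolding X0 Y0 1 by metis
    then show "\<exists>Z\<in>reorient A ` C. fst Z \<subseteq> fst X \<union> fst Y - {g} \<and> snd Z \<subseteq> snd X \<union> snd Y - {g}"
      using 4[OF X0(1) Y0(1)] g unfolding X0 Y0 by blast
  qed
qed

text \<open>The isomorphic copy lives on \<open>E\<close> itself: reorient where \<open>r\<close> is
  -1 and relabel by the identity. The integer order is shifted by its minimum to take values in the
  natural numbers.\<close>

lemma iso_to_positively_oriented_of_pos_iso:
  assumes c: "chir C E \<chi>" and rank: "om_rank E C = 3" and pos: "pos_iso E \<chi>"
  shows "iso_to_positively_oriented E C"
proof -
  obtain r h where r: "sign_fun r" and h: "pos_on E (resign r \<chi>) h" using pos unfolding pos_iso_def by blast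
  note D = chirD[OF c]
  define A where "A = {x\<in>E. r x = -1}"
  let ?C = "reorient A ` C"
  have rA: "(if x \<in> A then -1 else 1) = r x" if "x \<in> E" for x
    using that r unfolding A_def sign_fun_def by auto
  have ind: "om_indep ?C I \<longleftrightarrow> om_indep C I" for I
    unfolding om_indep_def by (simp add: supp_reorient)
  have rk: "om_rank E ?C = 3" using rank unfolding om_rank_def ind .
  define \<rho> where "\<rho> = resign r \<chi>"
  define chi where "chi xs = (if length xs = 3 then \<rho> (xs ! 0) (xs ! 1) (xs ! 2) else 0)" for xs
  have rpm: "r x = 1 \<or> r x = -1" for x using r unfolding sign_fun_def by blast
  have nz: "\<rho> x y z \<noteq> 0 \<longleftrightarrow> x \<in> E \<and> y \<in> E \<and> z \<in> E \<and> x \<noteq> y \<and> x \<noteq> z \<and> y \<noteq> z \<and> om_indep C {x, y, z}" for x y z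
    using D(4)[of x y z] rpm[of x] rpm[of y] rpm[of z] unfolding \<rho>_def resign_def by auto
  have a1: "\<rho> y x z = - \<rho> x y z" and a2: "\<rho> x z y = - \<rho> x y z" for x y z
    unfolding \<rho>_def resign_def using D(2)[of y x z] D(3)[of x z y] by (simp_all add: mult_ac)
  have v: "\<rho> x y z = 0 \<or> \<rho> x y z = 1 \<or> \<rho> x y z = -1" for x y z
    using D(1)[of x y z] rpm[of x] rpm[of y] rpm[of z] unfolding \<rho>_def resign_def by auto
  have list3: "\<exists>x y z. xs = [x, y, z]" if "length xs = 3" for xs :: "'a list"
    using that by (auto simp: numeral_3_eq_3 length_Suc_conv)
  have list2: "\<exists>x y. xs = [x, y]" if "length xs + 1 = 3" for xs :: "'a list"
    using that by (auto simp: numeral_3_eq_3 length_Suc_conv)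
  have chi3: "chi [x, y, z] = \<rho> x y z" for x y z unfolding chi_def by (simp add: numeral_2_eq_2)
  have "chirotope_of E ?C chi"
    unfolding chirotope_of_def rk Let_def
  proof (intro conjI allI ballI impI)
    fix xs show "chi xs \<in> {-1, 0, 1}" using v unfolding chi_def by auto
  next
    fix xs :: "'a list" assume xs: "set xs \<subseteq> E \<and> length xs = 3"
    then obtain x y z where x: "xs = [x, y, z]" using list3 by blast
    show "(chi xs \<noteq> 0) = (distinct xs \<and> om_basis E ?C (set xs))"
      unfolding x chi3 nz om_basis_def rk ind using xs x by auto
  next
    fix xs :: "'a list" and i j :: nat assume xs: "set xs \<subseteq> E \<and> length xs = 3 \<and> i < j \<and> j < 3"
    then obtain x y z where x: "xs = [x, y, z]" using list3 by blast
    have "i = 0 \<and> j = 1 \<or> i = 0 \<and> j = 2 \<or> i = 1 \<and> j = 2" using xs by auto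
    moreover have "\<rho> z y x = - \<rho> x y z"
      using a1[of z y x] a2[of y z x] a1[of y x z] by simp
    ultimately show "chi (xs[i := xs ! j, j := xs ! i]) = - chi xs"
      unfolding x using a1[of y x z] a2[of x z y]
      by (elim disjE conjE) (simp_all add: numeral_2_eq_2 chi3)
  next
    fix X p f xs assume X: "X \<in> ?C"
      and h: "p \<in> supp X \<and> f \<in> supp X \<and> p \<noteq> f \<and> set xs \<subseteq> E \<and> length xs + 1 = 3 \<and> supp X \<subseteq> {p, f} \<union> set xs"
    obtain x y where x: "xs = [x, y]" using list2 h by blast
    obtain Y where Y: "Y \<in> C" "X = reorient A Y" using X by blast
    have pf: "p \<in> supp Y" "f \<in> supp Y" "supp Y \<subseteq> {p, f, x, y}" using h unfolding Y supp_reorient x by auto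
    then have E: "p \<in> E" "f \<in> E" using supp_E[OF Y(1)] by blast+
    have "\<chi> f x y = - sgn_at Y p * sgn_at Y f * \<chi> p x y"
      by (rule chir_circuit[OF c Y(1)]) (use pf E h x in auto)
    moreover have "sgn_at X p = r p * sgn_at Y p" "sgn_at X f = r f * sgn_at Y f"
      unfolding Y sgn_at_reorient[OF disj[OF Y(1)]] using rA E by simp_all
    ultimately have "- sgn_at X p * sgn_at X f * \<rho> p x y = (r p * r p) * \<rho> f x y"
      unfolding \<rho>_def resign_def by (simp add: mult_ac)
    then show "chi (f # xs) = - sgn_at X p * sgn_at X f * chi (p # xs)"
      unfolding x chi3 using sign_fun_sq[OF r] by simp
  qed
  moreover obtain m where m: "\<And>x. x \<in> E \<Longrightarrow> m \<le> h x"
  proof -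
    have "finite (h ` E)" using finE by simp
    then show thesis using that[of "Min (h ` E)"] by simp
  qed
  define ord where "ord x = nat (h x - m)" for x
  have hinj: "inj_on h E" using h unfolding pos_on_def by blast
  have oi: "inj_on ord E"
  proof (rule inj_onI)
    fix x y assume a: "x \<in> E" "y \<in> E" "ord x = ord y"
    then have "h x = h y" using m[of x] m[of y] unfolding ord_def by simp
    then show "x = y" using hinj a unfolding inj_on_def by blast
  qed
  have op: "0 \<le> chi xs" if xs: "set xs \<subseteq> E \<and> length xs = 3 \<and> sorted_wrt (\<lambda>x y. ord x < ord y) xs" for xs
  proof -
    obtain x y z where x: "xs = [x, y, z]" using list3 xs by blast
    then have "x \<in> E" "y \<in> E" "z \<in> E" "h x < h y" "h y < h z" using xs m unfolding ord_def by auto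
    then show ?thesis unfolding x chi3 \<rho>_def using pos_on_sorted[OF h] by blast
  qed
  ultimately have po: "positively_oriented E ?C" unfolding positively_oriented_def rk using oi by blast
  have "relabel (\<lambda>x. x) X = X" for X :: "'a signed_set" unfolding relabel_def by simp
  then have "om_iso E C E ?C" unfolding om_iso_def
    by (intro exI[of _ A] exI[of _ "\<lambda>x. x"]) (auto simp: A_def bij_betw_def)
  then show ?thesis unfolding iso_to_positively_oriented_def using po oriented_matroid_reorient by blast
qed

end

theorem theorem11p4:
  fixes E :: "'a set" and C :: "'a signed_set set"
  assumes "oriented_matroid E C"
    and "simple_om E C"
    and "om_rank E C = 3"
    and "card E \<ge> 7"
    and "almost_positively_oriented E C"
  shows "iso_to_positively_oriented E C"
proof -
  have finE: "finite E" using assms(1) unfolding oriented_matroid_def by (elim conjE)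
  let ?R = "{card I | I. I \<subseteq> E \<and> om_indep C I}"
  have "?R \<subseteq> card ` Pow E" by blast
  then have fR: "finite ?R" by (rule finite_subset) (simp add: finE)
  have "({}, {}) \<notin> C" using assms(1) unfolding oriented_matroid_def by (elim conjE)
  then have "om_indep C {}" unfolding om_indep_def supp_def by (metis Un_empty prod.collapse subset_empty)
  then have "card {} \<in> ?R" by (intro CollectI exI[of _ "{}"]) simp
  then have "?R \<noteq> {}" by (metis empty_iff)
  then have "3 \<in> ?R" using Max_in[OF fR] assms(3) unfolding om_rank_def by simp
  then obtain I where I: "I \<subseteq> E" "om_indep C I" "card I = 3" by auto
  then obtain a b d where abd: "I = {a, b, d}" "a \<noteq> b" "a \<noteq> d" "b \<noteq> d" unfolding card_3_iff by blast
  have le: "card I \<le> 3" if "I \<subseteq> E" "om_indep C I" for I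
    using Max_ge[OF fR, of "card I"] that assms(3) unfolding om_rank_def by auto
  interpret om3 E C by unfold_locales (use assms le in auto)
  have del: "iso_to_positively_oriented (E - {e}) {X \<in> C. e \<notin> supp X}" if "e \<in> E" for e
    using assms(5) that unfolding almost_positively_oriented_def deletion_def by simp
  \<comment> \<open>An element outside a basis, so that its deletion still has rank 3 and provides
    the chirotope that is extended to \<open>E\<close>.\<close>
  obtain e where e: "e \<in> E" "e \<notin> I" using ex_notin_list[of "[a, b, d]" E] assms(4) abd(1) by auto
  have base: "{a, b, d} \<subseteq> E - {e}" "ind a b d" using I e abd by auto
  obtain c where c: "chir C (E - {e}) c"
    by (rule chirotope_of_deletion[OF del[OF e(1)] base(1) abd(2-4) base(2)])
  have "c a b d \<noteq> 0" using chirD(4)[OF c, of a b d] base abd by blast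
  then obtain \<chi> where chi: "chir C E \<chi>" using chir_extend[OF c e(1)] by blast
  have "\<chi> a b d \<noteq> 0" using chirD(4)[OF chi, of a b d] base abd by blast
  then interpret chiro E \<chi> by (rule chiro_of_chir[OF chi])
  have "pos_iso E \<chi>" using pos_iso_of_deletions assms(4) pos_iso_deletion[OF chi del] by blast
  then show ?thesis by (rule iso_to_positively_oriented_of_pos_iso[OF chi assms(3)])
qed

end
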